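(* Let $p$ and $q$ be different primes and $v\ge 1$ an integer. Let $G$ be a Schmidt group with parameters $p,q,v$ and let $H$ be an arbitrary group such that the semigroups $\mathrm{End}(G)$ and $\mathrm{End}(H)$ are isomorphic. Then $H$ is a Schmidt group with parameters $p,q$ and $v$.
   Context: A Schmidt group is a non-nilpotent finite group in which each proper subgroup is nilpotent. Every Schmidt group $G$ is a semidirect product of its derived subgroup $G'$ (normal), which is a $p$-group, and a cyclic group $\langle b\rangle$ of order $q^v$, for some different primes $p,q$ and some integer $v\ge 1$; these $p,q,v$ are called the parameters of $G$. $\mathrm{End}(G)$ is the semigroup of all endomorphisms of $G$ under composition. Maps are written to the right of their arguments, so $xy$ means first $x$, then $y$ (the same convention for all groups). *)

theory Defs
  imports "HOL-Algebra.Elementary_Groups" "HOL-Computational_Algebra.Primes"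
begin

text \<open>
  HOL-Algebra has no nilpotent groups; they are introduced through the lower central series
  $\gamma_0(G) = G$, $\gamma_{n+1}(G) = [\gamma_n(G), G]$. The commutator is written
  $x y x^{-1} y^{-1}$, as in the library's \<^const>\<open>derived\<close>; the other usual convention
  generates the same subgroups.
\<close>

primrec lower_central :: "('a, 'm) monoid_scheme \<Rightarrow> nat \<Rightarrow> 'a set" where
  "lower_central G 0 = carrier G"
| "lower_central G (Suc n) =
     generate G (\<Union>x \<in> lower_central G n. \<Union>y \<in> carrier G.
       {x \<otimes>\<^bsub>G\<^esub> y \<otimes>\<^bsub>G\<^esub> (inv\<^bsub>G\<^esub> x) \<otimes>\<^bsub>G\<^esub> (inv\<^bsub>G\<^esub> y)})"

definition nilpotent_group :: "('a, 'm) monoid_scheme \<Rightarrow> bool" where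
  "nilpotent_group G \<longleftrightarrow> group G \<and> (\<exists>n. lower_central G n = {\<one>\<^bsub>G\<^esub>})"

definition Schmidt_group :: "('a, 'm) monoid_scheme \<Rightarrow> bool" where
  "Schmidt_group G \<longleftrightarrow>
     group G \<and> finite (carrier G) \<and> \<not> nilpotent_group G \<and>
     (\<forall>K. subgroup K G \<and> K \<noteq> carrier G \<longrightarrow> nilpotent_group (G\<lparr>carrier := K\<rparr>))"

definition semidirect_of :: "('a, 'm) monoid_scheme \<Rightarrow> 'a set \<Rightarrow> 'a set \<Rightarrow> bool" where
  "semidirect_of G N K \<longleftrightarrow>
     N \<lhd> G \<and> subgroup K G \<and> N \<inter> K = {\<one>\<^bsub>G\<^esub>} \<and> N <#>\<^bsub>G\<^esub> K = carrier G"

definition Schmidt_group_with_parameters ::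
    "('a, 'm) monoid_scheme \<Rightarrow> nat \<Rightarrow> nat \<Rightarrow> nat \<Rightarrow> bool" where
  "Schmidt_group_with_parameters G p q v \<longleftrightarrow>
     Schmidt_group G \<and>
     Factorial_Ring.prime p \<and> Factorial_Ring.prime q \<and> p \<noteq> q \<and> v \<ge> 1 \<and>
     (\<exists>k. card (derived G (carrier G)) = p ^ k) \<and>
     (\<exists>b \<in> carrier G. card (generate G {b}) = q ^ v \<and>
        semidirect_of G (derived G (carrier G)) (generate G {b}))"

text \<open>
  Endomorphisms are taken extensional, so that each one is represented by exactly one HOL function.
  Maps act on the right: the product of \<open>f\<close> and \<open>g\<close> is first \<open>f\<close>, then \<open>g\<close>. The unit field only
  completes the record; \<^const>\<open>is_iso\<close> looks at carriers and products alone, so that for these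
  records it is isomorphism of semigroups.
\<close>

definition End_semigroup :: "('a, 'm) monoid_scheme \<Rightarrow> ('a \<Rightarrow> 'a) monoid" where
  "End_semigroup G =
     \<lparr>carrier = hom G G \<inter> extensional (carrier G),
      monoid.mult = \<lambda>f g. compose (carrier G) g f,
      one = \<lambda>x \<in> carrier G. x\<rparr>"

end

theory Submission
  imports Defs "HOL-Algebra.Sylow" "HOL-Algebra.Multiplicative_Group" "HOL-Number_Theory.Cong"
begin

text \<open>
  The endomorphism monoid of a Schmidt group \<open>G\<close> has little room. Let \<open>P = G'\<close> and let \<open>b\<close> generate a
  complement. An endomorphism that is not an automorphism has a proper, hence nilpotent, image, and
  modulo its derived subgroup this image is generated by the image of \<open>b\<close>. A nilpotent group that is
  cyclic modulo its derived subgroup is abelian (\<open>nilpotent_cyclic_mod_derived\<close>), so the endomorphism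
  kills \<open>P\<close>. Every endomorphism is therefore an automorphism or factors through the idempotent \<open>e\<close>
  with kernel \<open>P\<close> and image \<open>\<langle>b\<rangle>\<close>. The monoid \<open>e S e\<close>, for \<open>S = End G\<close>, is the multiplicative monoid of
  the integers modulo \<open>q\<^sup>v\<close>. The inner automorphisms by elements of \<open>P\<close> form an abelian \<open>p\<close>-group \<open>F\<close>
  on which \<open>b\<close> acts irreducibly and with order \<open>q\<close>. The locale \<open>schmidt_monoid\<close> collects what is needed
  of this in terms of products only, so that it passes along isomorphisms.

  The converse has to extract a finite group from these facts about \<open>End H\<close>, where \<open>H\<close> is arbitrary.
  The idempotent splits \<open>H\<close> as \<open>M \<rtimes> K\<close> with \<open>M\<close> its kernel. The monoid \<open>e S e\<close> is \<open>End K\<close>; as it is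
  commutative and totally ordered by divisibility, \<open>K\<close> is cyclic, and counting gives the order \<open>q\<^sup>v\<close>
  (\<open>cyclic_of_card_End\<close>). Every endomorphism of \<open>H\<close> other than an automorphism kills \<open>M\<close>. The proof feeds
  this with endomorphisms that exist in any case:

  \<^item> Maps of \<open>K\<close> into \<open>H\<close>, extended trivially to \<open>M\<close>, show that \<open>M\<close> has no \<open>q\<close>-torsion and that
    \<open>b\<^sup>q\<close> is central for a generator \<open>b\<close> of \<open>K\<close>.

  \<^item> The transfer into the centre is not an automorphism, so it kills \<open>M\<close>; on central elements it is a
    power map. As \<open>H\<close> has finitely many inner automorphisms, \<open>M\<close> has bounded exponent.

  \<^item> If \<open>M\<close> were larger than \<open>H'\<close>, then, the exponent being bounded, there would be a homomorphism of
    \<open>H\<close> onto a subgroup of prime order that does not kill \<open>M\<close>. Hence \<open>M = H'\<close>.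

  Commutators of inner automorphisms lie in \<open>F\<close>, so now \<open>F\<close> is the group of inner automorphisms by
  elements of \<open>M\<close>, and the group of all inner automorphisms of \<open>H\<close> has order \<open>card F * q\<close>. This forces
  the exponent of \<open>M\<close> to be a power of \<open>p\<close> and leaves finitely many commutators, of finite order, to
  generate \<open>M\<close>; so \<open>H\<close> is finite. A proper subgroup \<open>L\<close> either projects into \<open>\<langle>b\<^sup>q\<rangle>\<close> and has class at most
  two, or contains an element that acts on \<open>F\<close> as a generator of \<open>K\<close> does; by irreducibility
  \<open>L \<inter> M\<close> is then central, which makes \<open>L\<close> abelian, or covers \<open>F\<close>, which would give \<open>L = H\<close>.
\<close>

section \<open>Arithmetic modulo a prime\<close>

lemma prime_not_dvd_bezout:
  assumes "Factorial_Ring.prime (r::nat)" "\<not> int r dvd i"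
  obtains a b where "i * a + int r * b = 1"
proof -
  have "coprime i (int r)"
    using assms by (metis coprime_commute prime_imp_coprime prime_nat_int_transfer)
  then show thesis using that bezout_int[of i "int r"] by (auto simp: mult.commute)
qed

lemma inverse_mod_prime:
  assumes "Factorial_Ring.prime (q::nat)" and "0 < j" "j < q"
  shows "\<exists>a c. j * a = q * c + 1"
proof -
  have "coprime q j" using assms by (simp add: prime_imp_coprime nat_dvd_not_less)
  then have "gcd j q = 1" by (metis coprime_imp_gcd_eq_1 gcd.commute)
  then show ?thesis using bezout_nat[of j q] assms by simp
qed

section \<open>Commutators and nilpotent groups\<close>

context group begin

lemma inv_cancel_left:
  assumes "x \<in> carrier G" "y \<in> carrier G"
  shows "inv x \<otimes> (x \<otimes> y) = y" "x \<otimes> (inv x \<otimes> y) = y"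
  using assms by (simp_all flip: m_assoc)

lemmas word_simps = m_assoc inv_mult_group inv_cancel_left

lemma commutator_eq_one_iff:
  assumes "x \<in> carrier G" "y \<in> carrier G"
  shows "x \<otimes> y \<otimes> inv x \<otimes> inv y = \<one> \<longleftrightarrow> x \<otimes> y = y \<otimes> x"
proof -
  have "x \<otimes> y \<otimes> inv x \<otimes> inv y = (x \<otimes> y) \<otimes> inv (y \<otimes> x)"
    using assms by (simp add: word_simps)
  then show ?thesis
    using assms by (metis inv_closed inv_equality inv_inv m_closed r_inv)
qed

text \<open>
  This is the preimage of the centralizer of \<open>x\<close> modulo \<open>N\<close>. It serves to extend commutator
  relations from generators to the generated subgroup.
\<close>

lemma subgroup_commutator_in_normal:
  assumes N: "N \<lhd> G" and x: "x \<in> carrier G"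
  shows "subgroup {y \<in> carrier G. x \<otimes> y \<otimes> inv x \<otimes> inv y \<in> N} G"
proof -
  interpret N: normal N G by fact
  let ?c = "\<lambda>y. x \<otimes> y \<otimes> inv x \<otimes> inv y"
  show ?thesis
  proof (intro subgroupI)
    show "{y \<in> carrier G. ?c y \<in> N} \<noteq> {}" using x by (auto intro!: exI[of _ \<one>])
  next
    fix y assume y: "y \<in> {y \<in> carrier G. ?c y \<in> N}"
    then have "inv y \<otimes> inv (?c y) \<otimes> y \<in> N" by (intro N.inv_op_closed1) auto
    moreover have "inv y \<otimes> inv (?c y) \<otimes> y = ?c (inv y)" using x y by (simp add: word_simps)
    ultimately show "inv y \<in> {y \<in> carrier G. ?c y \<in> N}" using y by auto
  next
    fix y z assume y: "y \<in> {y \<in> carrier G. ?c y \<in> N}" and z: "z \<in> {y \<in> carrier G. ?c y \<in> N}"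
    then have "?c y \<otimes> (y \<otimes> ?c z \<otimes> inv y) \<in> N"
      using N.inv_op_closed2[of y "?c z"] N.m_closed[of "?c y"] by simp
    moreover have "?c y \<otimes> (y \<otimes> ?c z \<otimes> inv y) = ?c (y \<otimes> z)" using x y z by (simp add: word_simps)
    ultimately show "y \<otimes> z \<in> {y \<in> carrier G. ?c y \<in> N}" using y z by auto
  qed auto
qed

lemma centralizer_subgroup:
  assumes x: "x \<in> carrier G"
  shows "subgroup {y \<in> carrier G. x \<otimes> y = y \<otimes> x} G"
proof -
  have "{y \<in> carrier G. x \<otimes> y = y \<otimes> x} = {y \<in> carrier G. x \<otimes> y \<otimes> inv x \<otimes> inv y \<in> {\<one>}}"
    using commutator_eq_one_iff[OF x] by auto
  then show ?thesis using subgroup_commutator_in_normal[OF one_is_normal x] by simp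
qed

lemma commutator_eq_oneI:
  "x \<otimes> y = y \<otimes> x \<Longrightarrow> x \<in> carrier G \<Longrightarrow> y \<in> carrier G \<Longrightarrow> x \<otimes> y \<otimes> inv x \<otimes> inv y = \<one>"
  by (rule commutator_eq_one_iff[THEN iffD2])

lemma commutator_inv:
  assumes "x \<in> carrier G" "y \<in> carrier G"
  shows "inv (x \<otimes> y \<otimes> inv x \<otimes> inv y) = y \<otimes> x \<otimes> inv y \<otimes> inv x"
  using assms by (simp add: word_simps)

lemma commutator_swap:
  assumes N: "N \<lhd> G" and xy: "x \<in> carrier G" "y \<in> carrier G"
    and c: "x \<otimes> y \<otimes> inv x \<otimes> inv y \<in> N"
  shows "y \<otimes> x \<otimes> inv y \<otimes> inv x \<in> N"
proof -
  have "inv (x \<otimes> y \<otimes> inv x \<otimes> inv y) \<in> N" using c N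
    by (simp add: normal.axioms(1) subgroup.m_inv_closed)
  then show ?thesis using xy by (simp add: word_simps)
qed

lemma lower_central_normal: "lower_central G n \<lhd> G"
proof (induction n)
  case 0
  then show ?case by (simp add: normal_self)
next
  case (Suc n)
  interpret N: normal "lower_central G n" G by fact
  show ?case unfolding lower_central.simps
  proof (rule normal_generateI)
    show "(\<Union>x\<in>lower_central G n. \<Union>y\<in>carrier G. {x \<otimes> y \<otimes> inv x \<otimes> inv y}) \<subseteq> carrier G"
      using N.subset by auto
  next
    fix h g assume "h \<in> (\<Union>x\<in>lower_central G n. \<Union>y\<in>carrier G. {x \<otimes> y \<otimes> inv x \<otimes> inv y})"
      and g: "g \<in> carrier G"
    then obtain x y where x: "x \<in> lower_central G n" and y: "y \<in> carrier G"
      and h: "h = x \<otimes> y \<otimes> inv x \<otimes> inv y" by auto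
    have xc: "x \<in> carrier G" using x N.subset by auto
    have "g \<otimes> h \<otimes> inv g = (g \<otimes> x \<otimes> inv g) \<otimes> (g \<otimes> y \<otimes> inv g) \<otimes> inv (g \<otimes> x \<otimes> inv g) \<otimes> inv (g \<otimes> y \<otimes> inv g)"
      unfolding h using xc y g by (simp add: word_simps)
    moreover have "g \<otimes> x \<otimes> inv g \<in> lower_central G n" using N.inv_op_closed2 x g by auto
    moreover have "g \<otimes> y \<otimes> inv g \<in> carrier G" using y g by auto
    ultimately show "g \<otimes> h \<otimes> inv g \<in> (\<Union>x\<in>lower_central G n. \<Union>y\<in>carrier G. {x \<otimes> y \<otimes> inv x \<otimes> inv y})"
      by blast
  qed
qed

lemma commutator_in_lower_central:
  assumes "x \<in> lower_central G n" "y \<in> carrier G"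
  shows "x \<otimes> y \<otimes> inv x \<otimes> inv y \<in> lower_central G (Suc n)"
  unfolding lower_central.simps using assms by (intro generate.incl) blast

lemma lower_central_Suc_mono:
  assumes "lower_central G m \<subseteq> lower_central G n"
  shows "lower_central G (Suc m) \<subseteq> lower_central G (Suc n)"
  unfolding lower_central.simps by (intro mono_generate UN_mono assms order_refl)

lemma lower_central_1: "lower_central G (Suc 0) = derived G (carrier G)"
  by (simp add: derived_def)

lemma commutator_in_derived:
  "x \<in> carrier G \<Longrightarrow> y \<in> carrier G \<Longrightarrow> x \<otimes> y \<otimes> inv x \<otimes> inv y \<in> derived G (carrier G)"
  using commutator_in_lower_central[of x 0 y] by (simp add: lower_central_1 del: lower_central.simps(2))

text \<open>
  Modulo \<open>\<gamma>\<^sub>2 = [G', G]\<close> the derived subgroup is central, so the group is generated by a single element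
  together with central ones and is abelian there. Hence \<open>\<gamma>\<^sub>1 = \<gamma>\<^sub>2\<close>, the lower central series is stationary
  from then on, and nilpotency makes the common value trivial.
\<close>

lemma nilpotent_cyclic_mod_derived:
  assumes nil: "nilpotent_group G" and c: "c \<in> carrier G"
    and gen: "carrier G \<subseteq> generate G (insert c (derived G (carrier G)))"
    and xy: "x \<in> carrier G" "y \<in> carrier G"
  shows "x \<otimes> y = y \<otimes> x"
proof -
  define N where "N = lower_central G (Suc (Suc 0))"
  have N: "N \<lhd> G" unfolding N_def by (rule lower_central_normal)
  let ?D = "derived G (carrier G)"
  have D: "?D \<subseteq> carrier G" by (simp add: derived_in_carrier)
  have DC: "z \<otimes> d \<otimes> inv z \<otimes> inv d \<in> N" if "d \<in> ?D" "z \<in> carrier G" for d z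
    using commutator_in_lower_central[of d "Suc 0" z] that D commutator_swap[OF N, of d z]
    unfolding N_def by (auto simp: lower_central_1 simp del: lower_central.simps)
  have sub: "carrier G \<subseteq> {y \<in> carrier G. z \<otimes> y \<otimes> inv z \<otimes> inv y \<in> N}"
    if z: "z \<in> carrier G" "z \<otimes> c \<otimes> inv z \<otimes> inv c \<in> N" for z
    by (rule order_trans[OF gen generate_subgroup_incl[OF _ subgroup_commutator_in_normal[OF N z(1)]]])
       (use z c D DC in auto)
  have one: "c \<otimes> c \<otimes> inv c \<otimes> inv c \<in> N" using c N
    by (simp add: word_simps normal.axioms(1) subgroup.one_closed)
  have cc: "z \<otimes> c \<otimes> inv z \<otimes> inv c \<in> N" if "z \<in> carrier G" for z
    using sub[OF c one] that commutator_swap[OF N c, of z] by auto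
  have all: "u \<otimes> z \<otimes> inv u \<otimes> inv z \<in> N" if "u \<in> carrier G" "z \<in> carrier G" for u z
    using sub[OF that(1) cc[OF that(1)]] that by auto
  have step: "lower_central G (Suc 0) \<subseteq> lower_central G (Suc (Suc 0))"
    unfolding lower_central_1 derived_def
    by (rule generate_subgroup_incl) (use all N in \<open>auto simp: N_def normal.axioms(1) simp del: lower_central.simps\<close>)
  have mono: "lower_central G (Suc n) \<subseteq> lower_central G (Suc (Suc n))" for n
    by (induction n) (use step lower_central_Suc_mono in blast)+
  have "lower_central G (Suc 0) \<subseteq> lower_central G (Suc n)" for n
    by (induction n) (use mono in blast)+
  moreover obtain n where "lower_central G n = {\<one>}" using nil by (auto simp: nilpotent_group_def)
  moreover have "lower_central G (Suc n) \<subseteq> lower_central G n" for n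
  proof -
    interpret L: normal "lower_central G n" G by (rule lower_central_normal)
    show ?thesis unfolding lower_central.simps
    proof (rule generate_subgroup_incl[OF _ L.is_subgroup], safe)
      fix x y assume "x \<in> lower_central G n" "y \<in> carrier G"
      then have "x \<otimes> (y \<otimes> inv x \<otimes> inv y) \<in> lower_central G n"
        by (intro L.m_closed L.inv_op_closed2) auto
      then show "x \<otimes> y \<otimes> inv x \<otimes> inv y \<in> lower_central G n"
        using \<open>x \<in> _\<close> \<open>y \<in> _\<close> L.subset by (auto simp: m_assoc)
    qed
  qed
  ultimately have "derived G (carrier G) \<subseteq> {\<one>}" unfolding lower_central_1 by blast
  then show ?thesis
    using commutator_in_derived[OF xy] commutator_eq_one_iff[OF xy] by blast
qed

lemma nilpotent_if_derived_central:
  assumes central: "\<And>x y z. x \<in> carrier G \<Longrightarrow> y \<in> carrier G \<Longrightarrow> z \<in> carrier G \<Longrightarrow>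
     z \<otimes> (x \<otimes> y \<otimes> inv x \<otimes> inv y) = (x \<otimes> y \<otimes> inv x \<otimes> inv y) \<otimes> z"
  shows "nilpotent_group G"
proof -
  have 1: "z \<otimes> c \<otimes> inv z \<otimes> inv c = \<one>" if z: "z \<in> carrier G" and c: "c \<in> lower_central G (Suc 0)" for z c
  proof -
    have "lower_central G (Suc 0) \<subseteq> {c \<in> carrier G. z \<otimes> c \<otimes> inv z \<otimes> inv c \<in> {\<one>}}"
      unfolding lower_central.simps
      by (rule generate_subgroup_incl[OF _ subgroup_commutator_in_normal[OF one_is_normal z]])
        (use z central in \<open>auto intro!: commutator_eq_one_iff[OF z, THEN iffD2]\<close>)
    then show ?thesis using c by blast
  qed
  have sub: "lower_central G (Suc 0) \<subseteq> carrier G"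
    using lower_central_normal normal_imp_subgroup subgroup.subset by blast
  have 2: "c \<otimes> z \<otimes> inv c \<otimes> inv z = \<one>" if z: "z \<in> carrier G" and c: "c \<in> lower_central G (Suc 0)" for z c
    using 1[OF that] commutator_eq_one_iff[of z c] commutator_eq_one_iff[of c z] sub that by auto
  have "(\<Union>x\<in>lower_central G (Suc 0). \<Union>y\<in>carrier G. {x \<otimes> y \<otimes> inv x \<otimes> inv y}) \<subseteq> {\<one>}"
    using 2 by blast
  then have "lower_central G (Suc (Suc 0)) \<subseteq> generate G {\<one>}"
    unfolding lower_central.simps(2)[of _ "Suc 0"] by (rule mono_generate)
  then have "lower_central G (Suc (Suc 0)) = {\<one>}"
    using lower_central_normal[of "Suc (Suc 0)"] generate_one normal_imp_subgroup subgroup.one_closed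
    by blast
  then show ?thesis unfolding nilpotent_group_def using is_group by blast
qed

text \<open>
  If the commutator \<open>c\<close> commutes with \<open>x\<close>, then \<open>x\<close> conjugated by \<open>y\<close> differs from \<open>x\<close> by a factor that
  commutes with it, and powers multiply up.
\<close>

lemma commutator_pow:
  assumes xy: "x \<in> carrier G" "y \<in> carrier G" and c: "c = x \<otimes> y \<otimes> inv x \<otimes> inv y"
    and cx: "c \<otimes> x = x \<otimes> c"
  shows "x [^] (n::nat) \<otimes> y \<otimes> inv (x [^] n) \<otimes> inv y = c [^] n"
proof (induction n)
  case 0
  then show ?case using xy by simp
next
  case (Suc n)
  have cc: "c \<in> carrier G" using c xy by simp
  have cxn: "c \<otimes> x [^] n = x [^] n \<otimes> c" using group_commutes_pow[OF cx[symmetric] xy(1) cc, of n] by simp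
  have "x [^] Suc n \<otimes> y \<otimes> inv (x [^] Suc n) \<otimes> inv y
      = x [^] n \<otimes> c \<otimes> y \<otimes> inv (x [^] n) \<otimes> inv y"
    unfolding c using xy by (simp add: word_simps)
  also have "\<dots> = c \<otimes> (x [^] n \<otimes> y \<otimes> inv (x [^] n) \<otimes> inv y)"
    using xy cc cxn by (simp flip: m_assoc)
  also have "\<dots> = c [^] Suc n" unfolding Suc.IH using cc by (metis nat_pow_Suc2)
  finally show ?case .
qed

lemma commutator_pow_eq_one:
  assumes "x \<in> carrier G" "y \<in> carrier G" "c = x \<otimes> y \<otimes> inv x \<otimes> inv y"
    and "c \<otimes> x = x \<otimes> c" and "x [^] (n::nat) = \<one>"
  shows "c [^] n = \<one>"
  using commutator_pow[OF assms(1-4), of n] assms(1,2,5) by simp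

lemma pow_coprime_eq_one:
  assumes x: "x \<in> carrier G" and a: "x [^] (a::nat) = \<one>" and b: "x [^] (b::nat) = \<one>" and "coprime a b"
  shows "x = \<one>"
proof -
  have "ord x dvd a" "ord x dvd b" using a b x by (simp_all flip: pow_eq_id)
  then have "ord x dvd 1" using \<open>coprime a b\<close> by (meson coprime_common_divisor_nat coprime_def)
  then show ?thesis using x by (simp flip: ord_eq_1)
qed

text \<open>
  Once the commutator \<open>c\<close> lies in \<open>\<gamma>\<^sub>n\<close>, it is central modulo \<open>\<gamma>\<^sub>n\<^sub>+\<^sub>1\<close>. There \<open>c\<^sup>a = [x\<^sup>a, y]\<close> and \<open>c\<^sup>b\<close> are
  trivial, so \<open>c\<close> is trivial as well: it moves down one term, and so through all of them.
\<close>

lemma nilpotent_coprime_commute: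
  assumes nil: "nilpotent_group G" and xy: "x \<in> carrier G" "y \<in> carrier G"
    and a: "x [^] (a::nat) = \<one>" and b: "y [^] (b::nat) = \<one>" and ab: "coprime a b"
  shows "x \<otimes> y = y \<otimes> x"
proof -
  define c where "c = x \<otimes> y \<otimes> inv x \<otimes> inv y"
  have cc: "c \<in> carrier G" unfolding c_def using xy by simp
  have "c \<in> lower_central G n" for n
  proof (induction n)
    case 0
    then show ?case using cc by simp
  next
    case (Suc n)
    define N where "N = lower_central G (Suc n)"
    interpret N: normal N G unfolding N_def by (rule lower_central_normal)
    interpret Q: group "G Mod N" by (rule N.factorgroup_is_group)
    interpret h: group_hom G "G Mod N" "\<lambda>a. N #> a"
      by (intro group_hom.intro is_group Q.is_group group_hom_axioms.intro N.r_coset_hom_Mod)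
    have comm: "(N #> c) \<otimes>\<^bsub>G Mod N\<^esub> (N #> z) = (N #> z) \<otimes>\<^bsub>G Mod N\<^esub> (N #> c)" if z: "z \<in> carrier G" for z
    proof -
      have "c \<otimes> z \<otimes> inv c \<otimes> inv z \<in> N" unfolding N_def by (rule commutator_in_lower_central[OF Suc z])
      then have "N #> (c \<otimes> z \<otimes> inv c \<otimes> inv z) = \<one>\<^bsub>G Mod N\<^esub>" by (simp add: coset_join2 N.is_subgroup)
      then show ?thesis using Q.commutator_eq_one_iff[of "N #> c" "N #> z"] cc z by simp
    qed
    let ?C = "N #> c" let ?X = "N #> x" let ?Y = "N #> y"
    have C: "?C = ?X \<otimes>\<^bsub>G Mod N\<^esub> ?Y \<otimes>\<^bsub>G Mod N\<^esub> inv\<^bsub>G Mod N\<^esub> ?X \<otimes>\<^bsub>G Mod N\<^esub> inv\<^bsub>G Mod N\<^esub> ?Y"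
      unfolding c_def using xy by simp
    have C': "inv\<^bsub>G Mod N\<^esub> ?C = ?Y \<otimes>\<^bsub>G Mod N\<^esub> ?X \<otimes>\<^bsub>G Mod N\<^esub> inv\<^bsub>G Mod N\<^esub> ?Y \<otimes>\<^bsub>G Mod N\<^esub> inv\<^bsub>G Mod N\<^esub> ?X"
      unfolding C using xy by (intro Q.commutator_inv) auto
    have X: "?X \<in> carrier (G Mod N)" "?Y \<in> carrier (G Mod N)" "?C \<in> carrier (G Mod N)" using xy cc by auto
    have "?C [^]\<^bsub>G Mod N\<^esub> a = \<one>\<^bsub>G Mod N\<^esub>"
      by (rule Q.commutator_pow_eq_one[OF X(1,2) C comm[OF xy(1)]])
        (use h.hom_nat_pow[OF xy(1), of a] a in simp)
    moreover have "(inv\<^bsub>G Mod N\<^esub> ?C) [^]\<^bsub>G Mod N\<^esub> b = \<one>\<^bsub>G Mod N\<^esub>"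
    proof -
      have "inv\<^bsub>G Mod N\<^esub> ?C \<otimes>\<^bsub>G Mod N\<^esub> ?Y = ?Y \<otimes>\<^bsub>G Mod N\<^esub> inv\<^bsub>G Mod N\<^esub> ?C"
        using comm[OF xy(2)] X by (metis Q.inv_closed Q.inv_comm Q.inv_solve_left Q.inv_solve_right Q.m_assoc Q.m_closed)
      from Q.commutator_pow_eq_one[OF X(2,1) C' this, of b] show ?thesis
        using h.hom_nat_pow[OF xy(2), of b] b by simp
    qed
    then have "?C [^]\<^bsub>G Mod N\<^esub> b = \<one>\<^bsub>G Mod N\<^esub>" using X by (metis Q.inv_inv Q.inv_one Q.nat_pow_closed Q.nat_pow_inv)
    ultimately have "?C = \<one>\<^bsub>G Mod N\<^esub>" using Q.pow_coprime_eq_one X ab by blast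
    then have "N #> c = N" by simp
    then show ?case using rcos_self[OF cc N.is_subgroup] unfolding N_def by simp
  qed
  then have "c = \<one>" using nil by (metis nilpotent_group_def singletonD)
  then show ?thesis using commutator_eq_one_iff xy by (simp add: c_def)
qed

section \<open>Constructing homomorphisms\<close>

text \<open>
  For a prime divisor \<open>r\<close> of the order, a nontrivial element of a Sylow \<open>r\<close>-subgroup has order both a
  power of \<open>r\<close> and a divisor of \<open>p\<^sup>k\<close>.
\<close>

lemma exponent_imp_prime_power_order:
  assumes p: "Factorial_Ring.prime (p::nat)" and fin: "finite (carrier G)"
    and pow: "\<And>x. x \<in> carrier G \<Longrightarrow> x [^] (p ^ k) = \<one>"
  obtains j where "card (carrier G) = p ^ j"
proof -
  have "r = p" if r: "Factorial_Ring.prime r" "r dvd card (carrier G)" for r :: nat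
  proof -
    define a where "a = multiplicity r (card (carrier G))"
    have c0: "card (carrier G) \<noteq> 0" using fin by auto
    have a: "a > 0" unfolding a_def using r c0 by (simp add: prime_multiplicity_gt_zero_iff)
    obtain m where m: "order G = r ^ a * m"
      using multiplicity_dvd[of r "card (carrier G)"] unfolding a_def order_def by blast
    obtain R where R: "subgroup R G" "card R = r ^ a" using sylow_thm[OF r(1) is_group m fin] by blast
    have "card R \<noteq> 1" using R(2) a prime_gt_1_nat[OF r(1)] by simp
    then have "R \<noteq> {\<one>}" by auto
    then obtain x where x: "x \<in> R" "x \<noteq> \<one>" using subgroup.one_closed[OF R(1)] by blast
    have xG: "x \<in> carrier G" using x subgroup.mem_carrier[OF R(1)] by blast
    interpret R: group "G\<lparr>carrier := R\<rparr>" using R(1) by (rule subgroup_imp_group)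
    have "x [^] (r ^ a) = \<one>" using R.pow_order_eq_1[of x] x R(2) by (simp add: order_def flip: nat_pow_consistent)
    then show "r = p" using pow_coprime_eq_one[OF xG _ pow[OF xG], of "r ^ a"] x(2) primes_coprime[OF r(1) p]
      by (metis coprime_power_left_iff coprime_power_right_iff)
  qed
  then have "prime_factors (card (carrier G)) \<subseteq> {p}" by auto
  then have "prime_factors (card (carrier G)) = {} \<or> prime_factors (card (carrier G)) = {p}" by blast
  moreover have "card (carrier G) = (\<Prod>p\<in>prime_factors (card (carrier G)). p ^ multiplicity p (card (carrier G)))"
  proof -
    have "card (carrier G) \<noteq> 0" using fin one_closed by auto
    then show ?thesis using prod_prime_factors[of "card (carrier G)"] by simp
  qed
  ultimately have "card (carrier G) = p ^ 0 \<or> card (carrier G) = p ^ multiplicity p (card (carrier G))" by auto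
  then show thesis using that by metis
qed

lemma subgroup_powers_extension:
  assumes N: "subgroup N G" and b: "b \<in> carrier G"
    and l: "\<And>x. x \<in> N \<Longrightarrow> b \<otimes> x \<otimes> inv b \<in> N" and r: "\<And>x. x \<in> N \<Longrightarrow> inv b \<otimes> x \<otimes> b \<in> N"
  shows "subgroup {x \<otimes> b [^] (i::int) | x i. x \<in> N} G" (is "subgroup ?L G")
proof -
  interpret N: subgroup N G by fact
  let ?S = "{g \<in> carrier G. \<forall>x\<in>N. g \<otimes> x \<otimes> inv g \<in> N \<and> inv g \<otimes> x \<otimes> g \<in> N}"
  have "subgroup ?S G"
  proof (intro subgroupI)
    show "?S \<noteq> {}" by (auto intro!: exI[of _ \<one>])
  next
    fix g h assume gh: "g \<in> ?S" "h \<in> ?S"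
    show "g \<otimes> h \<in> ?S"
    proof safe
      fix x assume x: "x \<in> N"
      have "g \<otimes> (h \<otimes> x \<otimes> inv h) \<otimes> inv g \<in> N" "inv h \<otimes> (inv g \<otimes> x \<otimes> g) \<otimes> h \<in> N"
        using gh x by blast+
      then show "g \<otimes> h \<otimes> x \<otimes> inv (g \<otimes> h) \<in> N" "inv (g \<otimes> h) \<otimes> x \<otimes> (g \<otimes> h) \<in> N"
        using gh x by (simp_all add: word_simps)
    qed (use gh in auto)
  qed auto
  then have "generate G {b} \<subseteq> ?S" by (rule generate_subgroup_incl[rotated]) (use b l r in auto)
  then have conj: "b [^] (i::int) \<otimes> x \<otimes> inv (b [^] i) \<in> N" if "x \<in> N" for i x
    using that generate_pow[OF b] by blast
  show ?thesis
  proof (intro subgroupI)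
    show "?L \<subseteq> carrier G" using b by auto
    show "?L \<noteq> {}" using N.one_closed by blast
  next
    fix a assume "a \<in> ?L"
    then obtain x i where a: "a = x \<otimes> b [^] (i::int)" and x: "x \<in> N" by auto
    have "inv a = (b [^] (-i) \<otimes> inv x \<otimes> inv (b [^] (-i))) \<otimes> b [^] (-i)"
      unfolding a using x b by (simp add: word_simps int_pow_neg)
    then show "inv a \<in> ?L" using conj[of "inv x" "-i"] x by blast
  next
    fix a a' assume "a \<in> ?L" "a' \<in> ?L"
    then obtain x i x' i' where a: "a = x \<otimes> b [^] (i::int)" "a' = x' \<otimes> b [^] (i'::int)"
      and x: "x \<in> N" "x' \<in> N" by auto
    have "a \<otimes> a' = (x \<otimes> (b [^] i \<otimes> x' \<otimes> inv (b [^] i))) \<otimes> b [^] (i + i')"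
      unfolding a using x b by (simp add: word_simps int_pow_mult)
    then show "a \<otimes> a' \<in> ?L" using conj[of x' i] x N.m_closed by blast
  qed
qed

lemma powers_extension_mem:
  assumes N: "subgroup N G" and b: "b \<in> carrier G"
  shows "x \<in> N \<Longrightarrow> x \<in> {x \<otimes> b [^] (i::int) | x i. x \<in> N}"
    and "b [^] (j::int) \<in> {x \<otimes> b [^] (i::int) | x i. x \<in> N}"
proof -
  assume x: "x \<in> N"
  then have "x = x \<otimes> b [^] (0::int)" using subgroup.mem_carrier[OF N] by simp
  then show "x \<in> {x \<otimes> b [^] (i::int) | x i. x \<in> N}" using x by blast
next
  have "b [^] j = \<one> \<otimes> b [^] j" using b by simp
  then show "b [^] j \<in> {x \<otimes> b [^] (i::int) | x i. x \<in> N}" using subgroup.one_closed[OF N] by blast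
qed

text \<open>
  The quotient by \<open>N\<close> is cyclic, generated by the coset of \<open>k\<close>, so that any \<open>y\<close> satisfying the relations
  of \<open>k\<close> modulo \<open>N\<close> is the image of \<open>k\<close> under a homomorphism. An exponent for each coset is chosen; the
  choice does not influence the power of \<open>y\<close>.
\<close>

lemma hom_of_cyclic_quotient:
  assumes N: "N \<lhd> G" and k: "k \<in> carrier G" and Y: "group Y" and y: "y \<in> carrier Y"
    and cover: "\<And>x. x \<in> carrier G \<Longrightarrow> \<exists>i::int. x \<otimes> inv (k [^] i) \<in> N"
    and ker: "\<And>i::int. k [^] i \<in> N \<Longrightarrow> y [^]\<^bsub>Y\<^esub> i = \<one>\<^bsub>Y\<^esub>"
  obtains f where "f \<in> hom G Y" "f k = y" "\<And>x. x \<in> N \<Longrightarrow> f x = \<one>\<^bsub>Y\<^esub>"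
    "\<And>x. x \<in> carrier G \<Longrightarrow> \<exists>i::int. f x = y [^]\<^bsub>Y\<^esub> i"
proof -
  interpret N: normal N G by fact
  interpret Y: group Y by fact
  define \<epsilon> where "\<epsilon> x = (SOME i::int. x \<otimes> inv (k [^] i) \<in> N)" for x
  define f where "f x = y [^]\<^bsub>Y\<^esub> \<epsilon> x" for x
  have f: "f x = y [^]\<^bsub>Y\<^esub> i" if x: "x \<in> carrier G" and i: "x \<otimes> inv (k [^] i) \<in> N" for x and i :: int
  proof -
    have j: "x \<otimes> inv (k [^] \<epsilon> x) \<in> N" unfolding \<epsilon>_def using cover[OF x] by (rule someI_ex)
    have "inv (x \<otimes> inv (k [^] i)) \<otimes> (x \<otimes> inv (k [^] \<epsilon> x)) \<in> N" using i j by blast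
    also have "inv (x \<otimes> inv (k [^] i)) \<otimes> (x \<otimes> inv (k [^] \<epsilon> x)) = k [^] (i - \<epsilon> x)"
      using x k by (simp add: word_simps int_pow_diff)
    finally have "y [^]\<^bsub>Y\<^esub> (i - \<epsilon> x) = \<one>\<^bsub>Y\<^esub>" by (rule ker)
    then show ?thesis unfolding f_def using y
      by (metis Y.int_pow_closed Y.int_pow_diff Y.inv_closed Y.inv_equality Y.inv_inv)
  qed
  show thesis
  proof
    show "f \<in> hom G Y"
    proof (rule homI)
      fix x z assume x: "x \<in> carrier G" and z: "z \<in> carrier G"
      obtain i j :: int where i: "x \<otimes> inv (k [^] i) \<in> N" and j: "z \<otimes> inv (k [^] j) \<in> N"
        using cover x z by blast
      have "(x \<otimes> inv (k [^] i)) \<otimes> (k [^] i \<otimes> (z \<otimes> inv (k [^] j)) \<otimes> inv (k [^] i)) \<in> N"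
        using i j k N.inv_op_closed2 by blast
      also have "(x \<otimes> inv (k [^] i)) \<otimes> (k [^] i \<otimes> (z \<otimes> inv (k [^] j)) \<otimes> inv (k [^] i))
          = (x \<otimes> z) \<otimes> inv (k [^] (i + j))"
        using x z k by (simp add: word_simps flip: int_pow_mult)
          (metis add.commute int_pow_closed int_pow_mult inv_mult_group)
      finally show "f (x \<otimes> z) = f x \<otimes>\<^bsub>Y\<^esub> f z"
        using f[OF x i] f[OF z j] f[of "x \<otimes> z" "i + j"] x z y by (simp add: Y.int_pow_mult)
    qed (simp add: f_def y)
    show "f k = y" using f[OF k, of 1] k y by simp
    show "f x = \<one>\<^bsub>Y\<^esub>" if "x \<in> N" for x using f[of x 0] that by auto
    show "\<exists>i::int. f x = y [^]\<^bsub>Y\<^esub> i" for x by (auto simp: f_def)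
  qed
qed

lemma semidirect_hom:
  assumes sd: "semidirect_of G N (generate G {k})" and k: "k \<in> carrier G" and Y: "group Y"
    and y: "y \<in> carrier Y" "y [^]\<^bsub>Y\<^esub> ord k = \<one>\<^bsub>Y\<^esub>"
  obtains f where "f \<in> hom G Y" "f k = y" "\<And>x. x \<in> N \<Longrightarrow> f x = \<one>\<^bsub>Y\<^esub>"
proof -
  interpret Y: group Y by fact
  have N: "N \<lhd> G" using sd by (simp add: semidirect_of_def)
  interpret N: normal N G by fact
  have cover: "\<exists>i::int. x \<otimes> inv (k [^] i) \<in> N" if x: "x \<in> carrier G" for x
  proof -
    have "x \<in> N <#> generate G {k}" using x sd by (simp add: semidirect_of_def)
    then obtain n i where n: "n \<in> N" and "x = n \<otimes> k [^] (i::int)"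
      unfolding set_mult_def generate_pow[OF k] by blast
    then have "x \<otimes> inv (k [^] i) = n" using k by (simp add: m_assoc)
    then show ?thesis using n by blast
  qed
  have ker: "y [^]\<^bsub>Y\<^esub> i = \<one>\<^bsub>Y\<^esub>" if "k [^] i \<in> N" for i :: int
  proof -
    have "k [^] i \<in> N \<inter> generate G {k}" using that generate_pow[OF k] by blast
    then have "k [^] i = \<one>" using sd unfolding semidirect_of_def by blast
    then have "int (ord k) dvd i" using k by (simp add: int_pow_eq_id)
    then obtain j where "i = int (ord k) * j" by blast
    then show ?thesis using y by (simp add: int_pow_int flip: Y.int_pow_pow)
  qed
  from hom_of_cyclic_quotient[OF N k Y y(1) cover ker] that show thesis by blast
qed

lemma subgroup_above_derived_normal:
  assumes N: "subgroup N G" and D: "derived G (carrier G) \<subseteq> N"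
  shows "N \<lhd> G"
proof (rule normal_invI[OF N])
  interpret N: subgroup N G by fact
  fix x n assume x: "x \<in> carrier G" and n: "n \<in> N"
  have "x \<otimes> n \<otimes> inv x \<otimes> inv n \<in> N" using commutator_in_derived x n D by auto
  then have "x \<otimes> n \<otimes> inv x \<otimes> inv n \<otimes> n \<in> N" using n by blast
  then show "x \<otimes> n \<otimes> inv x \<in> N" using x n by (simp add: m_assoc)
qed

lemma comm_group_Mod_above_derived:
  assumes N: "subgroup N G" and D: "derived G (carrier G) \<subseteq> N"
  shows "comm_group (G Mod N)"
proof -
  interpret N: normal N G by (rule subgroup_above_derived_normal[OF assms])
  interpret Q: group "G Mod N" by (rule N.factorgroup_is_group)
  interpret h: group_hom G "G Mod N" "\<lambda>a. N #> a"
    by (intro group_hom.intro is_group Q.is_group group_hom_axioms.intro N.r_coset_hom_Mod)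
  show ?thesis
  proof (rule Q.group_comm_groupI)
    fix X Y assume "X \<in> carrier (G Mod N)" "Y \<in> carrier (G Mod N)"
    then obtain x y where xy: "x \<in> carrier G" "y \<in> carrier G" "X = N #> x" "Y = N #> y"
      unfolding carrier_FactGroup by blast
    have "x \<otimes> y \<otimes> inv x \<otimes> inv y \<in> N" using commutator_in_derived xy D by auto
    then have "N #> (x \<otimes> y \<otimes> inv x \<otimes> inv y) = \<one>\<^bsub>G Mod N\<^esub>" by (simp add: coset_join2 N.is_subgroup)
    then show "X \<otimes>\<^bsub>G Mod N\<^esub> Y = Y \<otimes>\<^bsub>G Mod N\<^esub> X"
      using Q.commutator_eq_one_iff[of X Y] xy by simp
  qed
qed

lemma subgroup_power_preimage:
  assumes N: "subgroup N G" and D: "derived G (carrier G) \<subseteq> N"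
  shows "subgroup {h \<in> carrier G. h [^] (s::nat) \<in> N} G"
proof -
  interpret N: normal N G by (rule subgroup_above_derived_normal[OF assms])
  interpret Q: comm_group "G Mod N" by (rule comm_group_Mod_above_derived[OF assms])
  interpret h: group_hom G "G Mod N" "\<lambda>a. N #> a"
    by (intro group_hom.intro is_group Q.is_group group_hom_axioms.intro N.r_coset_hom_Mod)
  have mem: "x \<in> N \<longleftrightarrow> N #> x = \<one>\<^bsub>G Mod N\<^esub>" if "x \<in> carrier G" for x
    using that rcos_self[OF that N.is_subgroup] by (auto simp: coset_join2 N.is_subgroup)
  show ?thesis
  proof (intro subgroupI)
    fix a b assume a: "a \<in> {h \<in> carrier G. h [^] s \<in> N}" and b: "b \<in> {h \<in> carrier G. h [^] s \<in> N}"
    have "N #> (a \<otimes> b) [^] s = (N #> a) [^]\<^bsub>G Mod N\<^esub> s \<otimes>\<^bsub>G Mod N\<^esub> (N #> b) [^]\<^bsub>G Mod N\<^esub> s"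
      using a b by (simp add: h.hom_nat_pow Q.nat_pow_distrib del: mult_FactGroup)
    also have "\<dots> = \<one>\<^bsub>G Mod N\<^esub>"
      using a b mem[of "a [^] s"] mem[of "b [^] s"] Q.l_one[OF Q.one_closed]
      by (simp flip: h.hom_nat_pow del: mult_FactGroup one_FactGroup)
    finally show "a \<otimes> b \<in> {h \<in> carrier G. h [^] s \<in> N}" using a b mem by simp
  qed (auto simp: nat_pow_inv intro: exI[of _ \<one>])
qed

text \<open>
  Take the least exponent \<open>r\<close> for which some proper overgroup \<open>N\<close> of \<open>N0\<close> contains all \<open>r\<close>-th powers. For
  a prime factor \<open>l\<close> of \<open>r = l s\<close>, the elements with \<open>s\<close>-th power in \<open>N\<close> form an overgroup that contains all
  \<open>l\<close>-th powers and that is still proper by minimality.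
\<close>

lemma prime_exponent_overgroup:
  assumes N: "subgroup N0 G" and D: "derived G (carrier G) \<subseteq> N0" and proper: "N0 \<noteq> carrier G"
    and n: "(n::nat) > 0" and pow: "\<And>h. h \<in> carrier G \<Longrightarrow> h [^] n \<in> N0"
  obtains r N where "Factorial_Ring.prime r" "subgroup N G" "N0 \<subseteq> N" "N \<noteq> carrier G"
    "\<And>h. h \<in> carrier G \<Longrightarrow> h [^] (r::nat) \<in> N"
proof -
  define P where "P r \<longleftrightarrow> r > 0 \<and> (\<exists>N. subgroup N G \<and> N0 \<subseteq> N \<and> N \<noteq> carrier G \<and>
      (\<forall>h\<in>carrier G. h [^] r \<in> N))" for r :: nat
  define r where "r = (LEAST r. P r)"
  have "P n" unfolding P_def using assms by blast
  then have Pr: "P r" unfolding r_def by (rule LeastI)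
  then obtain N where N1: "subgroup N G" "N0 \<subseteq> N" "N \<noteq> carrier G" "\<And>h. h \<in> carrier G \<Longrightarrow> h [^] r \<in> N"
    and r0: "r > 0"
    unfolding P_def by blast
  have "r \<noteq> 1"
  proof
    assume "r = 1"
    then have "carrier G \<subseteq> N" using N1(4) by fastforce
    then show False using N1(1,3) subgroup.subset by blast
  qed
  then obtain l where l: "Factorial_Ring.prime l" "l dvd r" using prime_factor_nat by blast
  then obtain s where s: "r = l * s" by blast
  let ?N = "{h \<in> carrier G. h [^] s \<in> N}"
  have sub: "subgroup ?N G" using subgroup_power_preimage[OF N1(1)] N1(2) D by blast
  have le: "N \<subseteq> ?N" using subgroup.subset[OF N1(1)] subgroup_int_pow_closed[OF N1(1), of _ "int s"]
    by (auto simp: int_pow_int)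
  have "s < r" using s r0 l(1) prime_gt_1_nat by fastforce
  then have "\<not> P s" unfolding r_def by (rule not_less_Least)
  moreover have "s > 0" using s r0 by (cases s) auto
  ultimately have ne: "?N \<noteq> carrier G" unfolding P_def using N1 by blast
  have "h [^] l \<in> ?N" if "h \<in> carrier G" for h using N1(4)[OF that] that by (simp add: nat_pow_pow s)
  then show thesis using that[OF l(1) sub _ ne] le N1(2) by blast
qed

lemma maximal_subgroup_avoiding:
  assumes N: "subgroup N G" and x: "x \<notin> N"
  obtains Y where "subgroup Y G" "N \<subseteq> Y" "x \<notin> Y"
    "\<And>Z. subgroup Z G \<Longrightarrow> Y \<subseteq> Z \<Longrightarrow> x \<notin> Z \<Longrightarrow> Z = Y"
proof -
  let ?A = "{Y. subgroup Y G \<and> N \<subseteq> Y \<and> x \<notin> Y}"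
  have "\<exists>M\<in>?A. \<forall>Z\<in>?A. M \<subseteq> Z \<longrightarrow> Z = M"
  proof (rule subset_Zorn_nonempty)
    show "?A \<noteq> {}" using N x by blast
  next
    fix C assume ne: "C \<noteq> {}" and C: "subset.chain ?A C"
    have sub: "C \<subseteq> ?A" using C by (simp add: subset.chain_def)
    have "subgroup (\<Union>C) G"
    proof (intro subgroupI)
      show "\<Union>C \<subseteq> carrier G" using sub subgroup.subset by blast
      show "\<Union>C \<noteq> {}" using ne sub by (auto dest!: subgroup.one_closed)
    next
      fix a assume "a \<in> \<Union>C"
      then obtain A where A: "A \<in> C" "a \<in> A" by blast
      then have "inv a \<in> A" using sub subgroup.m_inv_closed[of A G a] by auto
      then show "inv a \<in> \<Union>C" using A by blast
    next
      fix a b assume "a \<in> \<Union>C" "b \<in> \<Union>C"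
      then obtain A B where AB: "A \<in> C" "B \<in> C" "a \<in> A" "b \<in> B" by blast
      then have "A \<subseteq> B \<or> B \<subseteq> A" using C unfolding subset.chain_def by blast
      then show "a \<otimes> b \<in> \<Union>C"
      proof
        assume "A \<subseteq> B"
        then have "a \<otimes> b \<in> B" using AB sub subgroup.m_closed[of B G a b] by auto
        then show ?thesis using AB by blast
      next
        assume "B \<subseteq> A"
        then have "a \<otimes> b \<in> A" using AB sub subgroup.m_closed[of A G a b] by auto
        then show ?thesis using AB by blast
      qed
    qed
    then show "\<Union>C \<in> ?A" using sub ne by blast
  qed
  then obtain Y where "Y \<in> ?A" "\<forall>Z\<in>?A. Y \<subseteq> Z \<longrightarrow> Z = Y" by (rule bexE)
  then show thesis by (intro that[of Y]) auto
qed

text \<open>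
  The quotient by \<open>N\<close> is a vector space over the field with \<open>r\<close> elements, possibly of infinite
  dimension. A subgroup \<open>Y\<close> maximal among those that contain \<open>N\<close> and avoid \<open>x\<close> is a hyperplane
  complementary to \<open>x\<close>, and the map is given by the coordinate along \<open>x\<close>.
\<close>

lemma hom_onto_prime_order:
  assumes N: "subgroup N G" and D: "derived G (carrier G) \<subseteq> N" and r: "Factorial_Ring.prime r"
    and pow: "\<And>h. h \<in> carrier G \<Longrightarrow> h [^] (r::nat) \<in> N"
    and x: "x \<in> carrier G" "x \<notin> N" and u: "u \<in> carrier G" "u [^] r = \<one>"
  obtains f where "f \<in> hom G G" "f x = u" "\<And>y. y \<in> N \<Longrightarrow> f y = \<one>"
    "\<And>h. h \<in> carrier G \<Longrightarrow> \<exists>i::int. f h = u [^] i"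
proof -
  obtain Y where Y: "subgroup Y G" "N \<subseteq> Y" "x \<notin> Y"
    and max: "\<And>Z. subgroup Z G \<Longrightarrow> Y \<subseteq> Z \<Longrightarrow> x \<notin> Z \<Longrightarrow> Z = Y"
    using maximal_subgroup_avoiding[OF N x(2)] by blast
  have nY: "Y \<lhd> G" using subgroup_above_derived_normal Y D by blast
  interpret Y: normal Y G by fact
  interpret Q: group "G Mod Y" by (rule Y.factorgroup_is_group)
  interpret h: group_hom G "G Mod Y" "\<lambda>a. Y #> a"
    by (intro group_hom.intro is_group Q.is_group group_hom_axioms.intro Y.r_coset_hom_Mod)
  have mem: "a \<in> Y \<longleftrightarrow> Y #> a = \<one>\<^bsub>G Mod Y\<^esub>" if "a \<in> carrier G" for a
    using that rcos_self[OF that Y.is_subgroup] by (auto simp: coset_join2 Y.is_subgroup)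
  have hr: "h [^] (int r) \<in> Y" if "h \<in> carrier G" for h using pow[OF that] Y by (auto simp: int_pow_int)
  have ker: "int r dvd i" if i: "x [^] i \<in> Y" for i :: int
  proof (rule ccontr)
    assume "\<not> int r dvd i"
    then obtain a b where ab: "i * a + int r * b = 1" by (rule prime_not_dvd_bezout[OF r])
    have "(x [^] i) [^] a \<otimes> (x [^] int r) [^] b \<in> Y"
      using i hr[OF x(1)] Y.m_closed subgroup_int_pow_closed[OF Y(1)] by blast
    also have "(x [^] i) [^] a \<otimes> (x [^] int r) [^] b = x [^] (i * a + int r * b)"
      using x by (simp add: int_pow_pow int_pow_mult)
    finally show False using ab Y(3) x by simp
  qed
  (* If h is not in Y, then x lies in Y<h> by maximality, x = y h^i with i prime to r,
     so that h is a power of x modulo Y. *)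
  have cover: "\<exists>i::int. h \<otimes> inv (x [^] i) \<in> Y" if h: "h \<in> carrier G" for h
  proof (cases "h \<in> Y")
    case True
    then show ?thesis using h by (intro exI[of _ 0]) simp
  next
    case False
    let ?Z = "{y \<otimes> h [^] (i::int) | y i. y \<in> Y}"
    have Z: "subgroup ?Z G"
      by (rule subgroup_powers_extension[OF Y(1) h]) (use h Y.inv_op_closed1 Y.inv_op_closed2 in auto)
    have "Y \<subseteq> ?Z" using powers_extension_mem(1)[OF Y(1) h] by (rule subsetI)
    moreover have "h \<in> ?Z" using powers_extension_mem(2)[OF Y(1) h, of 1] h by simp
    ultimately have "x \<in> ?Z" using max[OF Z] False by blast
    then obtain y and i :: int where y: "y \<in> Y" and xe: "x = y \<otimes> h [^] i" by blast
    have "\<not> int r dvd i"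
    proof
      assume "int r dvd i"
      then obtain j where "i = int r * j" by blast
      then have "h [^] i = (h [^] int r) [^] j" using h by (simp add: int_pow_pow)
      then have "h [^] i \<in> Y" using subgroup_int_pow_closed[OF Y(1) hr[OF h]] by simp
      then show False using xe y Y(3) by blast
    qed
    then obtain a b where ab: "i * a + int r * b = 1" by (rule prime_not_dvd_bezout[OF r])
    let ?X = "Y #> x" and ?H = "Y #> h"
    have H: "?H \<in> carrier (G Mod Y)" using h by (rule h.hom_closed)
    have "?X = ?H [^]\<^bsub>G Mod Y\<^esub> i"
      unfolding h.hom_int_pow[OF h, symmetric] xe
      using y h by (metis Y.is_subgroup coset_join2 coset_mult_assoc int_pow_closed subgroup.mem_carrier Y.subset)
    moreover have "?H [^]\<^bsub>G Mod Y\<^esub> int r = \<one>\<^bsub>G Mod Y\<^esub>"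
      using hr[OF h] mem h by (simp flip: h.hom_int_pow)
    ultimately have "?X [^]\<^bsub>G Mod Y\<^esub> a = ?H [^]\<^bsub>G Mod Y\<^esub> (i * a + int r * b)"
      using H by (simp add: Q.int_pow_mult Q.int_pow_pow[symmetric] del: mult_FactGroup one_FactGroup)
    then have "?X [^]\<^bsub>G Mod Y\<^esub> a = ?H" using H ab by simp
    then have "Y #> (h \<otimes> inv (x [^] a)) = \<one>\<^bsub>G Mod Y\<^esub>"
      using h x Q.r_inv[OF H] by (simp add: h.hom_int_pow del: mult_FactGroup one_FactGroup)
    then show ?thesis using mem[of "h \<otimes> inv (x [^] a)"] h x by (intro exI[of _ a]) simp
  qed
  have "u [^] i = \<one>" if i: "x [^] i \<in> Y" for i :: int
  proof -
    obtain j where "i = int r * j" using ker[OF i] by blast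
    then show ?thesis using u by (simp add: int_pow_int flip: int_pow_pow)
  qed
  from hom_of_cyclic_quotient[OF nY x(1) is_group u(1) cover this]
  obtain f where "f \<in> hom G G" "f x = u" "\<And>y. y \<in> Y \<Longrightarrow> f y = \<one>"
    "\<And>h. h \<in> carrier G \<Longrightarrow> \<exists>i::int. f h = u [^] i" by blast
  then show thesis using Y(2) by (intro that[of f]) auto
qed

text \<open>
  The source of endomorphisms for groups that are not known to be finite. If \<open>G\<close> is covered by \<open>N0\<close> and
  a set \<open>M\<close> of bounded exponent, then some \<open>x\<close> in \<open>M\<close> is seen by homomorphisms that kill \<open>N0\<close> and map
  onto a prescribed cyclic subgroup of prime order \<open>r\<close>. As \<open>r\<close> divides the order of \<open>x\<close>, such a subgroup
  is found in \<open>M\<close> itself.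
\<close>

lemma exists_hom_onto_prime_order:
  assumes N0: "subgroup N0 G" and D: "derived G (carrier G) \<subseteq> N0" and proper: "N0 \<noteq> carrier G"
    and M: "M \<subseteq> carrier G" and n: "(n::nat) > 0" and pow: "\<And>m. m \<in> M \<Longrightarrow> m [^] n = \<one>"
    and Mpow: "\<And>m (i::nat). m \<in> M \<Longrightarrow> m [^] i \<in> M"
    and cover: "\<And>h. h \<in> carrier G \<Longrightarrow> \<exists>m\<in>M. \<exists>y\<in>N0. h = m \<otimes> y"
  obtains r x u where "Factorial_Ring.prime r" "x \<in> M" "u \<in> M" "u \<noteq> \<one>" "u [^] (r::nat) = \<one>"
    "\<And>u. u \<in> carrier G \<Longrightarrow> u [^] r = \<one> \<Longrightarrow> \<exists>f. f \<in> hom G G \<and> f x = u \<and> (\<forall>y\<in>N0. f y = \<one>) \<and>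
        (\<forall>h\<in>carrier G. \<exists>i::int. f h = u [^] i)"
proof -
  have pN: "h [^] n \<in> N0" if h: "h \<in> carrier G" for h
  proof -
    obtain m y where m: "m \<in> M" "y \<in> N0" "h = m \<otimes> y" using cover[OF h] by blast
    have "N0 \<subseteq> {h \<in> carrier G. h [^] n \<in> N0}"
      using subgroup.subset[OF N0] subgroup_int_pow_closed[OF N0, of _ "int n"] by (auto simp: int_pow_int)
    moreover have "m \<in> {h \<in> carrier G. h [^] n \<in> N0}" using m M pow subgroup.one_closed[OF N0] by auto
    ultimately have "m \<otimes> y \<in> {h \<in> carrier G. h [^] n \<in> N0}"
      using subgroup.m_closed[OF subgroup_power_preimage[OF N0 D, of n]] m by blast
    then show ?thesis using m by simp
  qed
  obtain r N where r: "Factorial_Ring.prime r" and N: "subgroup N G" "N0 \<subseteq> N" "N \<noteq> carrier G"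
    and powr: "\<And>h. h \<in> carrier G \<Longrightarrow> h [^] (r::nat) \<in> N"
    using prime_exponent_overgroup[OF N0 D proper n pN] by blast
  obtain h where h: "h \<in> carrier G" "h \<notin> N" using N(3) subgroup.subset[OF N(1)] by blast
  obtain x y where x: "x \<in> M" and y: "y \<in> N0" and hxy: "h = x \<otimes> y" using cover[OF h(1)] by blast
  have xN: "x \<notin> N" using h(2) hxy y N(2) subgroup.m_closed[OF N(1), of x y] by auto
  have xG: "x \<in> carrier G" using x M by blast
  have "r dvd ord x"
  proof (rule ccontr)
    assume "\<not> r dvd ord x"
    then have "coprime (int r) (int (ord x))" using r prime_imp_coprime by auto
    then obtain a b where ab: "int r * a + int (ord x) * b = 1"
      using bezout_int[of "int r" "int (ord x)"] by (auto simp: mult.commute)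
    have "x = x [^] (int r * a + int (ord x) * b)" using ab xG by simp
    also have "\<dots> = (x [^] int r) [^] a \<otimes> (x [^] int (ord x)) [^] b"
      using xG by (simp add: int_pow_mult int_pow_pow)
    also have "\<dots> = (x [^] int r) [^] a" using xG by (simp add: int_pow_int)
    also have "\<dots> \<in> N" using subgroup_int_pow_closed[OF N(1)] powr[OF xG] by (simp add: int_pow_int)
    finally show False using xN by simp
  qed
  then obtain d where d: "ord x = r * d" by blast
  have o0: "ord x \<noteq> 0" using pow[OF x] n xG ord_eq_0 by auto
  have d0: "d > 0" and dl: "d < ord x" using d r o0 prime_gt_1_nat[OF r] by (cases "d = 0"; simp)+
  let ?u = "x [^] d"
  have "?u \<noteq> \<one>" using dl d0 xG by (metis pow_eq_id nat_dvd_not_less)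
  moreover have "?u [^] r = \<one>" using d xG by (metis mult.commute nat_pow_pow pow_ord_eq_1)
  moreover have "\<exists>f. f \<in> hom G G \<and> f x = u \<and> (\<forall>y\<in>N0. f y = \<one>) \<and>
        (\<forall>h\<in>carrier G. \<exists>i::int. f h = u [^] i)" if u: "u \<in> carrier G" "u [^] r = \<one>" for u
  proof -
    obtain f where "f \<in> hom G G" "f x = u" "\<And>y. y \<in> N \<Longrightarrow> f y = \<one>"
      "\<And>h. h \<in> carrier G \<Longrightarrow> \<exists>i::int. f h = u [^] i"
      using hom_onto_prime_order[OF N(1) order_trans[OF D N(2)] r powr xG xN u] by blast
    then show ?thesis using N(2) by blast
  qed
  ultimately show thesis using that[OF r x Mpow[OF x, of d]] by blast
qed

text \<open>
  This is the transfer into the kernel of \<open>t\<close>. Coset representatives \<open>s\<close> are indexed by the image of \<open>t\<close>,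
  and \<open>z g c\<close> is the factor of \<open>g\<close> at the coset \<open>c\<close>. It lies in the central kernel, so the product over
  all \<open>c\<close> makes sense without an order; it is multiplicative because left translation by \<open>t h\<close>
  permutes the cosets. A central element contributes itself at every coset.
\<close>

lemma transfer_hom:
  fixes Y (structure)
  assumes t: "group_hom G Y t" and fin: "finite (t ` carrier G)"
    and central: "\<And>z g. z \<in> carrier G \<Longrightarrow> g \<in> carrier G \<Longrightarrow> t z = \<one>\<^bsub>Y\<^esub> \<Longrightarrow> z \<otimes>\<^bsub>G\<^esub> g = g \<otimes>\<^bsub>G\<^esub> z"
  obtains V where "V \<in> hom G G" "\<And>g. g \<in> carrier G \<Longrightarrow> t (V g) = \<one>\<^bsub>Y\<^esub>"
    "\<And>z. z \<in> carrier G \<Longrightarrow> t z = \<one>\<^bsub>Y\<^esub> \<Longrightarrow> V z = z [^]\<^bsub>G\<^esub> card (t ` carrier G)"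
proof -
  interpret t: group_hom G Y t by fact
  let ?I = "t ` carrier G"
  let ?K = "kernel G Y t"
  define Z where "Z = G\<lparr>carrier := ?K\<rparr>"
  have K: "subgroup ?K G" by (rule t.subgroup_kernel)
  interpret Z: comm_group Z
    unfolding Z_def
    by (rule group.group_comm_groupI[OF subgroup_imp_group[OF K]]) (use central in \<open>auto simp: kernel_def\<close>)
  have Zs: "carrier Z = ?K" "monoid.mult Z = monoid.mult G" "one Z = one G" by (simp_all add: Z_def)
  define s where "s c = (SOME g. g \<in> carrier G \<and> t g = c)" for c
  have s: "s c \<in> carrier G" "t (s c) = c" if "c \<in> ?I" for c
  proof -
    have "\<exists>g. g \<in> carrier G \<and> t g = c" using that by blast
    from someI_ex[OF this] show "s c \<in> carrier G" "t (s c) = c" by (auto simp: s_def)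
  qed
  define z where "z g c = inv\<^bsub>G\<^esub> (s (t g \<otimes>\<^bsub>Y\<^esub> c)) \<otimes>\<^bsub>G\<^esub> g \<otimes>\<^bsub>G\<^esub> s c" for g c
  have I: "t g \<otimes>\<^bsub>Y\<^esub> c \<in> ?I" if "g \<in> carrier G" "c \<in> ?I" for g c
    using that by (metis (no_types, opaque_lifting) image_iff t.hom_mult m_closed)
  have Ic: "c \<in> carrier Y" if "c \<in> ?I" for c using that by auto
  have zK: "z g c \<in> carrier Z" if "g \<in> carrier G" "c \<in> ?I" for g c
    using that s I[OF that] Ic[OF that(2)] unfolding Zs z_def
    by (simp add: kernel_def t.H.m_assoc)
  (* The cocycle identity that makes the transfer multiplicative. *)
  have zm: "z (g \<otimes>\<^bsub>G\<^esub> h) c = z g (t h \<otimes>\<^bsub>Y\<^esub> c) \<otimes>\<^bsub>Z\<^esub> z h c"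
    if "g \<in> carrier G" "h \<in> carrier G" "c \<in> ?I" for g h c
  proof -
    have "t (g \<otimes>\<^bsub>G\<^esub> h) \<otimes>\<^bsub>Y\<^esub> c = t g \<otimes>\<^bsub>Y\<^esub> (t h \<otimes>\<^bsub>Y\<^esub> c)"
      using that Ic by (simp add: t.H.m_assoc)
    then show ?thesis unfolding z_def Zs
      using that s I by (simp add: word_simps)
  qed
  define V where "V g = finprod Z (z g) ?I" for g
  have VZ: "V g \<in> carrier Z" if "g \<in> carrier G" for g
    unfolding V_def using zK that by (intro Z.finprod_closed) auto
  show thesis
  proof
    show "V \<in> hom G G"
    proof (rule homI)
      fix g assume "g \<in> carrier G"
      then show "V g \<in> carrier G" using VZ by (auto simp: Zs kernel_def)
    next
      fix g h assume gh: "g \<in> carrier G" "h \<in> carrier G"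
      let ?p = "\<lambda>c. t h \<otimes>\<^bsub>Y\<^esub> c"
      have inj: "inj_on ?p ?I" using gh by (auto intro!: inj_onI)
      have surj: "?p ` ?I = ?I"
        by (rule card_subset_eq[OF fin]) (use I gh inj in \<open>auto simp: card_image\<close>)
      have "V (g \<otimes>\<^bsub>G\<^esub> h) = finprod Z (\<lambda>c. z g (?p c) \<otimes>\<^bsub>Z\<^esub> z h c) ?I"
        unfolding V_def by (rule Z.finprod_cong') (use gh zm zK I in \<open>auto simp del: image_eqI\<close>)
      also have "\<dots> = finprod Z (\<lambda>c. z g (?p c)) ?I \<otimes>\<^bsub>Z\<^esub> finprod Z (z h) ?I"
        by (rule Z.finprod_multf) (use gh zK I in auto)
      also have "finprod Z (\<lambda>c. z g (?p c)) ?I = finprod Z (z g) (?p ` ?I)"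
        by (rule Z.finprod_reindex[symmetric]) (use gh zK inj surj in auto)
      finally show "V (g \<otimes>\<^bsub>G\<^esub> h) = V g \<otimes>\<^bsub>G\<^esub> V h" unfolding surj by (simp add: V_def Zs)
    qed
    show "t (V g) = \<one>\<^bsub>Y\<^esub>" if "g \<in> carrier G" for g using VZ[OF that] by (auto simp: Zs kernel_def)
    show "V a = a [^]\<^bsub>G\<^esub> card ?I" if a: "a \<in> carrier G" "t a = \<one>\<^bsub>Y\<^esub>" for a
    proof -
      have aZ: "a \<in> carrier Z" using a by (simp add: Zs kernel_def)
      have "z a c = a" if "c \<in> ?I" for c
      proof -
        have "z a c = inv\<^bsub>G\<^esub> (s c) \<otimes>\<^bsub>G\<^esub> (a \<otimes>\<^bsub>G\<^esub> s c)"
          unfolding z_def using a that s Ic by (simp add: m_assoc)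
        also have "\<dots> = inv\<^bsub>G\<^esub> (s c) \<otimes>\<^bsub>G\<^esub> (s c \<otimes>\<^bsub>G\<^esub> a)" using central[of a "s c"] a that s by simp
        finally show ?thesis using a that s by (simp add: inv_cancel_left)
      qed
      then have "V a = finprod Z (\<lambda>c. a) ?I"
        unfolding V_def by (intro Z.finprod_cong') (use aZ in auto)
      then show ?thesis using Z.finprod_const[OF aZ, of ?I] by (simp add: Z_def flip: nat_pow_consistent)
    qed
  qed
qed

text \<open>
  A finite subgroup \<open>U\<close> above the derived subgroup is normal, and stays finite when extended by the
  powers of one element of finite order.
\<close>

lemma finite_subgroup_over_derived:
  assumes T: "finite T" "T \<subseteq> carrier G" "\<And>t. t \<in> T \<Longrightarrow> \<exists>n>0. t [^] (n::nat) = \<one>"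
    and W: "subgroup W G" "finite W" "derived G (carrier G) \<subseteq> W"
  obtains U where "subgroup U G" "finite U" "W \<subseteq> U" "T \<subseteq> U"
proof -
  have "\<exists>U. subgroup U G \<and> finite U \<and> W \<subseteq> U \<and> T \<subseteq> U" using T
  proof (induction T rule: finite_induct)
    case empty
    then show ?case using W by blast
  next
    case (insert t T)
    then obtain U where U: "subgroup U G" "finite U" "W \<subseteq> U" "T \<subseteq> U" by auto
    have t: "t \<in> carrier G" using insert.prems by auto
    interpret U: normal U G using subgroup_above_derived_normal[OF U(1)] W U by blast
    let ?L = "{x \<otimes> t [^] (i::int) | x i. x \<in> U}"
    have L: "subgroup ?L G"
      by (rule subgroup_powers_extension[OF U(1) t]) (use t U.inv_op_closed1 U.inv_op_closed2 in auto)
    obtain n where n: "n > 0" "t [^] (n::nat) = \<one>" using insert.prems by auto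
    have "?L \<subseteq> (\<lambda>(x, i). x \<otimes> t [^] (i::nat)) ` (U \<times> {..<n})"
    proof safe
      fix x and i :: int assume x: "x \<in> U"
      have "t [^] i = t [^] (i mod int n + int n * (i div int n))" by simp
      also have "\<dots> = t [^] (i mod int n) \<otimes> (t [^] int n) [^] (i div int n)"
        unfolding int_pow_mult[OF t] int_pow_pow[OF t] ..
      also have "\<dots> = t [^] (nat (i mod int n))" using n t by (simp add: int_pow_int flip: pow_nat)
      finally have "x \<otimes> t [^] i = (\<lambda>(x, i). x \<otimes> t [^] i) (x, nat (i mod int n))" by simp
      moreover have "(x, nat (i mod int n)) \<in> U \<times> {..<n}" using x n by (simp add: nat_less_iff)
      ultimately show "x \<otimes> t [^] i \<in> (\<lambda>(x, i). x \<otimes> t [^] (i::nat)) ` (U \<times> {..<n})" by (rule image_eqI)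
    qed
    then have "finite ?L" by (rule finite_subset) (use U(2) in auto)
    moreover have "U \<subseteq> ?L" using powers_extension_mem(1)[OF U(1) t] by (rule subsetI)
    moreover have "t \<in> ?L" using powers_extension_mem(2)[OF U(1) t, of 1] t by simp
    ultimately show ?case using U L by (intro exI[of _ ?L]) auto
  qed
  then show thesis using that by auto
qed

end

section \<open>Commuting endomorphisms of an abelian group\<close>

context comm_group begin

text \<open>
  Schur's lemma with the double centralizer. Let \<open>C\<close> be the ring of endomorphisms commuting with \<open>\<beta>\<close>
  and \<open>D\<close> the centre of \<open>C\<close>, which contains \<open>\<beta>\<close>. For \<open>v \<noteq> \<one>\<close> the orbit of \<open>v\<close> under \<open>D\<close> is a \<open>\<beta>\<close>-invariant
  subgroup, hence everything. So \<open>d1 v = h v\<close> for some \<open>h\<close> in \<open>D\<close>, and as both \<open>d1\<close> and \<open>h\<close> commute with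
  \<open>D\<close>, they agree everywhere; but \<open>h\<close> commutes with \<open>d2\<close>.
\<close>

lemma commuting_endomorphisms_commute:
  assumes b: "\<beta> \<in> hom G G"
    and irr: "\<And>W. subgroup W G \<Longrightarrow> \<beta> ` W \<subseteq> W \<Longrightarrow> W = {\<one>} \<or> W = carrier G"
    and d1: "d1 \<in> hom G G" "\<And>x. x \<in> carrier G \<Longrightarrow> d1 (\<beta> x) = \<beta> (d1 x)"
    and d2: "d2 \<in> hom G G" "\<And>x. x \<in> carrier G \<Longrightarrow> d2 (\<beta> x) = \<beta> (d2 x)"
    and x: "x \<in> carrier G"
  shows "d1 (d2 x) = d2 (d1 x)"
proof (cases "carrier G = {\<one>}")
  case True
  then show ?thesis using x d1(1) d2(1) by (metis is_group hom_one singletonD)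
next
  case False
  then obtain v where v: "v \<in> carrier G" "v \<noteq> \<one>" using one_closed by blast
  define C where "C = {g \<in> hom G G. \<forall>x\<in>carrier G. g (\<beta> x) = \<beta> (g x)}"
  define D where "D = {h \<in> C. \<forall>g\<in>C. \<forall>x\<in>carrier G. h (g x) = g (h x)}"
  have bC: "\<beta> \<in> C" unfolding C_def using b by auto
  have cl: "h y \<in> carrier G" if "h \<in> C" "y \<in> carrier G" for h y
    using that by (auto simp: C_def hom_def)
  have mul: "h (y \<otimes> z) = h y \<otimes> h z" if "h \<in> C" "y \<in> carrier G" "z \<in> carrier G" for h y z
    using that by (auto simp: C_def hom_def)
  have one: "h \<one> = \<one>" if "h \<in> C" for h using that by (auto simp: C_def intro: hom_one[OF _ is_group is_group])
  have inv: "h (inv y) = inv (h y)" if "h \<in> C" "y \<in> carrier G" for h y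
  proof -
    interpret h: group_hom G G h by unfold_locales (use that C_def in auto)
    show ?thesis using that by simp
  qed
  have cb: "h (\<beta> y) = \<beta> (h y)" if "h \<in> C" "y \<in> carrier G" for h y
    using that by (auto simp: C_def)
  have DI: "h \<in> D" if "\<And>y. y \<in> carrier G \<Longrightarrow> h y \<in> carrier G"
     "\<And>y z. y \<in> carrier G \<Longrightarrow> z \<in> carrier G \<Longrightarrow> h (y \<otimes> z) = h y \<otimes> h z"
     "\<And>g y. g \<in> C \<Longrightarrow> y \<in> carrier G \<Longrightarrow> h (g y) = g (h y)" for h
    using that bC unfolding D_def C_def by (auto simp: hom_def)
  have DC: "h \<in> C" if "h \<in> D" for h using that by (simp add: D_def)
  have Dc: "h (g y) = g (h y)" if "h \<in> D" "g \<in> C" "y \<in> carrier G" for h g y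
    using that by (simp add: D_def)
  let ?W = "(\<lambda>h. h v) ` D"
  have "subgroup ?W G"
  proof (intro subgroupI)
    show "?W \<subseteq> carrier G" using cl DC v by auto
    have "(\<lambda>x. \<one>) \<in> D" by (rule DI) (simp_all add: one)
    then show "?W \<noteq> {}" by blast
  next
    fix a assume "a \<in> ?W"
    then obtain h where h: "h \<in> D" "a = h v" by blast
    have "(\<lambda>x. inv (h x)) \<in> D"
      by (rule DI) (use h DC cl in \<open>auto simp: inv mul Dc inv_mult\<close>)
    then show "inv a \<in> ?W" using h(2) by (intro image_eqI[of _ _ "\<lambda>x. inv (h x)"]) auto
  next
    fix a a' assume "a \<in> ?W" "a' \<in> ?W"
    then obtain h h' where h: "h \<in> D" "a = h v" "h' \<in> D" "a' = h' v" by blast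
    have "(\<lambda>x. h x \<otimes> h' x) \<in> D"
      by (rule DI) (use h DC cl in \<open>auto simp: mul Dc m_ac\<close>)
    then show "a \<otimes> a' \<in> ?W" using h(2,4) by (intro image_eqI[of _ _ "\<lambda>x. h x \<otimes> h' x"]) auto
  qed
  moreover have "\<beta> ` ?W \<subseteq> ?W"
  proof safe
    fix h assume h: "h \<in> D"
    have "(\<lambda>x. \<beta> (h x)) \<in> D"
      by (rule DI) (use h bC DC cl in \<open>auto simp: mul Dc cb\<close>)
    then show "\<beta> (h v) \<in> ?W" by (intro image_eqI[of _ _ "\<lambda>x. \<beta> (h x)"]) auto
  qed
  moreover have "v \<in> ?W"
  proof -
    have "(\<lambda>x. x) \<in> D" by (rule DI) auto
    then show ?thesis by (intro image_eqI[of _ _ "\<lambda>x. x"]) auto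
  qed
  ultimately have W: "?W = carrier G" using irr v by blast
  have d1C: "d1 \<in> C" and d2C: "d2 \<in> C" using d1 d2 by (auto simp: C_def)
  have "d1 v \<in> ?W" unfolding W using cl d1C v by simp
  then obtain h where h: "h \<in> D" "d1 v = h v" by auto
  have eq: "d1 y = h y" if y: "y \<in> carrier G" for y
  proof -
    obtain g where g: "g \<in> D" "y = g v" using y unfolding W[symmetric] by blast
    have "d1 y = g (d1 v)" unfolding g(2) using Dc[OF g(1) d1C v(1)] by simp
    also have "\<dots> = h y" unfolding h(2) g(2) using Dc[OF h(1) DC[OF g(1)] v(1)] by simp
    finally show ?thesis .
  qed
  then have "d1 (d2 x) = h (d2 x)" using cl[OF d2C x] by simp
  also have "\<dots> = d2 (h x)" using Dc[OF h(1) d2C x] .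
  finally show ?thesis using eq[OF x] by simp
qed

lemma hom_finprod_atMost:
  assumes d: "\<delta> \<in> hom G G" and f: "\<And>i. f i \<in> carrier G"
  shows "\<delta> (finprod G f {..n::nat}) = finprod G (\<lambda>i. \<delta> (f i)) {..n}"
proof -
  interpret d: group_hom G G \<delta> by unfold_locales (rule d)
  show ?thesis by (induction n) (use f in \<open>auto simp: Pi_def\<close>)
qed

lemma finprod_swap_atMost:
  assumes "\<And>i j. f i j \<in> carrier G"
  shows "finprod G (\<lambda>i. finprod G (f i) {..m::nat}) {..n::nat} = finprod G (\<lambda>j. finprod G (\<lambda>i. f i j) {..n}) {..m}"
proof (induction n)
  case 0
  then show ?case using assms by (simp add: Pi_def)
next
  case (Suc n)
  have "finprod G (\<lambda>j. finprod G (\<lambda>i. f i j) {..Suc n}) {..m}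
     = finprod G (\<lambda>j. f (Suc n) j \<otimes> finprod G (\<lambda>i. f i j) {..n}) {..m}"
    using assms by (simp add: Pi_def)
  also have "\<dots> = finprod G (f (Suc n)) {..m} \<otimes> finprod G (\<lambda>j. finprod G (\<lambda>i. f i j) {..n}) {..m}"
    using assms by (intro finprod_multf) auto
  finally show ?case using Suc assms by (simp add: Pi_def)
qed

text \<open>
  The product over an orbit of \<open>\<delta>\<close> is fixed by \<open>\<delta>\<close>. The fixed points form a \<open>\<beta>\<close>-invariant subgroup,
  which is proper since \<open>\<delta>\<close> moves \<open>y\<close>.
\<close>

lemma norm_eq_one:
  assumes irr: "\<And>W. subgroup W G \<Longrightarrow> \<beta> ` W \<subseteq> W \<Longrightarrow> W = {\<one>} \<or> W = carrier G"
    and d: "\<delta> \<in> hom G G" and comm: "\<And>x. x \<in> carrier G \<Longrightarrow> \<delta> (\<beta> x) = \<beta> (\<delta> x)"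
    and b: "\<beta> \<in> hom G G"
    and q: "\<And>x. x \<in> carrier G \<Longrightarrow> (\<delta> ^^ Suc n) x = x"
    and ne: "y \<in> carrier G" "\<delta> y \<noteq> y"
    and w: "w \<in> carrier G"
  shows "finprod G (\<lambda>i. (\<delta> ^^ i) w) {..n} = \<one>"
proof -
  interpret d: group_hom G G \<delta> by unfold_locales (rule d)
  interpret b: group_hom G G \<beta> by unfold_locales (rule b)
  have cl: "(\<delta> ^^ i) w \<in> carrier G" for i by (induction i) (use w in auto)
  let ?F = "{x \<in> carrier G. \<delta> x = x}"
  have "subgroup ?F G" by (intro subgroupI) (auto intro: exI[of _ \<one>])
  moreover have "\<beta> ` ?F \<subseteq> ?F" using comm by auto
  ultimately have F: "?F = {\<one>}" using irr[of ?F] ne by blast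
  have "\<delta> (finprod G (\<lambda>i. (\<delta> ^^ i) w) {..n}) = finprod G (\<lambda>i. (\<delta> ^^ Suc i) w) {..n}"
    by (subst hom_finprod_atMost[OF d]) (use cl in auto)
  also have "\<dots> \<otimes> w = (\<delta> ^^ Suc n) w \<otimes> finprod G (\<lambda>i. (\<delta> ^^ i) w) {..n}"
    using finprod_Suc[of "\<lambda>i. (\<delta> ^^ i) w" n] finprod_Suc2[of "\<lambda>i. (\<delta> ^^ i) w" n] cl by (simp del: funpow.simps(2) add: funpow_0)
  finally have "\<delta> (finprod G (\<lambda>i. (\<delta> ^^ i) w) {..n}) \<otimes> w = finprod G (\<lambda>i. (\<delta> ^^ i) w) {..n} \<otimes> w"
    using q[OF w] cl w by (simp add: m_comm Pi_def)
  then have "\<delta> (finprod G (\<lambda>i. (\<delta> ^^ i) w) {..n}) = finprod G (\<lambda>i. (\<delta> ^^ i) w) {..n}"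
    using cl w by (simp add: Pi_def)
  then have "finprod G (\<lambda>i. (\<delta> ^^ i) w) {..n} \<in> ?F" using cl by auto
  then show ?thesis using F by blast
qed

text \<open>
  A version of the fact that a noncyclic group of order \<open>q\<^sup>2\<close> cannot act faithfully on an irreducible
  module. Arrange \<open>\<beta>\<^sup>i\<^sup>j \<kappa>\<^sup>j x\<close> in a square with rows \<open>i\<close> and columns \<open>j\<close>, both running from \<open>0\<close> to \<open>q - 1\<close>. Row
  \<open>i\<close> is an orbit of \<open>\<beta>\<^sup>i \<kappa>\<close>, column \<open>j \<noteq> 0\<close> an orbit of \<open>\<beta>\<^sup>j\<close>, and column \<open>0\<close> is constantly \<open>x\<close>. If no
  \<open>\<beta>\<^sup>i \<kappa>\<close> is the identity, all rows and all columns except column \<open>0\<close> have trivial product, which leaves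
  \<open>x\<^sup>q = \<one>\<close> for all \<open>x\<close>. Hence some \<open>\<beta>\<^sup>i \<kappa>\<close> is the identity, \<open>\<beta>\<close> is a power of \<open>\<kappa>\<close>, and \<open>\<kappa>\<close>-invariant
  subgroups are \<open>\<beta>\<close>-invariant.
\<close>

lemma irreducible_under_commuting_prime_order:
  assumes q: "Factorial_Ring.prime (q::nat)"
    and b: "\<beta> \<in> hom G G" "\<And>x. x \<in> carrier G \<Longrightarrow> (\<beta> ^^ q) x = x"
    and irr: "\<And>W. subgroup W G \<Longrightarrow> \<beta> ` W \<subseteq> W \<Longrightarrow> W = {\<one>} \<or> W = carrier G"
    and k: "\<kappa> \<in> hom G G" "\<And>x. x \<in> carrier G \<Longrightarrow> (\<kappa> ^^ q) x = x"
    and comm: "\<And>x. x \<in> carrier G \<Longrightarrow> \<kappa> (\<beta> x) = \<beta> (\<kappa> x)"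
    and ne: "y \<in> carrier G" "\<kappa> y \<noteq> y"
    and tor: "\<And>x. x \<in> carrier G \<Longrightarrow> x [^] q = \<one> \<Longrightarrow> x = \<one>"
    and W: "subgroup W G" "\<kappa> ` W \<subseteq> W"
  shows "W = {\<one>} \<or> W = carrier G"
proof -
  interpret b: group_hom G G \<beta> by unfold_locales (rule b)
  interpret k: group_hom G G \<kappa> by unfold_locales (rule k)
  obtain n where n: "q = Suc n" using prime_gt_0_nat[OF q] gr0_implies_Suc by blast
  have bcl: "(\<beta> ^^ i) x \<in> carrier G" if "x \<in> carrier G" for i x by (induction i) (use that in auto)
  have kcl: "(\<kappa> ^^ i) x \<in> carrier G" if "x \<in> carrier G" for i x by (induction i) (use that in auto)
  have bhom: "\<beta> ^^ i \<in> hom G G" for i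
    by (induction i) (auto simp: hom_def bcl intro!: bcl)
  have bq: "(\<beta> ^^ (q * i)) x = x" if "x \<in> carrier G" for i x
    by (induction i) (use that b(2) in \<open>auto simp: funpow_add\<close>)
  have comm': "\<kappa> ((\<beta> ^^ i) x) = (\<beta> ^^ i) (\<kappa> x)" if "x \<in> carrier G" for i x
    by (induction i) (use that comm bcl in auto)
  have "\<beta> ` W \<subseteq> W"
  proof (cases "\<forall>x\<in>carrier G. \<beta> x = x")
    case True
    then show ?thesis using subgroup.subset[OF W(1)] by auto
  next
    case False
    then obtain z where z: "z \<in> carrier G" "\<beta> z \<noteq> z" by blast
    define d where "d i x = (\<beta> ^^ i) (\<kappa> x)" for i x
    have dhom: "d i \<in> hom G G" for i using k(1) bhom[of i] by (auto simp: d_def hom_def Pi_def)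
    have dpow: "(d i ^^ j) x = (\<beta> ^^ (i * j)) ((\<kappa> ^^ j) x)" if "x \<in> carrier G" for i j x
    proof (induction j)
      case (Suc j)
      have "(d i ^^ Suc j) x = (\<beta> ^^ i) (\<kappa> ((\<beta> ^^ (i * j)) ((\<kappa> ^^ j) x)))"
        by (simp add: Suc) (simp add: d_def)
      also have "\<dots> = (\<beta> ^^ (i * Suc j)) ((\<kappa> ^^ Suc j) x)"
        using that kcl by (simp add: comm' funpow_add)
      finally show ?case .
    qed simp
    have "\<exists>i\<le>n. \<forall>x\<in>carrier G. d i x = x"
    proof (rule ccontr)
      assume none: "\<not> (\<exists>i\<le>n. \<forall>x\<in>carrier G. d i x = x)"
      have "x = \<one>" if x: "x \<in> carrier G" for x
      proof (rule tor[OF x])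
        define f where "f i j = (\<beta> ^^ (i * j)) ((\<kappa> ^^ j) x)" for i j
        have fcl: "f i j \<in> carrier G" for i j unfolding f_def using bcl kcl x by simp
        (* With q = Suc n, the index range {..n} has q elements. *)
        have row: "finprod G (f i) {..n} = \<one>" if i: "i \<le> n" for i
        proof -
          obtain y' where y': "y' \<in> carrier G" "d i y' \<noteq> y'" using none i by blast
          have "finprod G (\<lambda>j. (d i ^^ j) x) {..n} = \<one>"
          proof (rule norm_eq_one[OF irr dhom _ b(1) _ y' x])
            fix a assume a: "a \<in> carrier G"
            show "d i (\<beta> a) = \<beta> (d i a)" unfolding d_def using a comm by (simp add: funpow_swap1)
            have "(d i ^^ q) a = (\<beta> ^^ (q * i)) ((\<kappa> ^^ q) a)" unfolding mult.commute[of q i] by (rule dpow[OF a])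
            then show "(d i ^^ Suc n) a = a" unfolding n[symmetric] using bq k(2) a by simp
          qed
          moreover have "(\<lambda>j. (d i ^^ j) x) = f i" using dpow[OF x] by (simp add: f_def fun_eq_iff)
          ultimately show ?thesis by simp
        qed
        have col: "finprod G (\<lambda>i. f i j) {..n} = \<one>" if j: "j \<noteq> 0" "j \<le> n" for j
        proof -
          obtain a c where ac: "j * a = q * c + 1" using inverse_mod_prime[OF q, of j] j n by auto
          have "(\<beta> ^^ j) z \<noteq> z"
          proof
            assume fix1: "(\<beta> ^^ j) z = z"
            have "(\<beta> ^^ (j * a)) z = z" for a by (induction a) (use fix1 in \<open>auto simp: funpow_add\<close>)
            then have "\<beta> ((\<beta> ^^ (q * c)) z) = z" using ac by (metis Suc_eq_plus1 comp_apply funpow.simps(2))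
            then show False using bq z by simp
          qed
          then have "finprod G (\<lambda>i. ((\<beta> ^^ j) ^^ i) ((\<kappa> ^^ j) x)) {..n} = \<one>"
          proof (intro norm_eq_one[OF irr bhom _ b(1) _ z(1) _ kcl[OF x]])
            fix a assume a: "a \<in> carrier G"
            show "(\<beta> ^^ j) (\<beta> a) = \<beta> ((\<beta> ^^ j) a)" by (simp add: funpow_swap1)
            show "((\<beta> ^^ j) ^^ Suc n) a = a" using bq[OF a, of j] by (simp add: funpow_mult n mult.commute[of j] del: funpow.simps)
          qed auto
          then show ?thesis by (simp add: f_def funpow_mult mult.commute)
        qed
        have "\<one> = finprod G (\<lambda>i. finprod G (f i) {..n}) {..n}"
          using row by (intro finprod_one_eqI[symmetric]) auto
        also have "\<dots> = finprod G (\<lambda>j. finprod G (\<lambda>i. f i j) {..n}) {..n}"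
          by (rule finprod_swap_atMost) (rule fcl)
        also have "\<dots> = finprod G (\<lambda>j. if j = 0 then x [^] q else \<one>) {..n}"
        proof (rule finprod_cong')
          fix j assume j: "j \<in> {..n}"
          show "finprod G (\<lambda>i. f i j) {..n} = (if j = 0 then x [^] q else \<one>)"
            using col[of j] j finprod_const[OF x, of "{..n}"] by (auto simp: f_def n)
        qed (use x in auto)
        also have "\<dots> = x [^] q"
          using finprod_singleton[of 0 "{..n}" "\<lambda>_. x [^] q"] x by simp
        finally show "x [^] q = \<one>" by simp
      qed
      then show False using ne k.hom_closed by metis
    qed
    then obtain i where i: "i \<le> n" "\<And>x. x \<in> carrier G \<Longrightarrow> d i x = x" by blast
    have "i \<noteq> 0" using i(2)[OF ne(1)] ne(2) by (cases "i = 0") (auto simp: d_def)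
    (* As n = q - 1, the a-th power of the identity map d i reads beta^(-1) kappa^a. *)
    then obtain a c where ac: "i * a = q * c + n"
    proof -
      obtain a c where ac: "i * a = q * c + 1" using inverse_mod_prime[OF q, of i] \<open>i \<noteq> 0\<close> i(1) n by auto
      have "i * (a * n) = q * (c * n) + n" using ac by (metis add_mult_distrib mult.assoc mult_1)
      then show ?thesis by (rule that)
    qed
    have "\<beta> x = (\<kappa> ^^ a) x" if x: "x \<in> carrier G" for x
    proof -
      have fix1: "(d i ^^ a) x = x" by (induction a) (use i(2) x in auto)
      have "(d i ^^ a) x = (\<beta> ^^ (i * a)) ((\<kappa> ^^ a) x)" by (rule dpow[OF x])
      then have "\<beta> x = (\<beta> ^^ Suc (i * a)) ((\<kappa> ^^ a) x)" using fix1 by simp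
      also have "Suc (i * a) = q * (c + 1)" using ac n by simp
      finally show ?thesis using bq kcl x by metis
    qed
    moreover have "(\<kappa> ^^ a) x \<in> W" if "x \<in> W" for x a by (induction a) (use that W in auto)
    ultimately show ?thesis using subgroup.mem_carrier[OF W(1)] by auto
  qed
  then show ?thesis using irr W by blast
qed

end

section \<open>The endomorphism monoid and inner automorphisms\<close>

lemma End_carrier_iff: "f \<in> carrier (End_semigroup G) \<longleftrightarrow> f \<in> hom G G \<and> f \<in> extensional (carrier G)"
  by (simp add: End_semigroup_def)

lemma End_mult_apply:
  "x \<in> carrier G \<Longrightarrow> (f \<otimes>\<^bsub>End_semigroup G\<^esub> g) x = g (f x)"
  by (simp add: End_semigroup_def compose_def)

lemma End_mult_eqD:
  "f \<otimes>\<^bsub>End_semigroup G\<^esub> g = h \<Longrightarrow> x \<in> carrier G \<Longrightarrow> g (f x) = h x"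
  by (metis End_mult_apply)

lemma End_one_apply: "x \<in> carrier G \<Longrightarrow> \<one>\<^bsub>End_semigroup G\<^esub> x = x"
  by (simp add: End_semigroup_def)

lemma End_eqI:
  assumes "f \<in> carrier (End_semigroup G)" "g \<in> carrier (End_semigroup G)"
    and "\<And>x. x \<in> carrier G \<Longrightarrow> f x = g x"
  shows "f = g"
  using assms by (auto simp: End_carrier_iff intro: extensionalityI)

context group begin

lemma End_restrictI:
  assumes "f \<in> hom G G"
  shows "restrict f (carrier G) \<in> carrier (End_semigroup G)"
  using assms by (auto simp: End_carrier_iff hom_def)

lemma End_apply_closed: "f \<in> carrier (End_semigroup G) \<Longrightarrow> x \<in> carrier G \<Longrightarrow> f x \<in> carrier G"
  by (auto simp: End_carrier_iff hom_def)

lemma End_group_hom: "f \<in> carrier (End_semigroup G) \<Longrightarrow> group_hom G G f"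
  by (auto simp: End_carrier_iff group_hom_def group_hom_axioms_def is_group)

lemma End_mult_closed:
  assumes "f \<in> carrier (End_semigroup G)" "g \<in> carrier (End_semigroup G)"
  shows "f \<otimes>\<^bsub>End_semigroup G\<^esub> g \<in> carrier (End_semigroup G)"
proof -
  have "compose (carrier G) g f \<in> hom G G"
    using assms by (intro hom_compose) (auto simp: End_carrier_iff)
  then show ?thesis by (simp add: End_semigroup_def compose_def)
qed

lemma End_monoid: "monoid (End_semigroup G)"
proof (rule monoidI)
  show "\<one>\<^bsub>End_semigroup G\<^esub> \<in> carrier (End_semigroup G)"
    by (auto simp: End_semigroup_def hom_def)
  then show "\<one>\<^bsub>End_semigroup G\<^esub> \<otimes>\<^bsub>End_semigroup G\<^esub> f = f" "f \<otimes>\<^bsub>End_semigroup G\<^esub> \<one>\<^bsub>End_semigroup G\<^esub> = f"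
    if "f \<in> carrier (End_semigroup G)" for f
    using that by (auto intro!: End_eqI[of _ G] simp: End_mult_closed End_mult_apply End_one_apply End_apply_closed)
qed (auto intro!: End_eqI[of _ G] simp: End_mult_closed End_mult_apply End_apply_closed)

lemma End_Units:
  assumes s: "s \<in> carrier (End_semigroup G)" and bij: "bij_betw s (carrier G) (carrier G)"
  shows "s \<in> Units (End_semigroup G)"
proof -
  have "s \<in> iso G G" using s bij by (simp add: iso_def End_carrier_iff)
  then have t: "inv_into (carrier G) s \<in> iso G G" by (rule iso_set_sym)
  let ?t = "restrict (inv_into (carrier G) s) (carrier G)"
  have tE: "?t \<in> carrier (End_semigroup G)" using t by (intro End_restrictI) (simp add: iso_def)
  interpret S: monoid "End_semigroup G" by (rule End_monoid)
  have "?t \<otimes>\<^bsub>End_semigroup G\<^esub> s = \<one>\<^bsub>End_semigroup G\<^esub>" "s \<otimes>\<^bsub>End_semigroup G\<^esub> ?t = \<one>\<^bsub>End_semigroup G\<^esub>"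
    using s tE bij End_apply_closed[OF s]
    by (auto intro!: End_eqI[of _ G] simp: End_mult_apply End_one_apply bij_betw_inv_into_right bij_betw_inv_into_left)
  then show ?thesis using s tE unfolding Units_def by blast
qed

lemma End_Units_bij:
  assumes s: "s \<in> Units (End_semigroup G)"
  shows "bij_betw s (carrier G) (carrier G)"
proof -
  obtain t where t: "t \<in> carrier (End_semigroup G)" "t \<otimes>\<^bsub>End_semigroup G\<^esub> s = \<one>\<^bsub>End_semigroup G\<^esub>"
    "s \<otimes>\<^bsub>End_semigroup G\<^esub> t = \<one>\<^bsub>End_semigroup G\<^esub>" and sc: "s \<in> carrier (End_semigroup G)"
    using s unfolding Units_def by blast
  show ?thesis
  proof (rule bij_betw_byWitness[where f' = t])
    show "\<forall>x\<in>carrier G. t (s x) = x" using t(3) End_mult_apply[of _ G s t] End_one_apply[of _ G] by auto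
    show "\<forall>x\<in>carrier G. s (t x) = x" using t(2) End_mult_apply[of _ G t s] End_one_apply[of _ G] by auto
  qed (use End_apply_closed t(1) sc in auto)
qed

text \<open>
  The inverse stands on the left so that \<open>inner\<close> is multiplicative for maps written on the right.
\<close>

definition inner :: "'a \<Rightarrow> 'a \<Rightarrow> 'a" where
  "inner g = (\<lambda>x \<in> carrier G. inv g \<otimes> x \<otimes> g)"

lemma inner_apply: "x \<in> carrier G \<Longrightarrow> inner g x = inv g \<otimes> x \<otimes> g"
  by (simp add: inner_def)

lemma inner_End: "g \<in> carrier G \<Longrightarrow> inner g \<in> carrier (End_semigroup G)"
  unfolding inner_def by (rule End_restrictI) (auto simp: hom_def word_simps)

lemma inner_mult:
  assumes "g \<in> carrier G" "h \<in> carrier G"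
  shows "inner g \<otimes>\<^bsub>End_semigroup G\<^esub> inner h = inner (g \<otimes> h)"
  using assms by (auto intro!: End_eqI[of _ G] simp: End_mult_closed inner_End End_mult_apply inner_apply word_simps)

lemma inner_one: "inner \<one> = \<one>\<^bsub>End_semigroup G\<^esub>"
  using monoid.one_closed[OF End_monoid]
  by (auto intro!: End_eqI[of _ G] simp: inner_End End_one_apply inner_apply)

lemma inner_r_inv: "x \<in> carrier G \<Longrightarrow> inner x \<otimes>\<^bsub>End_semigroup G\<^esub> inner (inv x) = \<one>\<^bsub>End_semigroup G\<^esub>"
  by (simp add: inner_mult inner_one)

lemma inner_l_inv: "x \<in> carrier G \<Longrightarrow> inner (inv x) \<otimes>\<^bsub>End_semigroup G\<^esub> inner x = \<one>\<^bsub>End_semigroup G\<^esub>"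
  by (simp add: inner_mult inner_one)

lemma conjugate_inner:
  assumes s: "s \<in> carrier (End_semigroup G)" "s' \<in> carrier (End_semigroup G)"
      "s' \<otimes>\<^bsub>End_semigroup G\<^esub> s = \<one>\<^bsub>End_semigroup G\<^esub>" and x: "x \<in> carrier G"
  shows "s' \<otimes>\<^bsub>End_semigroup G\<^esub> inner x \<otimes>\<^bsub>End_semigroup G\<^esub> s = inner (s x)"
proof (rule End_eqI)
  show "s' \<otimes>\<^bsub>End_semigroup G\<^esub> inner x \<otimes>\<^bsub>End_semigroup G\<^esub> s \<in> carrier (End_semigroup G)" "inner (s x) \<in> carrier (End_semigroup G)"
    using s x by (auto simp: inner_End End_apply_closed End_mult_closed)
  interpret s: group_hom G G s by (rule End_group_hom[OF s(1)])
  fix z assume z: "z \<in> carrier G"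
  have "s (s' z) = z" using s(3) z End_mult_apply[OF z, of s' s] End_one_apply[OF z] by simp
  then show "(s' \<otimes>\<^bsub>End_semigroup G\<^esub> inner x \<otimes>\<^bsub>End_semigroup G\<^esub> s) z = inner (s x) z"
    using s x z by (simp add: End_mult_apply inner_apply End_apply_closed[OF s(2)])
qed

lemma inner_eq_iff:
  assumes "g \<in> carrier G" "h \<in> carrier G"
  shows "inner g = inner h \<longleftrightarrow> (\<forall>x\<in>carrier G. (g \<otimes> inv h) \<otimes> x = x \<otimes> (g \<otimes> inv h))"
proof -
  have "inv g \<otimes> x \<otimes> g = inv h \<otimes> x \<otimes> h \<longleftrightarrow> (g \<otimes> inv h) \<otimes> x = x \<otimes> (g \<otimes> inv h)" (is "?A \<longleftrightarrow> ?B")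
    if x: "x \<in> carrier G" for x
  proof
    assume ?A
    then have "g \<otimes> (inv g \<otimes> x \<otimes> g) \<otimes> inv h = g \<otimes> (inv h \<otimes> x \<otimes> h) \<otimes> inv h" by simp
    then show ?B using x assms by (simp add: word_simps)
  next
    assume ?B
    then have "inv g \<otimes> ((g \<otimes> inv h) \<otimes> x) \<otimes> h = inv g \<otimes> (x \<otimes> (g \<otimes> inv h)) \<otimes> h" by simp
    then show ?A using x assms by (simp add: word_simps)
  qed
  then show ?thesis by (auto simp: inner_def fun_eq_iff)
qed

lemma inner_eq_one_iff:
  assumes "g \<in> carrier G"
  shows "inner g = \<one>\<^bsub>End_semigroup G\<^esub> \<longleftrightarrow> (\<forall>x\<in>carrier G. g \<otimes> x = x \<otimes> g)"
  using inner_eq_iff[of g \<one>] assms by (simp add: inner_one)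

end

section \<open>Groups whose endomorphisms form a chain\<close>

text \<open>
  The cyclic groups of prime power order have these properties. Apart from the trivial group they are
  the only such groups with finite endomorphism monoid (\<open>cyclic_of_prime_power_order\<close>).
\<close>

locale chain_endomorphisms = group +
  assumes End_commute: "f \<in> carrier (End_semigroup G) \<Longrightarrow> g \<in> carrier (End_semigroup G) \<Longrightarrow>
      f \<otimes>\<^bsub>End_semigroup G\<^esub> g = g \<otimes>\<^bsub>End_semigroup G\<^esub> f"
    and End_chain: "f \<in> carrier (End_semigroup G) \<Longrightarrow> g \<in> carrier (End_semigroup G) \<Longrightarrow>
      \<exists>u\<in>carrier (End_semigroup G). f = g \<otimes>\<^bsub>End_semigroup G\<^esub> u \<or> g = f \<otimes>\<^bsub>End_semigroup G\<^esub> u"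
begin

lemma kernels_chain:
  assumes f: "f \<in> hom G G" and g: "g \<in> hom G G"
  shows "(\<forall>x\<in>carrier G. f x = \<one> \<longrightarrow> g x = \<one>) \<or> (\<forall>x\<in>carrier G. g x = \<one> \<longrightarrow> f x = \<one>)"
proof -
  let ?f = "restrict f (carrier G)" and ?g = "restrict g (carrier G)"
  obtain u where u: "u \<in> carrier (End_semigroup G)"
    and or: "?f = ?g \<otimes>\<^bsub>End_semigroup G\<^esub> u \<or> ?g = ?f \<otimes>\<^bsub>End_semigroup G\<^esub> u"
    using End_chain[OF End_restrictI[OF f] End_restrictI[OF g]] by blast
  have u1: "u \<one> = \<one>" using group_hom.hom_one[OF End_group_hom[OF u]] .
  from or show ?thesis
  proof
    assume a: "?f = ?g \<otimes>\<^bsub>End_semigroup G\<^esub> u"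
    have "f x = u (g x)" if "x \<in> carrier G" for x
      using fun_cong[OF a, of x] that by (simp add: End_mult_apply)
    then show ?thesis using u1 by simp
  next
    assume a: "?g = ?f \<otimes>\<^bsub>End_semigroup G\<^esub> u"
    have "g x = u (f x)" if "x \<in> carrier G" for x
      using fun_cong[OF a, of x] that by (simp add: End_mult_apply)
    then show ?thesis using u1 by simp
  qed
qed

lemma images_chain:
  assumes f: "f \<in> hom G G" and g: "g \<in> hom G G"
  shows "f ` carrier G \<subseteq> g ` carrier G \<or> g ` carrier G \<subseteq> f ` carrier G"
proof -
  let ?f = "restrict f (carrier G)" and ?g = "restrict g (carrier G)"
  obtain u where u: "u \<in> carrier (End_semigroup G)"
    and or: "?f = ?g \<otimes>\<^bsub>End_semigroup G\<^esub> u \<or> ?g = ?f \<otimes>\<^bsub>End_semigroup G\<^esub> u"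
    using End_chain[OF End_restrictI[OF f] End_restrictI[OF g]] by blast
  from or show ?thesis
  proof
    assume "?f = ?g \<otimes>\<^bsub>End_semigroup G\<^esub> u"
    then have a: "?f = u \<otimes>\<^bsub>End_semigroup G\<^esub> ?g" using End_commute[OF u End_restrictI[OF g]] by simp
    have "f x = g (u x)" if "x \<in> carrier G" for x
      using fun_cong[OF a, of x] that End_apply_closed[OF u that] by (simp add: End_mult_apply)
    then show ?thesis using End_apply_closed[OF u] by auto
  next
    assume "?g = ?f \<otimes>\<^bsub>End_semigroup G\<^esub> u"
    then have a: "?g = u \<otimes>\<^bsub>End_semigroup G\<^esub> ?f" using End_commute[OF u End_restrictI[OF f]] by simp
    have "g x = f (u x)" if "x \<in> carrier G" for x
      using fun_cong[OF a, of x] that End_apply_closed[OF u that] by (simp add: End_mult_apply)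
    then show ?thesis using End_apply_closed[OF u] by auto
  qed
qed

lemma commutator_central:
  assumes x: "x \<in> carrier G" and y: "y \<in> carrier G" and z: "z \<in> carrier G"
  shows "(x \<otimes> y \<otimes> inv x \<otimes> inv y) \<otimes> z = z \<otimes> (x \<otimes> y \<otimes> inv x \<otimes> inv y)"
proof -
  have "inner (x \<otimes> y) = inner (y \<otimes> x)"
    using End_commute[OF inner_End[OF x] inner_End[OF y]] by (simp add: inner_mult x y)
  then show ?thesis using inner_eq_iff[of "x \<otimes> y" "y \<otimes> x"] x y z by (simp add: word_simps)
qed

text \<open>
  As inner automorphisms commute, commutators are central, and \<open>y \<mapsto> [x, y]\<close> is an endomorphism for every
  \<open>x\<close>. The kernels of \<open>[x, \<cdot>]\<close> and \<open>[y, \<cdot>]\<close> are comparable; the first contains \<open>x\<close> and the second \<open>y\<close>, so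
  one of them contains both.
\<close>

lemma commutative:
  assumes x: "x \<in> carrier G" and y: "y \<in> carrier G"
  shows "x \<otimes> y = y \<otimes> x"
proof -
  let ?ad = "\<lambda>x y. x \<otimes> y \<otimes> inv x \<otimes> inv y"
  have ad: "?ad x \<in> hom G G" if x: "x \<in> carrier G" for x
  proof (rule homI)
    fix y z assume y: "y \<in> carrier G" and z: "z \<in> carrier G"
    have "?ad x (y \<otimes> z) = ?ad x y \<otimes> (y \<otimes> (?ad x z \<otimes> inv y))"
      using x y z by (simp add: word_simps)
    also have "?ad x z \<otimes> inv y = inv y \<otimes> ?ad x z" using commutator_central[OF x z inv_closed[OF y]] .
    also have "y \<otimes> (inv y \<otimes> ?ad x z) = ?ad x z" using x y z by (simp add: inv_cancel_left)
    finally show "?ad x (y \<otimes> z) = ?ad x y \<otimes> ?ad x z" .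
  qed (use x in simp)
  have "?ad x x = \<one>" "?ad y y = \<one>" using x y commutator_eq_one_iff by auto
  then have "?ad y x = \<one> \<or> ?ad x y = \<one>" using kernels_chain[OF ad[OF x] ad[OF y]] x y by blast
  then show ?thesis using commutator_eq_one_iff x y by auto
qed

lemma comm_group: "comm_group G"
  by (rule group_comm_groupI) (rule commutative)

lemma power_hom: "(\<lambda>x. x [^] (n::nat)) \<in> hom G G"
proof -
  interpret comm_group G by (rule comm_group)
  show ?thesis by (auto simp: hom_def nat_pow_distrib)
qed

text \<open>
  As there are only finitely many endomorphisms, the power maps for two different exponents coincide.
\<close>

lemma bounded_exponent:
  assumes "finite (carrier (End_semigroup G))"
  obtains n where "n > 0" "\<And>x. x \<in> carrier G \<Longrightarrow> x [^] (n::nat) = \<one>"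
proof -
  let ?e = "\<lambda>n::nat. restrict (\<lambda>x. x [^] n) (carrier G)"
  have "range ?e \<subseteq> carrier (End_semigroup G)" using End_restrictI[OF power_hom] by auto
  then have "\<not> inj ?e" using assms finite_imageD[of ?e UNIV] finite_subset infinite_UNIV_nat by blast
  then obtain i j where "i \<noteq> j" "?e i = ?e j" unfolding inj_def by blast
  then obtain i j where ij: "i < j" "?e i = ?e j" by (metis nat_neq_iff)
  show thesis
  proof
    show "j - i > 0" using ij by simp
    fix x assume x: "x \<in> carrier G"
    have "x [^] i \<otimes> x [^] (j - i) = x [^] j" using x ij(1) by (simp add: nat_pow_mult)
    also have "\<dots> = x [^] i" using fun_cong[OF ij(2), of x] x by simp
    finally show "x [^] (j - i) = \<one>" using x by (simp add: r_cancel_one)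
  qed
qed

text \<open>
  Since kernels of power maps are comparable, elements whose order is prime to \<open>r\<close> cannot coexist with
  the element \<open>u\<close> of order \<open>r\<close>, and the group is an \<open>r\<close>-group of bounded exponent. Since images of
  homomorphisms onto subgroups of order \<open>r\<close> are comparable, there is only one such subgroup. An abelian
  group of this kind is generated by any element \<open>x\<close> of largest order.
\<close>

lemma cyclic_of_prime_power_order:
  assumes fin: "finite (carrier (End_semigroup G))" and nt: "carrier G \<noteq> {\<one>}"
  obtains r a x where "Factorial_Ring.prime r" "x \<in> carrier G" "carrier G = generate G {x}" "ord x = r ^ a"
proof -
  interpret comm_group G by (rule comm_group)
  obtain n where n: "n > 0" "\<And>x. x \<in> carrier G \<Longrightarrow> x [^] (n::nat) = \<one>"
    using bounded_exponent[OF fin] by blast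
  obtain r x0 u where r: "Factorial_Ring.prime r" and x0: "x0 \<in> carrier G"
    and u: "u \<in> carrier G" "u \<noteq> \<one>" "u [^] (r::nat) = \<one>"
    and homs: "\<And>u. u \<in> carrier G \<Longrightarrow> u [^] r = \<one> \<Longrightarrow> \<exists>f. f \<in> hom G G \<and> f x0 = u \<and> (\<forall>y\<in>{\<one>}. f y = \<one>) \<and>
        (\<forall>h\<in>carrier G. \<exists>i::int. f h = u [^] i)"
  proof (rule exists_hom_onto_prime_order[OF triv_subgroup _ _ order_refl n])
    show "derived G (carrier G) \<subseteq> {\<one>}" by (simp add: derived_eq_singleton)
    show "\<exists>m\<in>carrier G. \<exists>y\<in>{\<one>}. h = m \<otimes> y" if "h \<in> carrier G" for h using that by auto
  qed (use nt in auto)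
  have rtor: "\<exists>A. \<forall>y\<in>carrier G. y [^] (r ^ A) = \<one>"
  proof -
    obtain a m where am: "n = r ^ a * m" "\<not> r dvd m"
      using n(1) r multiplicity_decompose'[of n r] by (metis not_prime_unit not_gr0)
    have cop: "coprime r m" using am r prime_imp_coprime by blast
    have "a \<noteq> 0"
    proof
      assume "a = 0"
      then have "u [^] m = \<one>" using am n u by simp
      then show False using pow_coprime_eq_one[OF u(1,3) _ cop] u by blast
    qed
    then have ua: "u [^] (r ^ a) = \<one>" using u by (cases a) (simp_all flip: nat_pow_pow)
    have um: "u [^] m \<noteq> \<one>" using pow_coprime_eq_one[OF u(1,3) _ cop] u by blast
    (* The kernel of the r^a-th power map is not contained in that of the m-th power map, because of u. *)
    have key: "y [^] (r ^ a) = \<one>" if "y \<in> carrier G" "y [^] m = \<one>" for y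
      using kernels_chain[OF power_hom[of m] power_hom[of "r ^ a"]] that u(1) ua um by blast
    have "y [^] (r ^ (a + a)) = \<one>" if y: "y \<in> carrier G" for y
    proof -
      have "(y [^] (r ^ a)) [^] m = \<one>" using n(2)[OF y] y am by (simp add: nat_pow_pow)
      then have "(y [^] (r ^ a)) [^] (r ^ a) = \<one>" using key y by simp
      then show ?thesis using y by (simp add: nat_pow_pow power_add)
    qed
    then show ?thesis by blast
  qed
  define A where "A = (LEAST A. \<forall>y\<in>carrier G. y [^] (r ^ A) = \<one>)"
  have A: "y [^] (r ^ A) = \<one>" if "y \<in> carrier G" for y
    using LeastI_ex[OF rtor] that unfolding A_def by blast
  have "A \<noteq> 0" using A[OF u(1)] u by (cases "A = 0") auto
  then obtain B where B: "A = Suc B" using not0_implies_Suc by blast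
  have "\<not> (\<forall>y\<in>carrier G. y [^] (r ^ B) = \<one>)"
  proof
    assume "\<forall>y\<in>carrier G. y [^] (r ^ B) = \<one>"
    then have "A \<le> B" unfolding A_def by (rule Least_le)
    then show False using B by simp
  qed
  then obtain x where x: "x \<in> carrier G" "x [^] (r ^ B) \<noteq> \<one>" by blast
  define w where "w = x [^] (r ^ B)"
  have w: "w \<in> carrier G" "w \<noteq> \<one>" using x by (auto simp: w_def)
  have wr: "w [^] r = \<one>" using A[OF x(1)] x(1) by (simp add: w_def nat_pow_pow B mult.commute)
  have socle: "\<exists>i::int. y = w [^] i" if y: "y \<in> carrier G" "y [^] r = \<one>" for y
  proof -
    obtain f where f: "f \<in> hom G G" "f x0 = w" "\<And>h. h \<in> carrier G \<Longrightarrow> \<exists>i::int. f h = w [^] i"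
      using homs[OF w(1) wr] by blast
    obtain g where g: "g \<in> hom G G" "g x0 = y" "\<And>h. h \<in> carrier G \<Longrightarrow> \<exists>i::int. g h = y [^] i"
      using homs[OF y] by blast
    from images_chain[OF f(1) g(1)] show ?thesis
    proof
      assume "f ` carrier G \<subseteq> g ` carrier G"
      then obtain h where "h \<in> carrier G" "w = g h" using f(2) x0 by blast
      then obtain i where i: "w = y [^] (i::int)" using g(3) by blast
      have "\<not> int r dvd i"
      proof
        assume "int r dvd i"
        then obtain j where "i = int r * j" by blast
        then show False using i y w by (simp add: int_pow_int flip: int_pow_pow)
      qed
      then obtain a b where ab: "i * a + int r * b = 1" by (rule prime_not_dvd_bezout[OF r])
      have "y = y [^] (i * a + int r * b)" using ab y by simp
      also have "\<dots> = (y [^] i) [^] a \<otimes> (y [^] int r) [^] b" using y by (simp add: int_pow_mult int_pow_pow)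
      also have "\<dots> = w [^] a" using y w i by (simp add: int_pow_int)
      finally show ?thesis by blast
    next
      assume "g ` carrier G \<subseteq> f ` carrier G"
      then obtain h where "h \<in> carrier G" "y = f h" using g(2) x0 by blast
      then show ?thesis using f(3) by blast
    qed
  qed
  (* If y^r = x^j, then r divides j, as otherwise the order of y would exceed that of x;
     so y differs from a power of x by an element of order at most r, a power of w. *)
  have cyc: "\<exists>j::int. y = x [^] j" if "y \<in> carrier G" "y [^] (r ^ i) = \<one>" for y i
    using that
  proof (induction i arbitrary: y)
    case 0
    then show ?case by (intro exI[of _ 0]) simp
  next
    case (Suc i)
    have "(y [^] r) [^] (r ^ i) = \<one>" using Suc.prems by (simp add: nat_pow_pow)
    then obtain j where j: "y [^] r = x [^] (j::int)" using Suc.IH[of "y [^] r"] Suc.prems by blast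
    have "int r dvd j"
    proof (rule ccontr)
      assume "\<not> int r dvd j"
      then obtain a b where ab: "j * a + int r * b = 1" by (rule prime_not_dvd_bezout[OF r])
      have "w = w [^] (j * a + int r * b)" using ab w by simp
      also have "\<dots> = (w [^] j) [^] a \<otimes> (w [^] int r) [^] b" using w by (simp add: int_pow_mult int_pow_pow)
      also have "\<dots> = (w [^] j) [^] a" using w wr by (simp add: int_pow_int)
      also have "w [^] j = (x [^] j) [^] int (r ^ B)"
        using x by (simp add: w_def int_pow_pow mult.commute flip: int_pow_int)
      also have "\<dots> = (y [^] r) [^] (r ^ B)" unfolding j[symmetric] by (rule int_pow_int)
      also have "\<dots> = \<one>" using A[of y] Suc.prems by (simp add: nat_pow_pow B)
      finally show False using w by simp
    qed
    then obtain l where l: "j = int r * l" by blast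
    let ?z = "y \<otimes> inv (x [^] l)"
    have "?z [^] r = y [^] r \<otimes> inv ((x [^] l) [^] r)"
      using Suc.prems x by (simp add: nat_pow_distrib nat_pow_inv)
    also have "(x [^] l) [^] r = (x [^] l) [^] int r" by (simp add: int_pow_int)
    also have "\<dots> = y [^] r" unfolding j l using x by (simp add: int_pow_pow mult.commute)
    finally have "?z [^] r = \<one>" using Suc.prems by simp
    then obtain k where k: "?z = w [^] (k::int)" using socle[of ?z] Suc.prems x by auto
    have "y = ?z \<otimes> x [^] l" using Suc.prems x by (simp add: m_assoc)
    also have "\<dots> = x [^] (int (r ^ B) * k + l)"
      unfolding k w_def using x by (simp add: int_pow_mult int_pow_pow[symmetric] int_pow_int del: of_nat_power)
    finally show ?case by blast
  qed
  have "carrier G = generate G {x}"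
    unfolding generate_pow[OF x(1)] using cyc[OF _ A] x(1) by auto
  moreover have "ord x dvd r ^ A" using A[OF x(1)] x(1) by (simp add: pow_eq_id)
  then obtain a where "ord x = r ^ a" using r divides_primepow_nat by blast
  ultimately show thesis using that r x(1) by blast
qed

text \<open>
  Evaluation at a generator is a bijection from the endomorphisms of a cyclic group onto the group.
\<close>

lemma cyclic_of_card_End:
  assumes card: "card (carrier (End_semigroup G)) = q ^ v" and q: "Factorial_Ring.prime (q::nat)" and v: "v \<ge> 1"
  obtains x where "x \<in> carrier G" "carrier G = generate G {x}" "ord x = q ^ v"
proof -
  let ?E = "carrier (End_semigroup G)"
  have fin: "finite ?E" using card q by (metis card.infinite not_prime_0 power_not_zero)
  have "carrier G \<noteq> {\<one>}"
  proof
    assume 1: "carrier G = {\<one>}"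
    have "f = g" if "f \<in> ?E" "g \<in> ?E" for f g
      by (rule End_eqI[OF that]) (use that 1 End_apply_closed in fastforce)
    then have "card ?E \<le> 1" using fin by (metis card_le_Suc0_iff_eq One_nat_def)
    moreover have "q ^ v > 1" using q v by (metis one_less_power prime_gt_1_nat less_le_trans zero_less_one)
    ultimately show False using card by simp
  qed
  then obtain r a x where r: "Factorial_Ring.prime r" and x: "x \<in> carrier G"
    and gen: "carrier G = generate G {x}" and ord: "ord x = r ^ a"
    by (rule cyclic_of_prime_power_order[OF fin])
  have pw: "\<exists>i::int. y = x [^] i" if "y \<in> carrier G" for y
  proof -
    have "y \<in> generate G {x}" using that by (rule subst[OF gen])
    then show ?thesis using generate_pow[OF x] by auto
  qed
  have "bij_betw (\<lambda>f. f x) ?E (carrier G)"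
  proof (rule bij_betw_imageI)
    show "inj_on (\<lambda>f. f x) ?E"
    proof (rule inj_onI)
      fix f g assume f: "f \<in> ?E" and g: "g \<in> ?E" and eq: "f x = g x"
      interpret f: group_hom G G f by (rule End_group_hom[OF f])
      interpret g: group_hom G G g by (rule End_group_hom[OF g])
      show "f = g"
      proof (rule End_eqI[OF f g])
        fix y assume "y \<in> carrier G"
        then obtain i where "y = x [^] (i::int)" using pw by blast
        then show "f y = g y" using x eq by (simp add: f.hom_int_pow g.hom_int_pow)
      qed
    qed
    show "(\<lambda>f. f x) ` ?E = carrier G"
    proof (intro equalityI subsetI)
      fix y assume "y \<in> carrier G"
      then obtain i where i: "y = x [^] (i::int)" using pw by blast
      interpret comm_group G by (rule comm_group)
      have "(\<lambda>x. x [^] i) \<in> hom G G" by (auto simp: hom_def int_pow_distrib)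
      from End_restrictI[OF this] show "y \<in> (\<lambda>f. f x) ` ?E"
        by (rule image_eqI[rotated]) (use x i in simp)
    qed (use End_apply_closed x in auto)
  qed
  then have "card ?E = card (carrier G)" by (rule bij_betw_same_card)
  also have "\<dots> = ord x" unfolding generate_pow_card[OF x] by (rule arg_cong[OF gen])
  finally have "ord x = q ^ v" using card by simp
  then show thesis by (rule that[OF x gen])
qed

end

section \<open>The characteristic properties of the monoid\<close>

text \<open>
  A monoid with identity \<open>e\<close>. For an idempotent endomorphism it is the endomorphism monoid of the
  image.
\<close>

definition corner :: "('a, 'm) monoid_scheme \<Rightarrow> 'a \<Rightarrow> 'a set" where
  "corner M e = {s \<in> carrier M. e \<otimes>\<^bsub>M\<^esub> s = s \<and> s \<otimes>\<^bsub>M\<^esub> e = s}"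

text \<open>
  The idempotents generating the same right ideal as \<open>e\<close>. For endomorphisms acting on the right these
  are the idempotents with the same kernel as \<open>e\<close>.
\<close>

definition twins :: "('a, 'm) monoid_scheme \<Rightarrow> 'a \<Rightarrow> 'a set" where
  "twins M e = {w \<in> carrier M. e \<otimes>\<^bsub>M\<^esub> w = w \<and> w \<otimes>\<^bsub>M\<^esub> e = e}"

text \<open>
  For the endomorphism monoid of a Schmidt group, \<open>e\<close> is the projection onto the complement \<open>\<langle>b\<rangle>\<close> along
  \<open>P\<close> and \<open>F\<close> is the group of inner automorphisms by elements of \<open>P\<close>. An automorphism \<open>a\<close> satisfies
  \<open>a \<otimes> e = e\<close> if it acts trivially modulo \<open>P\<close>, and \<open>e \<otimes> a = e\<close> if it fixes \<open>b\<close>.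

  The two least obvious axioms carry the arithmetic. In \<open>corner_nonunit\<close>, an endomorphism of \<open>\<langle>b\<rangle>\<close> that is
  not invertible maps \<open>b\<close> to a power of the central element \<open>b\<^sup>q\<close>, which all twins of \<open>e\<close> fix. In
  \<open>F_irreducible\<close>, the monoid cannot single out conjugation by \<open>b\<close>, so that irreducibility is required of
  every automorphism of order \<open>q\<close> that fixes \<open>b\<close> and acts trivially modulo \<open>P\<close>.
\<close>

locale schmidt_monoid = monoid M for M (structure) +
  fixes p q v k :: nat and e :: 'a and F :: "'a set"
  assumes finite_carrier: "finite (carrier M)"
    and e_closed: "e \<in> carrier M" and e_idem: "e \<otimes> e = e"
    and unit_or_factors: "s \<in> carrier M \<Longrightarrow> s \<in> Units M \<or> e \<otimes> s = s"
    and corner_card: "card (corner M e) = q ^ v"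
    and corner_comm: "s \<in> corner M e \<Longrightarrow> t \<in> corner M e \<Longrightarrow> s \<otimes> t = t \<otimes> s"
    and corner_chain: "s \<in> corner M e \<Longrightarrow> t \<in> corner M e \<Longrightarrow> \<exists>u\<in>corner M e. s = t \<otimes> u \<or> t = s \<otimes> u"
    and corner_nonunit: "s \<in> corner M e \<Longrightarrow> w \<in> twins M e \<Longrightarrow> (\<exists>u\<in>corner M e. s \<otimes> u = e) \<or> s \<otimes> w = s"
    and factor_zero: "z \<in> carrier M \<Longrightarrow> (\<And>t. t \<in> carrier M \<Longrightarrow> z \<otimes> t = z \<and> t \<otimes> z = z) \<Longrightarrow>
        s \<in> carrier M \<Longrightarrow> e \<otimes> s = s \<Longrightarrow> s \<otimes> e = z \<Longrightarrow> s = z"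
    and F_closed: "f \<in> F \<Longrightarrow> f \<in> carrier M" and F_one: "\<one> \<in> F"
    and F_mult: "f \<in> F \<Longrightarrow> g \<in> F \<Longrightarrow> f \<otimes> g \<in> F"
    and F_inv: "f \<in> F \<Longrightarrow> \<exists>g\<in>F. f \<otimes> g = \<one>"
    and F_comm: "f \<in> F \<Longrightarrow> g \<in> F \<Longrightarrow> f \<otimes> g = g \<otimes> f"
    and F_card: "card F = p ^ k" and F_nontrivial: "F \<noteq> {\<one>}"
    and F_e: "f \<in> F \<Longrightarrow> f \<otimes> e = e"
    and F_free: "f \<in> F \<Longrightarrow> e \<otimes> f = e \<Longrightarrow> f = \<one>"
    and F_commutators: "a \<in> carrier M \<Longrightarrow> a' \<in> carrier M \<Longrightarrow> a \<otimes> a' = \<one> \<Longrightarrow> a' \<otimes> a = \<one> \<Longrightarrow> a \<otimes> e = e \<Longrightarrow>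
        b \<in> carrier M \<Longrightarrow> b' \<in> carrier M \<Longrightarrow> b \<otimes> b' = \<one> \<Longrightarrow> b' \<otimes> b = \<one> \<Longrightarrow> b \<otimes> e = e \<Longrightarrow>
        a' \<otimes> b' \<otimes> a \<otimes> b \<in> F"
    and F_irreducible: "c \<in> carrier M \<Longrightarrow> c' \<in> carrier M \<Longrightarrow> c \<otimes> c' = \<one> \<Longrightarrow> c' \<otimes> c = \<one> \<Longrightarrow>
        e \<otimes> c = e \<Longrightarrow> c \<otimes> e = e \<Longrightarrow> c [^] q = \<one> \<Longrightarrow> c \<noteq> \<one> \<Longrightarrow>
        W \<subseteq> F \<Longrightarrow> \<one> \<in> W \<Longrightarrow> (\<And>f g. f \<in> W \<Longrightarrow> g \<in> W \<Longrightarrow> f \<otimes> g \<in> W) \<Longrightarrow>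
        (\<And>f. f \<in> W \<Longrightarrow> \<exists>g\<in>W. f \<otimes> g = \<one>) \<Longrightarrow> (\<And>f. f \<in> W \<Longrightarrow> c' \<otimes> f \<otimes> c \<in> W) \<Longrightarrow>
        W = {\<one>} \<or> W = F"

lemma schmidt_monoid_iso:
  assumes M: "schmidt_monoid M p q v k e F" and M2: "monoid M2" and phi: "\<phi> \<in> iso M M2"
  shows "schmidt_monoid M2 p q v k (\<phi> e) (\<phi> ` F)"
proof -
  interpret M: schmidt_monoid M p q v k e F by fact
  interpret M2: monoid M2 by fact
  have hom: "\<phi> (x \<otimes>\<^bsub>M\<^esub> y) = \<phi> x \<otimes>\<^bsub>M2\<^esub> \<phi> y" if "x \<in> carrier M" "y \<in> carrier M" for x y
    using phi that by (simp add: iso_def hom_def)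
  have bij: "bij_betw \<phi> (carrier M) (carrier M2)" using phi by (simp add: iso_def)
  have inj: "\<phi> x = \<phi> y \<longleftrightarrow> x = y" if "x \<in> carrier M" "y \<in> carrier M" for x y
    using bij that by (meson bij_betw_def inj_on_eq_iff)
  have carr: "carrier M2 = \<phi> ` carrier M" using bij by (simp add: bij_betw_def)
  have cl: "\<phi> x \<in> carrier M2" if "x \<in> carrier M" for x using that carr by simp
  have one: "\<one>\<^bsub>M2\<^esub> = \<phi> \<one>\<^bsub>M\<^esub>"
  proof (rule M2.one_unique[symmetric])
    show "\<phi> \<one>\<^bsub>M\<^esub> \<in> carrier M2" by (simp add: cl)
    fix x assume "x \<in> carrier M2"
    then obtain y where y: "y \<in> carrier M" "x = \<phi> y" unfolding carr by blast
    then show "\<phi> \<one>\<^bsub>M\<^esub> \<otimes>\<^bsub>M2\<^esub> x = x" by (simp flip: hom)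
  qed
  have ec: "e \<in> carrier M" by (rule M.e_closed)
  have corner: "corner M2 (\<phi> e) = \<phi> ` corner M e"
    unfolding corner_def carr using ec by (auto simp: inj simp flip: hom)
  have twins: "twins M2 (\<phi> e) = \<phi> ` twins M e"
    unfolding twins_def carr using ec by (auto simp: inj simp flip: hom)
  have cor_c: "s \<in> carrier M" if "s \<in> corner M e" for s using that by (simp add: corner_def)
  have tw_c: "s \<in> carrier M" if "s \<in> twins M e" for s using that by (simp add: twins_def)
  have F_c: "s \<in> carrier M" if "s \<in> F" for s using that by (rule M.F_closed)
  have pow: "\<phi> (x [^]\<^bsub>M\<^esub> n) = \<phi> x [^]\<^bsub>M2\<^esub> (n::nat)" if "x \<in> carrier M" for x n
    by (induction n) (use that in \<open>simp_all add: one hom\<close>)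
  show ?thesis
  proof (unfold_locales)
    show "finite (carrier M2)" unfolding carr using M.finite_carrier by simp
    show "\<phi> e \<in> carrier M2" using ec cl by simp
    show "\<phi> e \<otimes>\<^bsub>M2\<^esub> \<phi> e = \<phi> e" using M.e_idem ec by (simp flip: hom)
  next
    fix s assume "s \<in> carrier M2"
    then obtain t where t: "t \<in> carrier M" "s = \<phi> t" unfolding carr by blast
    from M.unit_or_factors[OF t(1)] show "s \<in> Units M2 \<or> \<phi> e \<otimes>\<^bsub>M2\<^esub> s = s"
    proof
      assume "t \<in> Units M"
      then obtain u where u: "u \<in> carrier M" "u \<otimes>\<^bsub>M\<^esub> t = \<one>\<^bsub>M\<^esub>" "t \<otimes>\<^bsub>M\<^esub> u = \<one>\<^bsub>M\<^esub>" unfolding Units_def by blast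
      then have "\<phi> u \<otimes>\<^bsub>M2\<^esub> s = \<one>\<^bsub>M2\<^esub>" "s \<otimes>\<^bsub>M2\<^esub> \<phi> u = \<one>\<^bsub>M2\<^esub>" using t by (simp_all add: one flip: hom)
      then have "s \<in> Units M2" using cl[OF u(1)] cl[OF t(1)] t(2) unfolding Units_def by blast
      then show ?thesis ..
    next
      assume "e \<otimes>\<^bsub>M\<^esub> t = t"
      then show ?thesis using t ec by (simp flip: hom)
    qed
  next
    have "inj_on \<phi> (corner M e)" using inj cor_c by (auto intro!: inj_onI)
    then show "card (corner M2 (\<phi> e)) = q ^ v" unfolding corner using M.corner_card by (simp add: card_image)
  next
    fix s t assume "s \<in> corner M2 (\<phi> e)" "t \<in> corner M2 (\<phi> e)"
    then obtain a b where a: "a \<in> corner M e" "s = \<phi> a" and b: "b \<in> corner M e" "t = \<phi> b" unfolding corner by blast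
    show "s \<otimes>\<^bsub>M2\<^esub> t = t \<otimes>\<^bsub>M2\<^esub> s" using M.corner_comm[OF a(1) b(1)] a b cor_c by (simp flip: hom)
    obtain u where u: "u \<in> corner M e" "a = b \<otimes>\<^bsub>M\<^esub> u \<or> b = a \<otimes>\<^bsub>M\<^esub> u" using M.corner_chain[OF a(1) b(1)] by blast
    then have "s = t \<otimes>\<^bsub>M2\<^esub> \<phi> u \<or> t = s \<otimes>\<^bsub>M2\<^esub> \<phi> u" using a b cor_c by (auto simp flip: hom)
    then show "\<exists>u\<in>corner M2 (\<phi> e). s = t \<otimes>\<^bsub>M2\<^esub> u \<or> t = s \<otimes>\<^bsub>M2\<^esub> u" unfolding corner using u by blast
  next
    fix s w assume "s \<in> corner M2 (\<phi> e)" "w \<in> twins M2 (\<phi> e)"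
    then obtain a b where a: "a \<in> corner M e" "s = \<phi> a" and b: "b \<in> twins M e" "w = \<phi> b" unfolding corner twins by blast
    from M.corner_nonunit[OF a(1) b(1)]
    show "(\<exists>u\<in>corner M2 (\<phi> e). s \<otimes>\<^bsub>M2\<^esub> u = \<phi> e) \<or> s \<otimes>\<^bsub>M2\<^esub> w = s"
    proof
      assume "\<exists>u\<in>corner M e. a \<otimes>\<^bsub>M\<^esub> u = e"
      then obtain u where u: "u \<in> corner M e" "a \<otimes>\<^bsub>M\<^esub> u = e" by blast
      then have "s \<otimes>\<^bsub>M2\<^esub> \<phi> u = \<phi> e" using a cor_c by (simp flip: hom)
      then show ?thesis unfolding corner using u by blast
    next
      assume "a \<otimes>\<^bsub>M\<^esub> b = a"
      then show ?thesis using a b cor_c tw_c by (simp flip: hom)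
    qed
  next
    fix z s assume z: "z \<in> carrier M2" and zero: "\<And>t. t \<in> carrier M2 \<Longrightarrow> z \<otimes>\<^bsub>M2\<^esub> t = z \<and> t \<otimes>\<^bsub>M2\<^esub> z = z"
      and s: "s \<in> carrier M2" "\<phi> e \<otimes>\<^bsub>M2\<^esub> s = s" "s \<otimes>\<^bsub>M2\<^esub> \<phi> e = z"
    obtain y t where y: "y \<in> carrier M" "z = \<phi> y" and t: "t \<in> carrier M" "s = \<phi> t" using z s(1) unfolding carr by blast
    have "y \<otimes>\<^bsub>M\<^esub> x = y \<and> x \<otimes>\<^bsub>M\<^esub> y = y" if "x \<in> carrier M" for x
      using zero[OF cl[OF that]] y that by (simp add: inj flip: hom)
    moreover have "e \<otimes>\<^bsub>M\<^esub> t = t" "t \<otimes>\<^bsub>M\<^esub> e = y" using s(2,3) y t ec by (simp_all add: inj flip: hom)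
    ultimately have "t = y" using M.factor_zero[OF y(1) _ t(1)] by blast
    then show "s = z" using y t by simp
  next
    fix f assume f: "f \<in> \<phi> ` F"
    then obtain a where a: "a \<in> F" "f = \<phi> a" by blast
    show "f \<in> carrier M2" using a F_c cl by simp
    obtain b where "b \<in> F" "a \<otimes>\<^bsub>M\<^esub> b = \<one>\<^bsub>M\<^esub>" using M.F_inv[OF a(1)] by blast
    then show "\<exists>g\<in>\<phi> ` F. f \<otimes>\<^bsub>M2\<^esub> g = \<one>\<^bsub>M2\<^esub>" using a F_c by (intro bexI[of _ "\<phi> b"]) (simp_all add: one flip: hom)
    show "f \<otimes>\<^bsub>M2\<^esub> \<phi> e = \<phi> e" using M.F_e[OF a(1)] a F_c ec by (simp flip: hom)
    show "f = \<one>\<^bsub>M2\<^esub>" if "\<phi> e \<otimes>\<^bsub>M2\<^esub> f = \<phi> e"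
    proof -
      have "e \<otimes>\<^bsub>M\<^esub> a = e" using that a F_c ec by (simp add: inj flip: hom)
      then show ?thesis using M.F_free[OF a(1)] a one by simp
    qed
    fix g assume "g \<in> \<phi> ` F"
    then obtain b where b: "b \<in> F" "g = \<phi> b" by blast
    show "f \<otimes>\<^bsub>M2\<^esub> g \<in> \<phi> ` F" using M.F_mult[OF a(1) b(1)] a b F_c by (simp flip: hom)
    show "f \<otimes>\<^bsub>M2\<^esub> g = g \<otimes>\<^bsub>M2\<^esub> f" using M.F_comm[OF a(1) b(1)] a b F_c by (simp flip: hom)
  next
    show "\<one>\<^bsub>M2\<^esub> \<in> \<phi> ` F" using M.F_one one by simp
    have "inj_on \<phi> F" using inj F_c by (auto intro!: inj_onI)
    then show "card (\<phi> ` F) = p ^ k" using M.F_card by (simp add: card_image)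
    show "\<phi> ` F \<noteq> {\<one>\<^bsub>M2\<^esub>}"
    proof
      assume "\<phi> ` F = {\<one>\<^bsub>M2\<^esub>}"
      then have "\<phi> x = \<phi> \<one>\<^bsub>M\<^esub>" if "x \<in> F" for x using that one by auto
      then have "F \<subseteq> {\<one>\<^bsub>M\<^esub>}" using F_c inj M.one_closed by blast
      then show False using M.F_one M.F_nontrivial by blast
    qed
  next
    fix a a' b b' assume a: "a \<in> carrier M2" "a' \<in> carrier M2" "a \<otimes>\<^bsub>M2\<^esub> a' = \<one>\<^bsub>M2\<^esub>" "a' \<otimes>\<^bsub>M2\<^esub> a = \<one>\<^bsub>M2\<^esub>" "a \<otimes>\<^bsub>M2\<^esub> \<phi> e = \<phi> e"
      and b: "b \<in> carrier M2" "b' \<in> carrier M2" "b \<otimes>\<^bsub>M2\<^esub> b' = \<one>\<^bsub>M2\<^esub>" "b' \<otimes>\<^bsub>M2\<^esub> b = \<one>\<^bsub>M2\<^esub>" "b \<otimes>\<^bsub>M2\<^esub> \<phi> e = \<phi> e"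
    obtain x x' y y' where x: "x \<in> carrier M" "a = \<phi> x" "x' \<in> carrier M" "a' = \<phi> x'"
      and y: "y \<in> carrier M" "b = \<phi> y" "y' \<in> carrier M" "b' = \<phi> y'"
      using a(1,2) b(1,2) unfolding carr by blast
    have "x' \<otimes>\<^bsub>M\<^esub> y' \<otimes>\<^bsub>M\<^esub> x \<otimes>\<^bsub>M\<^esub> y \<in> F"
      by (rule M.F_commutators) (use a b x y ec in \<open>simp_all add: one inj flip: hom\<close>)
    then show "a' \<otimes>\<^bsub>M2\<^esub> b' \<otimes>\<^bsub>M2\<^esub> a \<otimes>\<^bsub>M2\<^esub> b \<in> \<phi> ` F" using x y by (simp flip: hom)
  next
    fix c c' W
    assume c: "c \<in> carrier M2" "c' \<in> carrier M2" "c \<otimes>\<^bsub>M2\<^esub> c' = \<one>\<^bsub>M2\<^esub>" "c' \<otimes>\<^bsub>M2\<^esub> c = \<one>\<^bsub>M2\<^esub>"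
        "\<phi> e \<otimes>\<^bsub>M2\<^esub> c = \<phi> e" "c \<otimes>\<^bsub>M2\<^esub> \<phi> e = \<phi> e" "c [^]\<^bsub>M2\<^esub> q = \<one>\<^bsub>M2\<^esub>" "c \<noteq> \<one>\<^bsub>M2\<^esub>"
      and W: "W \<subseteq> \<phi> ` F" "\<one>\<^bsub>M2\<^esub> \<in> W" "\<And>f g. f \<in> W \<Longrightarrow> g \<in> W \<Longrightarrow> f \<otimes>\<^bsub>M2\<^esub> g \<in> W"
        "\<And>f. f \<in> W \<Longrightarrow> \<exists>g\<in>W. f \<otimes>\<^bsub>M2\<^esub> g = \<one>\<^bsub>M2\<^esub>" "\<And>f. f \<in> W \<Longrightarrow> c' \<otimes>\<^bsub>M2\<^esub> f \<otimes>\<^bsub>M2\<^esub> c \<in> W"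
    obtain x x' where x: "x \<in> carrier M" "c = \<phi> x" "x' \<in> carrier M" "c' = \<phi> x'"
      using c(1,2) unfolding carr by blast
    define U where "U = {f \<in> F. \<phi> f \<in> W}"
    have WU: "W = \<phi> ` U" using W(1) unfolding U_def by blast
    have "U = {\<one>\<^bsub>M\<^esub>} \<or> U = F"
    proof (rule M.F_irreducible[OF x(1,3)])
      show "x \<otimes>\<^bsub>M\<^esub> x' = \<one>\<^bsub>M\<^esub>" "x' \<otimes>\<^bsub>M\<^esub> x = \<one>\<^bsub>M\<^esub>" "e \<otimes>\<^bsub>M\<^esub> x = e" "x \<otimes>\<^bsub>M\<^esub> e = e"
        "x [^]\<^bsub>M\<^esub> q = \<one>\<^bsub>M\<^esub>" "x \<noteq> \<one>\<^bsub>M\<^esub>"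
        using c x ec by (simp_all add: one inj flip: hom pow)
      show "U \<subseteq> F" by (simp add: U_def)
      show "\<one>\<^bsub>M\<^esub> \<in> U" using W(2) M.F_one by (simp add: U_def one)
    next
      fix f assume f: "f \<in> U"
      then have fF: "f \<in> F" "\<phi> f \<in> W" by (simp_all add: U_def)
      obtain g where g: "g \<in> W" "\<phi> f \<otimes>\<^bsub>M2\<^esub> g = \<one>\<^bsub>M2\<^esub>" using W(4)[OF fF(2)] by blast
      then obtain h where h: "h \<in> U" "g = \<phi> h" using WU by blast
      then have "f \<otimes>\<^bsub>M\<^esub> h = \<one>\<^bsub>M\<^esub>" using g fF F_c by (simp add: U_def one inj flip: hom)
      then show "\<exists>g\<in>U. f \<otimes>\<^bsub>M\<^esub> g = \<one>\<^bsub>M\<^esub>" using h by blast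
      have "\<phi> (x' \<otimes>\<^bsub>M\<^esub> f \<otimes>\<^bsub>M\<^esub> x) \<in> W" using W(5)[OF fF(2)] x fF F_c by (simp add: hom)
      then obtain h where h: "h \<in> F" "\<phi> (x' \<otimes>\<^bsub>M\<^esub> f \<otimes>\<^bsub>M\<^esub> x) = \<phi> h" using W(1) by blast
      then have "x' \<otimes>\<^bsub>M\<^esub> f \<otimes>\<^bsub>M\<^esub> x = h" using x fF F_c inj by simp
      then show "x' \<otimes>\<^bsub>M\<^esub> f \<otimes>\<^bsub>M\<^esub> x \<in> U" using h \<open>\<phi> (x' \<otimes>\<^bsub>M\<^esub> f \<otimes>\<^bsub>M\<^esub> x) \<in> W\<close> by (simp add: U_def)
      fix g assume g: "g \<in> U"
      then have gF: "g \<in> F" "\<phi> g \<in> W" by (simp_all add: U_def)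
      show "f \<otimes>\<^bsub>M\<^esub> g \<in> U" using W(3)[OF fF(2) gF(2)] M.F_mult[OF fF(1) gF(1)] fF gF F_c by (simp add: U_def hom)
    qed
    then show "W = {\<one>\<^bsub>M2\<^esub>} \<or> W = \<phi> ` F" unfolding WU one by blast
  qed
qed

section \<open>The endomorphisms of a Schmidt group\<close>

locale schmidt_split = group G for G (structure) +
  fixes p q v k :: nat and b
  assumes Schmidt: "Schmidt_group G"
    and p: "Factorial_Ring.prime p" and q: "Factorial_Ring.prime q" and pq: "p \<noteq> q" and v: "v \<ge> 1"
    and card_derived: "card (derived G (carrier G)) = p ^ k"
    and b: "b \<in> carrier G" and card_b: "card (generate G {b}) = q ^ v"
    and split: "semidirect_of G (derived G (carrier G)) (generate G {b})"
begin

abbreviation P where "P \<equiv> derived G (carrier G)"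
abbreviation S where "S \<equiv> End_semigroup G"
abbreviation S_mult (infixl "\<cdot>" 70) where "s \<cdot> t \<equiv> s \<otimes>\<^bsub>S\<^esub> t"

sublocale S: monoid S by (rule End_monoid)
sublocale P: normal P G using split by (simp add: semidirect_of_def)

lemma finite_carrier: "finite (carrier G)" and non_nilpotent: "\<not> nilpotent_group G"
  and proper_nilpotent: "\<And>K. subgroup K G \<Longrightarrow> K \<noteq> carrier G \<Longrightarrow> nilpotent_group (G\<lparr>carrier := K\<rparr>)"
  using Schmidt unfolding Schmidt_group_def by auto

lemma ord_b: "ord b = q ^ v"
  using generate_pow_card[OF b] card_b by simp

lemma b_pow: "b [^] (q ^ v) = \<one>"
  using pow_ord_eq_1[OF b] ord_b by simp

lemma coprime_pq: "coprime (p ^ i) (q ^ j)"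
  using primes_coprime[OF p q pq] by simp

lemma P_pow: "x \<in> P \<Longrightarrow> x [^] (p ^ k) = \<one>"
proof -
  assume x: "x \<in> P"
  interpret Q: group "G\<lparr>carrier := P\<rparr>" using P.is_subgroup by (rule subgroup_imp_group)
  show ?thesis using Q.pow_order_eq_1[of x] x card_derived by (simp add: order_def flip: nat_pow_consistent)
qed

lemma P_torsion: "x \<in> P \<Longrightarrow> x [^] (q ^ v) = \<one> \<Longrightarrow> x = \<one>"
  using pow_coprime_eq_one[OF _ P_pow _ coprime_pq] P.subset by blast

lemma decompose: "x \<in> carrier G \<Longrightarrow> \<exists>y\<in>P. \<exists>i::int. x = y \<otimes> b [^] i"
proof -
  assume x: "x \<in> carrier G"
  have "x \<in> P <#> generate G {b}" using x split by (simp add: semidirect_of_def)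
  then show ?thesis unfolding set_mult_def generate_pow[OF b] by blast
qed

lemma b_pow_in_P: "b [^] (i::int) \<in> P \<Longrightarrow> b [^] i = \<one>"
proof -
  assume "b [^] i \<in> P"
  then have "b [^] i \<in> P \<inter> generate G {b}" unfolding generate_pow[OF b] by blast
  then show ?thesis using split unfolding semidirect_of_def by blast
qed

lemma End_eq_on_P_b:
  assumes s: "s \<in> carrier S" "t \<in> carrier S" and P: "\<And>x. x \<in> P \<Longrightarrow> s x = t x" and "s b = t b"
  shows "s = t"
proof (rule End_eqI[OF s])
  interpret s: group_hom G G s by (rule End_group_hom[OF s(1)])
  interpret t: group_hom G G t by (rule End_group_hom[OF s(2)])
  fix x assume "x \<in> carrier G"
  then obtain y i where y: "y \<in> P" "x = y \<otimes> b [^] (i::int)" using decompose by blast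
  have "y \<in> carrier G" using y(1) by (rule P.mem_carrier)
  then show "s x = t x" using y b assms by (simp add: s.hom_int_pow t.hom_int_pow)
qed

lemma exists_End:
  assumes g: "g \<in> carrier G" "g [^] (q ^ v) = \<one>"
  obtains s where "s \<in> carrier S" "s b = g" "\<And>x. x \<in> P \<Longrightarrow> s x = \<one>"
proof -
  have g': "g [^] ord b = \<one>" using g ord_b by simp
  obtain f where f: "f \<in> hom G G" "f b = g" "\<And>x. x \<in> P \<Longrightarrow> f x = \<one>"
    using semidirect_hom[OF split b is_group g(1) g'] by blast
  show thesis
    by (rule that[OF End_restrictI[OF f(1)]]) (use f b P.subset in auto)
qed

lemma P_nontrivial: "P \<noteq> {\<one>}"
proof
  assume P: "P = {\<one>}"
  have "nilpotent_group G"
  proof (rule nilpotent_if_derived_central)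
    fix x y z assume "x \<in> carrier G" "y \<in> carrier G" "z \<in> carrier G"
    moreover from this have "x \<otimes> y \<otimes> inv x \<otimes> inv y = \<one>" using commutator_in_derived P by blast
    ultimately show "z \<otimes> (x \<otimes> y \<otimes> inv x \<otimes> inv y) = x \<otimes> y \<otimes> inv x \<otimes> inv y \<otimes> z" by simp
  qed
  then show False using non_nilpotent by simp
qed

lemma P_proper: "P \<noteq> carrier G"
proof
  assume "P = carrier G"
  then have "b = \<one>" using P_torsion b b_pow by blast
  then have "q ^ v = 1" using ord_b by simp
  then show False using q v by (metis One_nat_def not_prime_1 power_eq_1_iff le_zero_eq nat_power_eq_Suc_0_iff zero_neq_one)
qed

text \<open>
  \<open>P \<langle>b\<^sup>q\<rangle>\<close> is a proper subgroup, so it is nilpotent, and its elements of coprime order commute.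
\<close>

lemma b_power_q_central:
  assumes g: "g \<in> carrier G"
  shows "g \<otimes> b [^] q = b [^] q \<otimes> g"
proof -
  let ?c = "b [^] q"
  have c: "?c \<in> carrier G" using b by simp
  let ?L = "{x \<otimes> ?c [^] (i::int) | x i. x \<in> P}"
  have L: "subgroup ?L G"
    by (rule subgroup_powers_extension[OF P.is_subgroup c]) (use c P.inv_op_closed1 P.inv_op_closed2 in auto)
  have ne: "?L \<noteq> carrier G"
  proof
    assume "?L = carrier G"
    then obtain x and i :: int where x: "x \<in> P" "b = x \<otimes> ?c [^] i" using b by blast
    have ci: "?c [^] i = b [^] (int q * i)" using b by (simp add: int_pow_pow flip: int_pow_int)
    have xG: "x \<in> carrier G" using x(1) by (rule P.mem_carrier)
    have "x \<otimes> ?c [^] i \<otimes> inv (?c [^] i) = x" using xG b by (simp add: m_assoc)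
    then have "b \<otimes> inv (?c [^] i) = x" using x(2) by simp
    then have "b [^] (1 - int q * i) \<in> P" unfolding ci using x b by (simp add: int_pow_diff)
    then have "b [^] (1 - int q * i) = \<one>" by (rule b_pow_in_P)
    then have "int (q ^ v) dvd 1 - int q * i" using int_pow_eq_id[OF b] ord_b by simp
    moreover have "int q dvd int (q ^ v)" using v by (simp add: dvd_power)
    ultimately have "int q dvd 1 - int q * i" by (rule dvd_trans[rotated])
    then have "int q dvd 1" by (simp add: dvd_diff_left_iff)
    then show False using q by simp
  qed
  interpret L: group "G\<lparr>carrier := ?L\<rparr>" using L by (rule subgroup_imp_group)
  have PL: "x \<in> ?L" if "x \<in> P" for x by (rule powers_extension_mem(1)[OF P.is_subgroup c that])
  have cL: "?c \<in> ?L" using powers_extension_mem(2)[OF P.is_subgroup c, of 1] c by simp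
  have cP: "x \<otimes> ?c = ?c \<otimes> x" if x: "x \<in> P" for x
  proof -
    have "x [^]\<^bsub>G\<lparr>carrier := ?L\<rparr>\<^esub> (p ^ k) = \<one>" "?c [^]\<^bsub>G\<lparr>carrier := ?L\<rparr>\<^esub> (q ^ v) = \<one>"
      using P_pow[OF x] b b_pow by (simp_all flip: nat_pow_consistent add: nat_pow_pow mult.commute[of q])
         (simp flip: nat_pow_pow)
    then show ?thesis
      using L.nilpotent_coprime_commute[OF proper_nilpotent[OF L ne] _ _ _ _ coprime_pq] PL[OF x] cL by simp
  qed
  obtain y i where y: "y \<in> P" "g = y \<otimes> b [^] (i::int)" using decompose[OF g] by blast
  have yG: "y \<in> carrier G" using y(1) by (rule P.mem_carrier)
  have "b [^] i \<otimes> ?c = ?c \<otimes> b [^] i"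
    unfolding int_pow_int[symmetric] int_pow_mult[OF b, symmetric] by (simp add: add.commute)
  then have "g \<otimes> ?c = y \<otimes> (?c \<otimes> b [^] i)" unfolding y(2) using yG b by (simp add: m_assoc)
  also have "\<dots> = y \<otimes> ?c \<otimes> b [^] i" using yG b by (simp add: m_assoc)
  also have "\<dots> = ?c \<otimes> g" unfolding cP[OF y(1)] y(2) using yG b by (simp add: m_assoc)
  finally show ?thesis .
qed

text \<open>
  If \<open>P0 \<langle>b\<rangle>\<close> is a proper subgroup, it is nilpotent and \<open>b\<close> commutes with the \<open>p\<close>-elements in it. This
  dichotomy is the irreducibility of \<open>b\<close> on \<open>P\<close> modulo fixed points, and the main consequence of the
  minimality of \<open>G\<close>.
\<close>

lemma invariant_subgroup:
  assumes P0: "subgroup P0 G" "P0 \<subseteq> P" and inv: "\<And>x. x \<in> P0 \<Longrightarrow> inv b \<otimes> x \<otimes> b \<in> P0"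
  shows "P0 = P \<or> (\<forall>x\<in>P0. x \<otimes> b = b \<otimes> x)"
proof -
  interpret P0: subgroup P0 G by fact
  have step: "inv (b [^] n) \<otimes> x \<otimes> b [^] n \<in> P0" if "x \<in> P0" for x and n :: nat
  proof (induction n)
    case 0
    then show ?case using that by simp
  next
    case (Suc n)
    have "inv b \<otimes> (inv (b [^] n) \<otimes> x \<otimes> b [^] n) \<otimes> b \<in> P0" by (rule inv[OF Suc])
    then show ?case using that b P0.mem_carrier[OF that] by (simp add: word_simps)
  qed
  have inv': "b \<otimes> x \<otimes> inv b \<in> P0" if x: "x \<in> P0" for x
  proof -
    have "q ^ v > 0" using q prime_gt_0_nat by simp
    then have "b \<otimes> b [^] (q ^ v - 1) = b [^] (q ^ v)" using b by (metis nat_pow_Suc2 Suc_pred' )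
    then have bb: "b \<otimes> b [^] (q ^ v - 1) = \<one>" using b_pow by simp
    then have "b [^] (q ^ v - 1) = inv b" using b by (metis inv_equality inv_comm nat_pow_closed)
    then show ?thesis using step[OF x, of "q ^ v - 1"] b by simp
  qed
  let ?L = "{x \<otimes> b [^] (i::int) | x i. x \<in> P0}"
  have L: "subgroup ?L G" by (rule subgroup_powers_extension[OF P0(1) b inv' inv])
  show ?thesis
  proof (cases "?L = carrier G")
    case True
    have "P \<subseteq> P0"
    proof
      fix y assume y: "y \<in> P"
      then have "y \<in> ?L" using True P.subset by blast
      then obtain x and i :: int where x: "x \<in> P0" "y = x \<otimes> b [^] i" by blast
      have xG: "x \<in> carrier G" using x(1) by (rule P0.mem_carrier)
      have "inv x \<otimes> y = b [^] i" unfolding x(2) using xG b by (simp add: inv_cancel_left)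
      moreover have "inv x \<otimes> y \<in> P" using x(1) y P0(2) by blast
      ultimately have "b [^] i = \<one>" using b_pow_in_P by simp
      then show "y \<in> P0" using x xG by simp
    qed
    then show ?thesis using P0(2) by blast
  next
    case False
    interpret L: group "G\<lparr>carrier := ?L\<rparr>" using L by (rule subgroup_imp_group)
    have bL: "b \<in> ?L" using powers_extension_mem(2)[OF P0(1) b, of 1] b by simp
    have "x \<otimes> b = b \<otimes> x" if x: "x \<in> P0" for x
    proof -
      have "x \<in> ?L" by (rule powers_extension_mem(1)[OF P0(1) b x])
      moreover have "x [^]\<^bsub>G\<lparr>carrier := ?L\<rparr>\<^esub> (p ^ k) = \<one>" "b [^]\<^bsub>G\<lparr>carrier := ?L\<rparr>\<^esub> (q ^ v) = \<one>"
        using P_pow x P0(2) b_pow by (auto simp flip: nat_pow_consistent)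
      ultimately show ?thesis
        using L.nilpotent_coprime_commute[OF proper_nilpotent[OF L False] _ _ _ _ coprime_pq] bL by simp
    qed
    then show ?thesis by blast
  qed
qed

text \<open>
  A perfect nilpotent group is abelian by \<open>nilpotent_cyclic_mod_derived\<close>, hence trivial.
\<close>

lemma derived_P_proper: "derived G P \<noteq> P"
proof
  assume perfect: "derived G P = P"
  interpret Q: group "G\<lparr>carrier := P\<rparr>" using P.is_subgroup by (rule subgroup_imp_group)
  have nil: "nilpotent_group (G\<lparr>carrier := P\<rparr>)" by (rule proper_nilpotent[OF P.is_subgroup P_proper])
  have comm: "x \<otimes> y = y \<otimes> x" if "x \<in> P" "y \<in> P" for x y
  proof -
    have "derived (G\<lparr>carrier := P\<rparr>) (carrier (G\<lparr>carrier := P\<rparr>)) = P"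
      using derived_consistent[OF _ P.is_subgroup, of P] perfect by simp
    then have "carrier (G\<lparr>carrier := P\<rparr>) \<subseteq> generate (G\<lparr>carrier := P\<rparr>)
        (insert \<one> (derived (G\<lparr>carrier := P\<rparr>) (carrier (G\<lparr>carrier := P\<rparr>))))"
      by (auto intro: generate.incl)
    then show ?thesis using Q.nilpotent_cyclic_mod_derived[OF nil, of \<one> x y] that by simp
  qed
  have "derived G P \<subseteq> {\<one>}"
    unfolding derived_def[of G P]
    by (rule generate_subgroup_incl[OF _ triv_subgroup])
      (auto intro!: commutator_eq_oneI comm P.mem_carrier)
  then show False using perfect P_nontrivial P.one_closed by blast
qed

text \<open>
  The lemma \<open>C_central\<close> below identifies \<open>C\<close> as the intersection of \<open>P\<close> with the centre of \<open>G\<close>.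
\<close>

definition C where "C = {x \<in> P. x \<otimes> b = b \<otimes> x}"

text \<open>
  If \<open>b\<close> centralized \<open>P\<close>, the derived subgroups of \<open>G\<close> and of \<open>P\<close> would coincide.
\<close>

lemma C_proper: "C \<noteq> P"
proof
  assume "C = P"
  then have xb: "x \<otimes> b = b \<otimes> x" if "x \<in> P" for x using that by (auto simp: C_def)
  have xbi: "x \<otimes> b [^] (i::int) = b [^] i \<otimes> x" if x: "x \<in> P" for x i
  proof -
    have xG: "x \<in> carrier G" using x by (rule P.mem_carrier)
    have "generate G {b} \<subseteq> {y \<in> carrier G. x \<otimes> y = y \<otimes> x}"
      by (rule generate_subgroup_incl[OF _ centralizer_subgroup[OF xG]]) (use b xb[OF x] in auto)
    then show ?thesis unfolding generate_pow[OF b] by blast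
  qed
  define D where "D = derived G P"
  have "P \<subseteq> D"
    unfolding derived_def[of G "carrier G"]
  proof (rule generate_subgroup_incl)
    show "subgroup D G" unfolding D_def using derived_is_subgroup[OF P.subset] .
    show "(\<Union>x\<in>carrier G. \<Union>y\<in>carrier G. {x \<otimes> y \<otimes> inv x \<otimes> inv y}) \<subseteq> D"
    proof safe
      fix g h assume g: "g \<in> carrier G" and h: "h \<in> carrier G"
      obtain x y and i j :: int where x: "x \<in> P" "g = x \<otimes> b [^] i" and y: "y \<in> P" "h = y \<otimes> b [^] j"
        using decompose[OF g] decompose[OF h] by blast
      have xG: "x \<in> carrier G" and yG: "y \<in> carrier G" using x y P.mem_carrier by auto
      let ?i = "b [^] i" and ?j = "b [^] j"
      have ij: "?i \<in> carrier G" "?j \<in> carrier G" using b by auto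
      have c: "?i \<otimes> ?j = ?j \<otimes> ?i" unfolding int_pow_mult[OF b, symmetric] by (simp add: add.commute)
      have "g \<otimes> h = x \<otimes> y \<otimes> (?i \<otimes> ?j)"
      proof -
        have "g \<otimes> h = x \<otimes> (?i \<otimes> y) \<otimes> ?j" unfolding x(2) y(2) using xG yG ij by (simp add: m_assoc)
        also have "?i \<otimes> y = y \<otimes> ?i" using xbi[OF y(1)] by simp
        finally show ?thesis using xG yG ij by (simp add: m_assoc)
      qed
      moreover have "h \<otimes> g = y \<otimes> x \<otimes> (?i \<otimes> ?j)"
      proof -
        have "h \<otimes> g = y \<otimes> (?j \<otimes> x) \<otimes> ?i" unfolding x(2) y(2) using xG yG ij by (simp add: m_assoc)
        also have "?j \<otimes> x = x \<otimes> ?j" using xbi[OF x(1)] by simp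
        finally show ?thesis unfolding c using xG yG ij by (simp add: m_assoc)
      qed
      moreover have "g \<otimes> h \<otimes> inv g \<otimes> inv h = (g \<otimes> h) \<otimes> inv (h \<otimes> g)" using g h by (simp add: word_simps)
      ultimately have "g \<otimes> h \<otimes> inv g \<otimes> inv h = x \<otimes> y \<otimes> inv x \<otimes> inv y"
        using xG yG ij by (simp add: word_simps)
      then show "g \<otimes> h \<otimes> inv g \<otimes> inv h \<in> D"
        unfolding D_def derived_def[of G P] using x(1) y(1) by (auto intro!: generate.incl)
    qed
  qed
  moreover have "D \<subseteq> P" unfolding D_def using derived_incl[OF order_refl P.is_subgroup] .
  ultimately show False using derived_P_proper D_def by blast
qed

text \<open>
  Such a commutator has order dividing that of \<open>b\<close>, but it lies in the \<open>p\<close>-group \<open>P\<close>.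
\<close>

lemma commutator_with_b_trivial:
  assumes x: "x \<in> P" and c: "(b \<otimes> x \<otimes> inv b \<otimes> inv x) \<otimes> b = b \<otimes> (b \<otimes> x \<otimes> inv b \<otimes> inv x)"
  shows "x \<otimes> b = b \<otimes> x"
proof -
  let ?c = "b \<otimes> x \<otimes> inv b \<otimes> inv x"
  have xG: "x \<in> carrier G" using x by (rule P.mem_carrier)
  have "?c [^] (q ^ v) = \<one>" by (rule commutator_pow_eq_one[OF b xG refl c b_pow])
  moreover have "?c \<in> P" using x b xG commutator_in_derived by blast
  ultimately have "?c = \<one>" using P_torsion by blast
  then show ?thesis using commutator_eq_one_iff[OF b xG] by simp
qed

lemma derived_P_subset_C: "derived G P \<subseteq> C"
proof -
  have sub: "derived G P \<subseteq> P" using derived_incl[OF order_refl P.is_subgroup] .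
  have dsub: "subgroup (derived G P) G" using derived_is_subgroup[OF P.subset] .
  have "derived G P \<subseteq> {x \<in> carrier G. inv b \<otimes> x \<otimes> b \<in> derived G P}"
    unfolding derived_def[of G P]
  proof (rule generate_subgroup_incl)
    show "subgroup {x \<in> carrier G. inv b \<otimes> x \<otimes> b \<in> generate G (\<Union>h1\<in>P. \<Union>h2\<in>P. {h1 \<otimes> h2 \<otimes> inv h1 \<otimes> inv h2})} G"
      unfolding derived_def[of G P, symmetric]
    proof (intro subgroupI)
      interpret D: subgroup "derived G P" G by (rule dsub)
      show "{x \<in> carrier G. inv b \<otimes> x \<otimes> b \<in> derived G P} \<noteq> {}"
        using b by (auto intro!: exI[of _ \<one>])
      fix x assume x: "x \<in> {x \<in> carrier G. inv b \<otimes> x \<otimes> b \<in> derived G P}"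
      have "inv (inv b \<otimes> x \<otimes> b) \<in> derived G P" using x by blast
      then show "inv x \<in> {x \<in> carrier G. inv b \<otimes> x \<otimes> b \<in> derived G P}" using x b by (simp add: word_simps)
      fix y assume y: "y \<in> {x \<in> carrier G. inv b \<otimes> x \<otimes> b \<in> derived G P}"
      have "(inv b \<otimes> x \<otimes> b) \<otimes> (inv b \<otimes> y \<otimes> b) \<in> derived G P" using x y by blast
      then show "x \<otimes> y \<in> {x \<in> carrier G. inv b \<otimes> x \<otimes> b \<in> derived G P}" using x y b by (simp add: word_simps)
    qed auto
    show "(\<Union>h1\<in>P. \<Union>h2\<in>P. {h1 \<otimes> h2 \<otimes> inv h1 \<otimes> inv h2})
      \<subseteq> {x \<in> carrier G. inv b \<otimes> x \<otimes> b \<in> generate G (\<Union>h1\<in>P. \<Union>h2\<in>P. {h1 \<otimes> h2 \<otimes> inv h1 \<otimes> inv h2})}"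
    proof safe
      fix x y assume xy: "x \<in> P" "y \<in> P"
      have G: "x \<in> carrier G" "y \<in> carrier G" using xy P.mem_carrier by auto
      then show "x \<otimes> y \<otimes> inv x \<otimes> inv y \<in> carrier G" by simp
      have "inv b \<otimes> (x \<otimes> y \<otimes> inv x \<otimes> inv y) \<otimes> b = (inv b \<otimes> x \<otimes> b) \<otimes> (inv b \<otimes> y \<otimes> b) \<otimes> inv (inv b \<otimes> x \<otimes> b) \<otimes> inv (inv b \<otimes> y \<otimes> b)"
        using G b by (simp add: word_simps)
      moreover have "inv b \<otimes> x \<otimes> b \<in> P" "inv b \<otimes> y \<otimes> b \<in> P" using P.inv_op_closed1[OF b] xy by auto
      ultimately show "inv b \<otimes> (x \<otimes> y \<otimes> inv x \<otimes> inv y) \<otimes> b \<in> generate G (\<Union>h1\<in>P. \<Union>h2\<in>P. {h1 \<otimes> h2 \<otimes> inv h1 \<otimes> inv h2})"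
        by (intro generate.incl) blast
    qed
  qed
  then have "derived G P = P \<or> (\<forall>x\<in>derived G P. x \<otimes> b = b \<otimes> x)"
    by (intro invariant_subgroup[OF dsub sub]) blast
  then show ?thesis using derived_P_proper sub by (auto simp: C_def)
qed

text \<open>
  The subgroup \<open>[b, P]\<close> is invariant under \<open>b\<close>. If \<open>b\<close> centralized it, it would centralize \<open>P\<close> by
  \<open>commutator_with_b_trivial\<close>.
\<close>

lemma P_generated_by_commutators: "generate G {b \<otimes> x \<otimes> inv b \<otimes> inv x | x. x \<in> P} = P"
proof -
  let ?T = "{b \<otimes> x \<otimes> inv b \<otimes> inv x | x. x \<in> P}"
  have TG: "?T \<subseteq> carrier G" using b P.mem_carrier by auto
  have TP: "?T \<subseteq> P" using b P.mem_carrier commutator_in_derived by auto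
  have sub: "generate G ?T \<subseteq> P" by (rule generate_subgroup_incl[OF TP P.is_subgroup])
  have gs: "subgroup (generate G ?T) G" by (rule generate_is_subgroup[OF TG])
  have "inv b \<otimes> y \<otimes> b \<in> generate G ?T" if "y \<in> generate G ?T" for y
    using that
  proof (induction rule: generate.induct)
    case one
    then show ?case using b generate.one by simp
  next
    case (incl h)
    then obtain x where x: "x \<in> P" "h = b \<otimes> x \<otimes> inv b \<otimes> inv x" by blast
    have xG: "x \<in> carrier G" using x(1) by (rule P.mem_carrier)
    have "inv b \<otimes> h \<otimes> b = b \<otimes> (inv b \<otimes> x \<otimes> b) \<otimes> inv b \<otimes> inv (inv b \<otimes> x \<otimes> b)"
      unfolding x(2) using xG b by (simp add: word_simps)
    moreover have "inv b \<otimes> x \<otimes> b \<in> P" using P.inv_op_closed1[OF b x(1)] .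
    ultimately show ?case by (intro generate.incl) blast
  next
    case (inv h)
    then obtain x where x: "x \<in> P" "h = b \<otimes> x \<otimes> inv b \<otimes> inv x" by blast
    have xG: "x \<in> carrier G" using x(1) by (rule P.mem_carrier)
    have "inv b \<otimes> inv h \<otimes> b = inv (b \<otimes> (inv b \<otimes> x \<otimes> b) \<otimes> inv b \<otimes> inv (inv b \<otimes> x \<otimes> b))"
      unfolding x(2) using xG b by (simp add: word_simps)
    moreover have "inv b \<otimes> x \<otimes> b \<in> P" using P.inv_op_closed1[OF b x(1)] .
    ultimately show ?case by (auto intro!: generate.inv)
  next
    case (eng h1 h2)
    have "h1 \<in> carrier G" "h2 \<in> carrier G" using eng.hyps generate_in_carrier[OF TG] by auto
    then have "inv b \<otimes> (h1 \<otimes> h2) \<otimes> b = (inv b \<otimes> h1 \<otimes> b) \<otimes> (inv b \<otimes> h2 \<otimes> b)" using b by (simp add: word_simps)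
    then show ?case using generate.eng[OF eng.IH] by simp
  qed
  then have or: "generate G ?T = P \<or> (\<forall>x\<in>generate G ?T. x \<otimes> b = b \<otimes> x)"
    by (rule invariant_subgroup[OF gs sub])
  then show ?thesis
  proof
    assume c: "\<forall>x\<in>generate G ?T. x \<otimes> b = b \<otimes> x"
    have "x \<in> C" if x: "x \<in> P" for x
    proof -
      have "b \<otimes> x \<otimes> inv b \<otimes> inv x \<in> generate G ?T" using x by (intro generate.incl) blast
      then have "x \<otimes> b = b \<otimes> x" using commutator_with_b_trivial[OF x] c by blast
      then show ?thesis using x by (simp add: C_def)
    qed
    then have "C = P" by (auto simp: C_def)
    then show ?thesis using C_proper by simp
  qed
qed

text \<open>
  For \<open>c\<close> in \<open>C\<close> and \<open>x\<close> in \<open>P\<close>, the commutator of \<open>x\<^sup>-\<^sup>1\<close> and \<open>c\<close> lies in \<open>P'\<close> and thus commutes with \<open>b\<close>.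
  Rewritten, \<open>c\<close> commutes with \<open>x b x\<^sup>-\<^sup>1\<close>, hence with \<open>[b, x]\<close>; these elements generate \<open>P\<close>.
\<close>

lemma C_central:
  assumes c: "c \<in> C" and g: "g \<in> carrier G"
  shows "c \<otimes> g = g \<otimes> c"
proof -
  have cP: "c \<in> P" and cb: "c \<otimes> b = b \<otimes> c" using c by (auto simp: C_def)
  have cG: "c \<in> carrier G" using cP by (rule P.mem_carrier)
  let ?Z = "{y \<in> carrier G. c \<otimes> y = y \<otimes> c}"
  have Z: "subgroup ?Z G" by (rule centralizer_subgroup[OF cG])
  have "b \<otimes> x \<otimes> inv b \<otimes> inv x \<in> ?Z" if x: "x \<in> P" for x
  proof -
    have xG: "x \<in> carrier G" using x by (rule P.mem_carrier)
    let ?y = "inv x"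
    have "?y \<otimes> c \<otimes> inv ?y \<otimes> inv c \<in> derived G P"
      unfolding derived_def[of G P] using P.m_inv_closed[OF x] cP by (intro generate.incl) blast
    then have "(?y \<otimes> c \<otimes> inv ?y \<otimes> inv c) \<otimes> b = b \<otimes> (?y \<otimes> c \<otimes> inv ?y \<otimes> inv c)"
      using derived_P_subset_C by (auto simp: C_def)
    then have "?y \<otimes> c \<otimes> x \<otimes> (inv c \<otimes> b) = b \<otimes> (?y \<otimes> c \<otimes> x \<otimes> inv c)" using xG cG b by (simp add: m_assoc)
    also have "inv c \<otimes> b = b \<otimes> inv c"
    proof -
      have "inv c \<otimes> (c \<otimes> b) \<otimes> inv c = inv c \<otimes> (b \<otimes> c) \<otimes> inv c" using cb by simp
      then show ?thesis using cG b by (simp add: m_assoc inv_cancel_left)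
    qed
    finally have "?y \<otimes> c \<otimes> x \<otimes> b \<otimes> inv c = b \<otimes> ?y \<otimes> c \<otimes> x \<otimes> inv c" using xG cG b by (simp add: m_assoc)
    then have "?y \<otimes> c \<otimes> x \<otimes> b = b \<otimes> ?y \<otimes> c \<otimes> x" using xG cG b by simp
    then have "x \<otimes> (?y \<otimes> c \<otimes> x \<otimes> b) \<otimes> inv x = x \<otimes> (b \<otimes> ?y \<otimes> c \<otimes> x) \<otimes> inv x" by simp
    then have "c \<otimes> (x \<otimes> b \<otimes> inv x) = (x \<otimes> b \<otimes> inv x) \<otimes> c" using xG cG b by (simp add: word_simps)
    then have "x \<otimes> b \<otimes> inv x \<in> ?Z" "b \<in> ?Z" using cb b xG by auto
    then have "b \<otimes> inv (x \<otimes> b \<otimes> inv x) \<in> ?Z"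
      using subgroup.m_closed[OF Z _ subgroup.m_inv_closed[OF Z]] by blast
    moreover have "b \<otimes> inv (x \<otimes> b \<otimes> inv x) = b \<otimes> x \<otimes> inv b \<otimes> inv x" using xG b by (simp add: word_simps)
    ultimately show ?thesis by simp
  qed
  then have "generate G {b \<otimes> x \<otimes> inv b \<otimes> inv x | x. x \<in> P} \<subseteq> ?Z"
    by (intro generate_subgroup_incl[OF _ Z]) auto
  then have "P \<subseteq> ?Z" using P_generated_by_commutators by (rule subst[rotated])
  moreover have "b \<in> ?Z" using cb b by simp
  ultimately have "y \<otimes> b [^] (i::int) \<in> ?Z" if "y \<in> P" for y i
    using subgroup_int_pow_closed[OF Z] that by (intro subgroup.m_closed[OF Z]) auto
  then have "g \<in> ?Z" using decompose[OF g] by blast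
  then show ?thesis by simp
qed

lemma central_in_P: "x \<in> P \<Longrightarrow> (\<And>g. g \<in> carrier G \<Longrightarrow> x \<otimes> g = g \<otimes> x) \<Longrightarrow> x \<in> C"
  using b by (simp add: C_def)

definition e where "e = (SOME s. s \<in> carrier S \<and> s b = b \<and> (\<forall>x\<in>P. s x = \<one>))"

lemma e: "e \<in> carrier S" and e_b: "e b = b" and e_P: "x \<in> P \<Longrightarrow> e x = \<one>"
proof -
  have "\<exists>s. s \<in> carrier S \<and> s b = b \<and> (\<forall>x\<in>P. s x = \<one>)"
    using exists_End[OF b b_pow] by metis
  from someI_ex[OF this] show "e \<in> carrier S" "e b = b" "x \<in> P \<Longrightarrow> e x = \<one>" by (auto simp: e_def)
qed

sublocale e: group_hom G G e by (rule End_group_hom[OF e])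

lemma e_b_int: "e (b [^] (i::int)) = b [^] i"
  using b by (simp add: e.hom_int_pow e_b)

lemma e_decomposed: "y \<in> P \<Longrightarrow> e (y \<otimes> b [^] (i::int)) = b [^] i"
  using b P.mem_carrier by (simp add: e_P e_b_int)

lemma e_kernel: "x \<in> carrier G \<Longrightarrow> e x = \<one> \<Longrightarrow> x \<in> P"
  using decompose[of x] e_decomposed P.mem_carrier by auto

lemma End_P: "s \<in> carrier S \<Longrightarrow> x \<in> P \<Longrightarrow> s x \<in> P"
proof -
  assume s: "s \<in> carrier S" and x: "x \<in> P"
  interpret s: group_hom G G s by (rule End_group_hom[OF s])
  have "derived G (s ` carrier G) \<subseteq> P" by (rule mono_derived) auto
  then show "s x \<in> P" using s.derived_img[of "carrier G"] x by auto
qed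

lemma factors_iff: "s \<in> carrier S \<Longrightarrow> e \<cdot> s = s \<longleftrightarrow> (\<forall>x\<in>P. s x = \<one>)"
proof -
  assume s: "s \<in> carrier S"
  interpret s: group_hom G G s by (rule End_group_hom[OF s])
  show ?thesis
  proof
    assume a: "e \<cdot> s = s"
    show "\<forall>x\<in>P. s x = \<one>"
    proof
      fix x assume "x \<in> P"
      then show "s x = \<one>" using End_mult_apply[of x G e s] P.mem_carrier a e_P by simp
    qed
  next
    assume "\<forall>x\<in>P. s x = \<one>"
    then show "e \<cdot> s = s"
      by (intro End_eq_on_P_b End_mult_closed e s) (use P.mem_carrier b in \<open>auto simp: End_mult_apply e_P e_b\<close>)
  qed
qed

text \<open>
  The image is nilpotent and cyclic modulo its derived subgroup, so it is abelian.
\<close>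

lemma nonsurjective_kills_P:
  assumes s: "s \<in> carrier S" and "s ` carrier G \<noteq> carrier G" and x: "x \<in> P"
  shows "s x = \<one>"
proof -
  interpret s: group_hom G G s by (rule End_group_hom[OF s])
  let ?L = "s ` carrier G"
  have L: "subgroup ?L G" by (rule s.img_is_subgroup)
  interpret L: group "G\<lparr>carrier := ?L\<rparr>" using L by (rule subgroup_imp_group)
  have nil: "nilpotent_group (G\<lparr>carrier := ?L\<rparr>)" by (rule proper_nilpotent[OF L assms(2)])
  have D: "derived (G\<lparr>carrier := ?L\<rparr>) (carrier (G\<lparr>carrier := ?L\<rparr>)) = s ` P"
    using derived_consistent[OF order_refl L] s.derived_img[of "carrier G"] by simp
  have sb: "s b \<in> ?L" using b by blast
  have gen: "carrier (G\<lparr>carrier := ?L\<rparr>) \<subseteq> generate (G\<lparr>carrier := ?L\<rparr>)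
      (insert (s b) (derived (G\<lparr>carrier := ?L\<rparr>) (carrier (G\<lparr>carrier := ?L\<rparr>))))" (is "_ \<subseteq> ?R")
  proof
    fix l assume "l \<in> carrier (G\<lparr>carrier := ?L\<rparr>)"
    then obtain g where g: "g \<in> carrier G" "l = s g" by auto
    obtain y i where y: "y \<in> P" "g = y \<otimes> b [^] (i::int)" using decompose[OF g(1)] by blast
    have l: "l = s y \<otimes> s b [^] i" unfolding g(2) y(2) using y(1) P.mem_carrier b by (simp add: s.hom_int_pow)
    have sub: "insert (s b) (derived (G\<lparr>carrier := ?L\<rparr>) (carrier (G\<lparr>carrier := ?L\<rparr>))) \<subseteq> carrier (G\<lparr>carrier := ?L\<rparr>)"
      unfolding D using sb P.subset by auto
    have R: "subgroup ?R (G\<lparr>carrier := ?L\<rparr>)" by (rule L.generate_is_subgroup[OF sub])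
    have "s y \<in> ?R" unfolding D using y(1) by (intro generate.incl) blast
    moreover have "s b \<in> ?R" by (intro generate.incl) blast
    then have "s b [^]\<^bsub>G\<lparr>carrier := ?L\<rparr>\<^esub> i \<in> ?R" by (rule L.subgroup_int_pow_closed[OF R])
    then have "s b [^] i \<in> ?R" using int_pow_consistent[OF L sb] by simp
    ultimately show "l \<in> ?R" unfolding l using subgroup.m_closed[OF R, of "s y" "s b [^] i"] by simp
  qed
  have comm: "s g \<otimes> s h = s h \<otimes> s g" if "g \<in> carrier G" "h \<in> carrier G" for g h
    using L.nilpotent_cyclic_mod_derived[OF nil _ gen, of "s g" "s h"] sb that by simp
  have "P \<subseteq> kernel G G s"
    unfolding derived_def
    by (rule generate_subgroup_incl[OF _ s.subgroup_kernel])
       (auto simp: kernel_def intro!: commutator_eq_oneI comm)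
  then show ?thesis using x by (auto simp: kernel_def)
qed

lemma unit_or_kills_P: "s \<in> carrier S \<Longrightarrow> s \<in> Units S \<or> (\<forall>x\<in>P. s x = \<one>)"
proof (cases "s ` carrier G = carrier G")
  case True
  assume s: "s \<in> carrier S"
  have "inj_on s (carrier G)" by (rule eq_card_imp_inj_on[OF finite_carrier]) (simp add: True)
  then show ?thesis using End_Units[OF s] True by (simp add: bij_betw_def)
qed (use nonsurjective_kills_P in blast)

text \<open>
  An element \<open>s\<close> of the corner is given by an exponent \<open>i\<close> with \<open>s b = b\<^sup>i\<close>, determined modulo \<open>q\<^sup>v\<close>, and
  products of endomorphisms become products of exponents.
\<close>

lemma corner_iff: "s \<in> corner S e \<longleftrightarrow> s \<in> carrier S \<and> (\<forall>x\<in>P. s x = \<one>) \<and> s b \<in> generate G {b}"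
proof (cases "s \<in> carrier S \<and> (\<forall>x\<in>P. s x = \<one>)")
  case True
  then have s: "s \<in> carrier S" and sP: "\<And>x. x \<in> P \<Longrightarrow> s x = \<one>" by auto
  have sb: "s b \<in> carrier G" by (rule End_apply_closed[OF s b])
  have "s \<cdot> e = s \<longleftrightarrow> e (s b) = s b"
  proof
    assume "s \<cdot> e = s"
    then show "e (s b) = s b" using End_mult_apply[OF b, of s e] by simp
  next
    assume "e (s b) = s b"
    then show "s \<cdot> e = s"
      by (intro End_eq_on_P_b End_mult_closed e s) (use P.mem_carrier b in \<open>auto simp: End_mult_apply sP\<close>)
  qed
  moreover have "e (s b) = s b \<longleftrightarrow> s b \<in> generate G {b}"
  proof
    assume a: "e (s b) = s b"
    obtain y i where y: "y \<in> P" "s b = y \<otimes> b [^] (i::int)" using decompose[OF sb] by blast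
    then have "s b = b [^] i" using a e_decomposed[OF y(1), of i] by simp
    then show "s b \<in> generate G {b}" unfolding generate_pow[OF b] by blast
  next
    assume "s b \<in> generate G {b}"
    then show "e (s b) = s b" unfolding generate_pow[OF b] using e_b_int by auto
  qed
  ultimately show ?thesis using s sP factors_iff[OF s] by (auto simp: corner_def)
qed (use factors_iff in \<open>auto simp: corner_def\<close>)

lemma exists_corner: "\<exists>s\<in>corner S e. s b = b [^] (i::int)"
proof -
  have "(b [^] i) [^] (q ^ v) = (b [^] (q ^ v)) [^] i"
    using b by (simp add: int_pow_pow mult.commute flip: int_pow_int)
  then have "(b [^] i) [^] (q ^ v) = \<one>" using b_pow by simp
  then obtain s where s: "s \<in> carrier S" "s b = b [^] i" "\<And>x. x \<in> P \<Longrightarrow> s x = \<one>"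
    using exists_End[of "b [^] i"] b by auto
  moreover have "b [^] i \<in> generate G {b}" unfolding generate_pow[OF b] by blast
  ultimately show ?thesis using corner_iff by metis
qed

lemma corner_b: "s \<in> corner S e \<Longrightarrow> \<exists>i::int. s b = b [^] i"
  unfolding corner_iff generate_pow[OF b] by blast

lemma corner_eqI: "s \<in> corner S e \<Longrightarrow> t \<in> corner S e \<Longrightarrow> s b = t b \<Longrightarrow> s = t"
  by (rule End_eq_on_P_b) (auto simp: corner_iff)

lemma corner_mult:
  assumes s: "s \<in> corner S e" "s b = b [^] (i::int)" and t: "t \<in> corner S e" "t b = b [^] (j::int)"
  shows "s \<cdot> t \<in> corner S e" "(s \<cdot> t) b = b [^] (i * j)"
proof -
  have sS: "s \<in> carrier S" "t \<in> carrier S" using s t by (auto simp: corner_def)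
  interpret t: group_hom G G t by (rule End_group_hom[OF sS(2)])
  show "s \<cdot> t \<in> corner S e" using s t e sS S.m_assoc[of e s t] S.m_assoc[of s t e] by (auto simp: corner_def)
  show "(s \<cdot> t) b = b [^] (i * j)"
    using s t b by (simp add: End_mult_apply t.hom_int_pow int_pow_pow mult.commute)
qed

lemma corner_comm: "s \<in> corner S e \<Longrightarrow> t \<in> corner S e \<Longrightarrow> s \<cdot> t = t \<cdot> s"
proof -
  assume st: "s \<in> corner S e" "t \<in> corner S e"
  obtain i j where i: "s b = b [^] (i::int)" and j: "t b = b [^] (j::int)" using corner_b st by metis
  show ?thesis using corner_mult[OF st(1) i st(2) j] corner_mult[OF st(2) j st(1) i]
    by (intro corner_eqI) (auto simp: mult.commute)
qed

text \<open>
  The greatest common divisors with \<open>q\<^sup>v\<close> are powers of \<open>q\<close> and hence comparable.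
\<close>

lemma divisibility_chain_prime_power: "\<exists>t. [i = j * t] (mod int (q ^ v)) \<or> [j = i * t] (mod int (q ^ v))"
proof -
  have pq: "normalization_semidom_class.prime (int q)" using q by simp
  obtain a c where a: "gcd i (int (q ^ v)) = int q ^ a" and c: "gcd j (int (q ^ v)) = int q ^ c"
    using divides_primepow[OF pq, of _ v] gcd_dvd2 by (metis normalize_gcd normalize_power of_nat_power)
  have key: "\<exists>t. [j = i * t] (mod int (q ^ v))" if "gcd i (int (q ^ v)) dvd gcd j (int (q ^ v))" for i j
  proof -
    have "gcd i (int (q ^ v)) dvd j" using that by (rule dvd_trans) simp
    then obtain m where m: "j = gcd i (int (q ^ v)) * m" by blast
    obtain x where "[i * x = gcd i (int (q ^ v))] (mod int (q ^ v))" using cong_solve_int by blast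
    then have "[i * x * m = gcd i (int (q ^ v)) * m] (mod int (q ^ v))" by (rule cong_scalar_right)
    then show ?thesis using m by (metis cong_sym mult.assoc)
  qed
  show ?thesis
  proof (cases "a \<le> c")
    case True
    then have "gcd i (int (q ^ v)) dvd gcd j (int (q ^ v))" unfolding a c by (rule le_imp_power_dvd)
    then show ?thesis using key by blast
  next
    case False
    then have "gcd j (int (q ^ v)) dvd gcd i (int (q ^ v))" unfolding a c by (intro le_imp_power_dvd) simp
    then show ?thesis using key by blast
  qed
qed

lemma b_int_pow_cong: "b [^] (i::int) = b [^] j \<longleftrightarrow> [i = j] (mod int (q ^ v))"
  using int_pow_eq[OF b, of i j] ord_b by (simp add: cong_iff_dvd_diff dvd_diff_commute)

lemma corner_chain:
  assumes st: "s \<in> corner S e" "t \<in> corner S e"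
  shows "\<exists>u\<in>corner S e. s = t \<cdot> u \<or> t = s \<cdot> u"
proof -
  obtain i j where i: "s b = b [^] (i::int)" and j: "t b = b [^] (j::int)" using corner_b st by metis
  obtain m where m: "[i = j * m] (mod int (q ^ v)) \<or> [j = i * m] (mod int (q ^ v))"
    using divisibility_chain_prime_power by blast
  obtain u where u: "u \<in> corner S e" "u b = b [^] m" using exists_corner by blast
  from m show ?thesis
  proof
    assume "[i = j * m] (mod int (q ^ v))"
    then have "s = t \<cdot> u"
      using corner_mult[OF st(2) j u] st(1) i b_int_pow_cong by (intro corner_eqI) auto
    then show ?thesis using u by blast
  next
    assume "[j = i * m] (mod int (q ^ v))"
    then have "t = s \<cdot> u"
      using corner_mult[OF st(1) i u] st(2) j b_int_pow_cong by (intro corner_eqI) auto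
    then show ?thesis using u by blast
  qed
qed

lemma corner_card: "card (corner S e) = q ^ v"
proof -
  have "bij_betw (\<lambda>s. s b) (corner S e) (generate G {b})"
  proof (rule bij_betw_imageI)
    show "inj_on (\<lambda>s. s b) (corner S e)" by (intro inj_onI corner_eqI)
    show "(\<lambda>s. s b) ` corner S e = generate G {b}"
    proof
      show "(\<lambda>s. s b) ` corner S e \<subseteq> generate G {b}" by (auto simp: corner_iff)
      show "generate G {b} \<subseteq> (\<lambda>s. s b) ` corner S e"
      proof
        fix y assume "y \<in> generate G {b}"
        then obtain i where i: "y = b [^] (i::int)" unfolding generate_pow[OF b] by blast
        obtain s where "s \<in> corner S e" "s b = b [^] i" using exists_corner by blast
        then show "y \<in> (\<lambda>s. s b) ` corner S e" using i by (intro image_eqI[of _ _ s]) auto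
      qed
    qed
  qed
  then show ?thesis using card_b by (simp add: bij_betw_same_card)
qed

text \<open>
  The element \<open>s b\<close> lies in \<open>P\<close>, the kernel of \<open>e\<close>, and its order divides \<open>q\<^sup>v\<close>.
\<close>

lemma factor_zero:
  assumes s: "s \<in> carrier S" "e \<cdot> s = s" and se: "\<And>x. x \<in> carrier G \<Longrightarrow> e (s x) = \<one>" and x: "x \<in> carrier G"
  shows "s x = \<one>"
proof -
  interpret s: group_hom G G s by (rule End_group_hom[OF s(1)])
  have sP: "s y = \<one>" if "y \<in> P" for y using factors_iff[OF s(1)] s(2) that by blast
  have "s b \<in> P" using e_kernel se b by simp
  moreover have "s b [^] (q ^ v) = \<one>" using b b_pow by (simp flip: s.hom_nat_pow)
  ultimately have sb: "s b = \<one>" by (rule P_torsion)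
  obtain y i where "y \<in> P" "x = y \<otimes> b [^] (i::int)" using decompose[OF x] by blast
  then show ?thesis using sb sP b P.mem_carrier by (simp add: s.hom_int_pow)
qed

definition F where "F = inner ` P"

lemma inner_eq_one_iff_C: "x \<in> P \<Longrightarrow> inner x = \<one>\<^bsub>S\<^esub> \<longleftrightarrow> x \<in> C"
proof -
  assume x: "x \<in> P"
  have "(\<forall>g\<in>carrier G. x \<otimes> g = g \<otimes> x) \<longleftrightarrow> x \<in> C"
  proof
    assume "\<forall>g\<in>carrier G. x \<otimes> g = g \<otimes> x"
    then show "x \<in> C" by (intro central_in_P[OF x]) (rule bspec)
  qed (rule ballI, rule C_central)
  then show ?thesis unfolding inner_eq_one_iff[OF P.mem_carrier[OF x]] .
qed

text \<open>
  As a group, \<open>F\<close> is isomorphic to the quotient of \<open>P\<close> by \<open>C\<close>. Working with inner automorphisms in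
  place of cosets keeps the action of automorphisms inside the monoid, as \<open>conjugation_hom\<close> shows.
\<close>

definition V where "V = S\<lparr>carrier := F\<rparr>"

lemma V_simps: "carrier V = F" "x \<otimes>\<^bsub>V\<^esub> y = x \<cdot> y" "\<one>\<^bsub>V\<^esub> = \<one>\<^bsub>S\<^esub>"
  by (simp_all add: V_def)

lemma F_S: "f \<in> F \<Longrightarrow> f \<in> carrier S"
  using inner_End P.mem_carrier by (auto simp: F_def)

lemma F_one: "\<one>\<^bsub>S\<^esub> \<in> F"
  unfolding F_def inner_one[symmetric] using P.one_closed by (rule imageI)

lemma F_mult: "f \<in> F \<Longrightarrow> g \<in> F \<Longrightarrow> f \<cdot> g \<in> F"
proof -
  assume "f \<in> F" "g \<in> F"
  then obtain x y where x: "x \<in> P" "f = inner x" and y: "y \<in> P" "g = inner y" unfolding F_def by blast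
  have "f \<cdot> g = inner (x \<otimes> y)" unfolding x(2) y(2) by (rule inner_mult[OF P.mem_carrier[OF x(1)] P.mem_carrier[OF y(1)]])
  then show ?thesis unfolding F_def using P.m_closed[OF x(1) y(1)] by (rule image_eqI)
qed

lemma F_inv: "f \<in> F \<Longrightarrow> \<exists>g\<in>F. f \<cdot> g = \<one>\<^bsub>S\<^esub>"
proof -
  assume "f \<in> F"
  then obtain x where x: "x \<in> P" "f = inner x" unfolding F_def by (rule imageE)
  have "f \<cdot> inner (inv x) = \<one>\<^bsub>S\<^esub>" unfolding x(2) by (rule inner_r_inv[OF P.mem_carrier[OF x(1)]])
  moreover have "inner (inv x) \<in> F" unfolding F_def using P.m_inv_closed[OF x(1)] by (rule imageI)
  ultimately show ?thesis by (rule bexI)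
qed

lemma F_comm: "f \<in> F \<Longrightarrow> g \<in> F \<Longrightarrow> f \<cdot> g = g \<cdot> f"
proof -
  assume "f \<in> F" "g \<in> F"
  then obtain x y where xy: "x \<in> P" "f = inner x" "y \<in> P" "g = inner y" by (auto simp: F_def)
  then have G: "x \<in> carrier G" "y \<in> carrier G" using P.mem_carrier by auto
  have "x \<otimes> y \<otimes> inv x \<otimes> inv y \<in> derived G P"
    unfolding derived_def[of G P] using xy by (intro generate.incl) blast
  then have "x \<otimes> y \<otimes> inv x \<otimes> inv y \<in> C" using derived_P_subset_C by blast
  moreover have "x \<otimes> y \<otimes> inv (y \<otimes> x) = x \<otimes> y \<otimes> inv x \<otimes> inv y" using G by (simp add: word_simps)
  ultimately have "inner (x \<otimes> y) = inner (y \<otimes> x)" using inner_eq_iff[of "x \<otimes> y" "y \<otimes> x"] G C_central by simp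
  then show ?thesis using xy G by (simp add: inner_mult)
qed

sublocale V: comm_group V
proof (rule comm_groupI)
  show "\<exists>y\<in>carrier V. y \<otimes>\<^bsub>V\<^esub> x = \<one>\<^bsub>V\<^esub>" if "x \<in> carrier V" for x
    using F_inv[of x] F_comm that by (metis V_simps)
  show "x \<otimes>\<^bsub>V\<^esub> y = y \<otimes>\<^bsub>V\<^esub> x" if "x \<in> carrier V" "y \<in> carrier V" for x y
    using that unfolding V_simps by (rule F_comm)
qed (auto simp: V_simps F_mult F_one F_S S.m_assoc)

lemma finite_V: "finite (carrier V)"
  using finite_subset[OF P.subset finite_carrier] by (simp add: V_simps F_def)

lemma inner_pow: "x \<in> P \<Longrightarrow> inner x [^]\<^bsub>V\<^esub> (n::nat) = inner (x [^] n)"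
proof (induction n)
  case (Suc n)
  then show ?case using P.mem_carrier by (simp add: V_simps inner_mult)
qed (simp add: V_simps inner_one)

lemma V_pow: "f \<in> carrier V \<Longrightarrow> f [^]\<^bsub>V\<^esub> (p ^ k) = \<one>\<^bsub>V\<^esub>"
proof -
  assume "f \<in> carrier V"
  then obtain x where x: "x \<in> P" "f = inner x" unfolding V_simps F_def by (rule imageE)
  show ?thesis unfolding x(2) V_simps using x(1) by (simp add: inner_pow P_pow inner_one)
qed

lemma F_nontrivial: "F \<noteq> {\<one>\<^bsub>S\<^esub>}"
proof
  assume "F = {\<one>\<^bsub>S\<^esub>}"
  then have "x \<in> C" if "x \<in> P" for x using that inner_eq_one_iff_C by (auto simp: F_def)
  then show False using C_proper by (auto simp: C_def)
qed

lemma conjugation_hom: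
  assumes s: "s \<in> carrier S" "s' \<in> carrier S" "s \<cdot> s' = \<one>\<^bsub>S\<^esub>" "s' \<cdot> s = \<one>\<^bsub>S\<^esub>"
  shows "(\<lambda>f. s' \<cdot> f \<cdot> s) \<in> hom V V"
proof (rule homI)
  fix f assume "f \<in> carrier V"
  then obtain x where x: "x \<in> P" "f = inner x" unfolding V_simps F_def by (rule imageE)
  have "s' \<cdot> f \<cdot> s = inner (s x)"
    unfolding x(2) by (rule conjugate_inner[OF s(1,2,4) P.mem_carrier[OF x(1)]])
  then show "s' \<cdot> f \<cdot> s \<in> carrier V"
    unfolding V_simps F_def using End_P[OF s(1) x(1)] by (rule image_eqI)
next
  fix f g assume "f \<in> carrier V" "g \<in> carrier V"
  then have fg: "f \<in> carrier S" "g \<in> carrier S" by (auto simp: V_simps F_S)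
  have "s' \<cdot> (f \<cdot> g) \<cdot> s = s' \<cdot> f \<cdot> (s \<cdot> s') \<cdot> g \<cdot> s"
    unfolding s(3) using s(1,2) fg by (simp add: S.m_assoc)
  also have "\<dots> = s' \<cdot> f \<cdot> s \<cdot> (s' \<cdot> g \<cdot> s)"
    using s(1,2) fg by (simp add: S.m_assoc)
  finally show "s' \<cdot> (f \<otimes>\<^bsub>V\<^esub> g) \<cdot> s = (s' \<cdot> f \<cdot> s) \<otimes>\<^bsub>V\<^esub> (s' \<cdot> g \<cdot> s)"
    by (simp add: V_simps)
qed

text \<open>
  Conjugation by \<open>b\<close>, carried over from \<open>P\<close> to \<open>F\<close> (see \<open>beta_inner\<close>).
\<close>

definition \<beta> where "\<beta> f = inner (inv b) \<cdot> f \<cdot> inner b"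

lemma beta_hom: "\<beta> \<in> hom V V"
  unfolding \<beta>_def[abs_def]
  by (rule conjugation_hom) (use b inner_r_inv[of b] inner_r_inv[of "inv b"] in \<open>auto simp: inner_End\<close>)

lemma beta_inner: "x \<in> P \<Longrightarrow> \<beta> (inner x) = inner (inv b \<otimes> x \<otimes> b)"
  unfolding \<beta>_def using b P.mem_carrier by (simp add: inner_mult m_assoc)

lemma V_irreducible:
  assumes W: "subgroup W V" "\<beta> ` W \<subseteq> W"
  shows "W = {\<one>\<^bsub>V\<^esub>} \<or> W = carrier V"
proof -
  interpret W: subgroup W V by fact
  have WF: "W \<subseteq> F" using W.subset by (simp add: V_simps)
  define P0 where "P0 = {x \<in> P. inner x \<in> W}"
  have "subgroup P0 G"
  proof (rule subgroupI)
    show "P0 \<subseteq> carrier G" using P.subset by (auto simp: P0_def)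
    have "\<one> \<in> P0" using W.one_closed P.one_closed by (simp add: P0_def V_simps inner_one)
    then show "P0 \<noteq> {}" by blast
  next
    fix x y assume x: "x \<in> P0" and y: "y \<in> P0"
    have xy: "x \<in> P" "y \<in> P" using x y by (simp_all add: P0_def)
    have "inner x \<otimes>\<^bsub>V\<^esub> inner y \<in> W" using x y by (intro W.m_closed) (simp_all add: P0_def)
    then have "inner (x \<otimes> y) \<in> W" unfolding V_simps inner_mult[OF P.mem_carrier[OF xy(1)] P.mem_carrier[OF xy(2)]] .
    then show "x \<otimes> y \<in> P0" using P.m_closed[OF xy] by (simp add: P0_def)
  next
    fix x assume x: "x \<in> P0"
    then have xP: "x \<in> P" "inner x \<in> W" by (auto simp: P0_def)
    have "inner (inv x) = inv\<^bsub>V\<^esub> (inner x)"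
    proof (rule V.inv_equality[symmetric])
      show "inner (inv x) \<otimes>\<^bsub>V\<^esub> inner x = \<one>\<^bsub>V\<^esub>" using inner_r_inv[of "inv x"] xP P.mem_carrier by (simp add: V_simps)
    qed (use xP P.m_inv_closed in \<open>auto simp: V_simps F_def\<close>)
    then show "inv x \<in> P0" using xP W.m_inv_closed by (simp add: P0_def)
  qed
  moreover have "P0 \<subseteq> P" by (auto simp: P0_def)
  moreover have "inv b \<otimes> x \<otimes> b \<in> P0" if "x \<in> P0" for x
    using that W(2) beta_inner[of x] P.inv_op_closed1[OF b, of x] by (auto simp: P0_def)
  ultimately have "P0 = P \<or> (\<forall>x\<in>P0. x \<otimes> b = b \<otimes> x)" by (rule invariant_subgroup)
  then show ?thesis
  proof
    assume "P0 = P"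
    then have "F \<subseteq> W" by (auto simp: F_def P0_def)
    then show ?thesis using WF by (auto simp: V_simps)
  next
    assume c: "\<forall>x\<in>P0. x \<otimes> b = b \<otimes> x"
    have "f = \<one>\<^bsub>S\<^esub>" if f: "f \<in> W" for f
    proof -
      obtain x where x: "x \<in> P" "f = inner x" using f WF by (auto simp: F_def)
      then have "x \<in> P0" using f by (simp add: P0_def)
      then have "x \<in> C" using c x by (simp add: C_def)
      then show ?thesis using inner_eq_one_iff_C x by simp
    qed
    then have "W = {\<one>\<^bsub>S\<^esub>}" using W.one_closed unfolding V_simps by blast
    then show ?thesis by (simp add: V_simps)
  qed
qed

text \<open>
  The commutator \<open>[b, x]\<close> depends only on the inner automorphism by \<open>x\<close>, and such commutators
  generate \<open>P\<close>.
\<close>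

lemma End_eq_if_inner_eq:
  assumes s: "s \<in> carrier S" "t \<in> carrier S" and sb: "s b = b" "t b = b"
    and eq: "\<And>x. x \<in> P \<Longrightarrow> inner (s x) = inner (t x)"
  shows "s = t"
proof (rule End_eq_on_P_b[OF s])
  interpret s: group_hom G G s by (rule End_group_hom[OF s(1)])
  interpret t: group_hom G G t by (rule End_group_hom[OF s(2)])
  show "s b = t b" using sb by simp
  have sub: "subgroup {x \<in> carrier G. s x = t x} G" by (intro subgroupI) (auto intro: exI[of _ \<one>])
  have "generate G {b \<otimes> x \<otimes> inv b \<otimes> inv x | x. x \<in> P} \<subseteq> {x \<in> carrier G. s x = t x}"
  proof (rule generate_subgroup_incl[OF _ sub], safe)
    fix x assume x: "x \<in> P"
    then have xG: "x \<in> carrier G" by (rule P.mem_carrier)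
    then show "b \<otimes> x \<otimes> inv b \<otimes> inv x \<in> carrier G" using b by simp
    have st: "s x \<in> carrier G" "t x \<in> carrier G" using xG by auto
    have "b \<otimes> s x \<otimes> inv b \<otimes> inv (s x) = b \<otimes> t x \<otimes> inv b \<otimes> inv (t x)"
    proof -
      have "inner (inv (s x)) \<cdot> inner (t x) = \<one>\<^bsub>S\<^esub>"
        using inner_r_inv[of "inv (s x)"] st eq[OF x] by simp
      then have "inner (inv (s x)) \<cdot> inner (t x) \<cdot> inner (inv (t x)) = inner (inv (t x))"
        using st by (simp add: inner_End)
      then have "inner (inv (s x)) = inner (inv (t x))"
        using st by (simp add: inner_mult m_assoc)
      then have "inner (inv (s x)) (inv b) = inner (inv (t x)) (inv b)" by simp
      then show ?thesis using st b by (simp add: inner_apply m_assoc)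
    qed
    then show "s (b \<otimes> x \<otimes> inv b \<otimes> inv x) = t (b \<otimes> x \<otimes> inv b \<otimes> inv x)" using xG b sb by simp
  qed
  then have "P \<subseteq> {x \<in> carrier G. s x = t x}" using P_generated_by_commutators by (rule subst[rotated])
  then show "s x = t x" if "x \<in> P" for x using that by blast
qed

text \<open>
  The factor \<open>z\<close> is central, so its order divides \<open>q\<^sup>v\<close> like that of \<open>h\<close> and of the conjugate of \<open>b\<close>;
  but \<open>z\<close> is a \<open>p\<close>-element.
\<close>

lemma conjugate_shift:
  assumes x: "x \<in> carrier G" and h: "h \<in> carrier G" "h [^] (q ^ v) = \<one>" and z: "z \<in> C"
    and eq: "inv x \<otimes> b \<otimes> x = h \<otimes> z"
  shows "z = \<one>"
proof -
  have zP: "z \<in> P" using z by (simp add: C_def)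
  have zG: "z \<in> carrier G" using zP by (rule P.mem_carrier)
  interpret i: group_hom G G "inner x" by (rule End_group_hom[OF inner_End[OF x]])
  have "(inv x \<otimes> b \<otimes> x) [^] (q ^ v) = \<one>"
    using i.hom_nat_pow[OF b, of "q ^ v"] b_pow b by (simp add: inner_apply)
  moreover have "(h \<otimes> z) [^] (q ^ v) = h [^] (q ^ v) \<otimes> z [^] (q ^ v)"
    by (rule pow_mult_distrib) (use C_central[OF z h(1)] h(1) zG in auto)
  ultimately have "z [^] (q ^ v) = \<one>" using eq h zG by simp
  then show ?thesis by (rule P_torsion[OF zP])
qed

text \<open>
  This is the conjugacy of complements. Write \<open>x\<^sup>-\<^sup>1 b x = b (\<psi> x)\<close> for \<open>x\<close> in \<open>P\<close>. On \<open>F\<close> the map \<open>\<psi>\<close>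
  induces the endomorphism \<open>\<chi>\<close>, which is injective because \<open>b\<close> has no fixed points there, and hence
  surjective by finiteness. This reaches \<open>h\<close> up to a factor in \<open>C\<close>, which \<open>conjugate_shift\<close> removes.
\<close>

lemma conjugates_of_b:
  assumes h: "h \<in> carrier G" "h [^] (q ^ v) = \<one>" "e h = b"
  obtains x where "x \<in> P" "h = inv x \<otimes> b \<otimes> x"
proof -
  define \<psi> where "\<psi> x = inv (inv b \<otimes> x \<otimes> b) \<otimes> x" for x
  have psi_P: "\<psi> x \<in> P" if "x \<in> P" for x
    unfolding \<psi>_def using P.inv_op_closed1[OF b that] that by blast
  have psi_conj: "inv x \<otimes> b \<otimes> x = b \<otimes> \<psi> x" if "x \<in> carrier G" for x
    unfolding \<psi>_def using that b by (simp add: word_simps)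
  define \<chi> where "\<chi> f = inv\<^bsub>V\<^esub> (\<beta> f) \<otimes>\<^bsub>V\<^esub> f" for f
  interpret \<beta>: group_hom V V \<beta> by unfold_locales (rule beta_hom)
  have chi: "\<chi> (inner x) = inner (\<psi> x)" if x: "x \<in> P" for x
  proof -
    let ?y = "inv b \<otimes> x \<otimes> b"
    have y: "?y \<in> P" by (rule P.inv_op_closed1[OF b x])
    have "inv\<^bsub>V\<^esub> (inner ?y) = inner (inv ?y)"
    proof (rule V.inv_equality)
      show "inner (inv ?y) \<otimes>\<^bsub>V\<^esub> inner ?y = \<one>\<^bsub>V\<^esub>"
        using inner_r_inv[of "inv ?y"] P.mem_carrier[OF y] by (simp only: V_simps inv_inv inv_closed)
    qed (use y P.m_inv_closed[OF y] in \<open>auto simp: V_simps F_def\<close>)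
    then show ?thesis unfolding \<chi>_def \<psi>_def beta_inner[OF x] V_simps
      using inner_mult[of "inv ?y" x] P.mem_carrier[OF y] P.mem_carrier[OF x] by simp
  qed
  have chi_hom: "group_hom V V \<chi>"
  proof (unfold_locales, rule homI)
    show "\<chi> f \<in> carrier V" if "f \<in> carrier V" for f using that by (simp add: \<chi>_def)
    show "\<chi> (f \<otimes>\<^bsub>V\<^esub> g) = \<chi> f \<otimes>\<^bsub>V\<^esub> \<chi> g" if "f \<in> carrier V" "g \<in> carrier V" for f g
      using that by (simp add: \<chi>_def V.inv_mult V.m_ac)
  qed
  interpret \<chi>: group_hom V V \<chi> by (rule chi_hom)
  have "inj_on \<chi> (carrier V)"
  proof (rule \<chi>.inj_on_one_iff[THEN iffD2], safe)
    fix f assume f: "f \<in> carrier V" "\<chi> f = \<one>\<^bsub>V\<^esub>"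
    then obtain x where x: "x \<in> P" "f = inner x" by (auto simp: V_simps F_def)
    then have xG: "x \<in> carrier G" by (intro P.mem_carrier)
    have z: "\<psi> x \<in> P" by (rule psi_P[OF x(1)])
    have "\<psi> x \<in> C" using f(2) inner_eq_one_iff_C[OF z] chi[OF x(1)] x(2) by (simp add: V_simps)
    then have "\<psi> x = \<one>" by (rule conjugate_shift[OF xG b b_pow _ psi_conj[OF xG]])
    then have "x \<otimes> (inv x \<otimes> b \<otimes> x) = x \<otimes> b" using psi_conj[OF xG] b by simp
    then have "x \<otimes> b = b \<otimes> x" using xG b by (simp add: m_assoc inv_cancel_left)
    then have "x \<in> C" using x(1) by (simp add: C_def)
    then show "f = \<one>\<^bsub>V\<^esub>" using inner_eq_one_iff_C x by (simp add: V_simps)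
  qed
  then have surj: "\<chi> ` carrier V = carrier V"
    using endo_inj_surj[OF finite_V] \<chi>.hom_closed by blast
  have "inv b \<otimes> h \<in> P" using h b by (intro e_kernel) (auto simp: e_b)
  then obtain y where y: "y \<in> P" "h = b \<otimes> y" using b h by (metis inv_cancel_left(2))
  have "inner y \<in> \<chi> ` carrier V" unfolding surj using y by (auto simp: V_simps F_def)
  then obtain x where x: "x \<in> P" "inner y = \<chi> (inner x)" by (auto simp: V_simps F_def)
  have xG: "x \<in> carrier G" and yG: "y \<in> carrier G" using x y P.mem_carrier by auto
  have pG: "\<psi> x \<in> carrier G" using psi_P[OF x(1)] by (rule P.mem_carrier)
  have "inner (inv y \<otimes> \<psi> x) = inner (inv y) \<cdot> inner y"
    using x(2) chi[OF x(1)] yG pG by (simp flip: inner_mult)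
  also have "\<dots> = \<one>\<^bsub>S\<^esub>" using inner_r_inv[of "inv y"] yG by simp
  finally have "inner (inv y \<otimes> \<psi> x) = \<one>\<^bsub>S\<^esub>" .
  moreover have "inv y \<otimes> \<psi> x \<in> P" using psi_P[OF x(1)] y(1) by blast
  ultimately have "inv y \<otimes> \<psi> x \<in> C" using inner_eq_one_iff_C by blast
  moreover have c: "inv x \<otimes> b \<otimes> x = h \<otimes> (inv y \<otimes> \<psi> x)"
    unfolding psi_conj[OF xG] y(2) using b yG pG by (simp add: m_assoc inv_cancel_left)
  ultimately have "inv y \<otimes> \<psi> x = \<one>" using conjugate_shift[OF xG h(1,2)] by blast
  then have "h = inv x \<otimes> b \<otimes> x" using c h(1) by (metis r_one)
  then show thesis by (rule that[OF x(1)])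
qed

lemma e_idem: "e \<cdot> e = e"
  using factors_iff[OF e] e_P by blast

lemma twin_conjugate:
  assumes w: "w \<in> twins S e"
  shows "\<exists>f\<in>F. e \<cdot> f = w"
proof -
  have wS: "w \<in> carrier S" and ew: "e \<cdot> w = w" and we: "w \<cdot> e = e" using w by (auto simp: twins_def)
  interpret w: group_hom G G w by (rule End_group_hom[OF wS])
  have "w b \<in> carrier G" using b by simp
  moreover have "w b [^] (q ^ v) = \<one>" using w.hom_nat_pow[OF b, of "q ^ v"] b_pow by simp
  moreover have "e (w b) = b" using End_mult_apply[OF b, of w e] we e_b by simp
  ultimately obtain x where x: "x \<in> P" "w b = inv x \<otimes> b \<otimes> x" by (rule conjugates_of_b)
  have xG: "x \<in> carrier G" using x(1) by (rule P.mem_carrier)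
  have fS: "inner x \<in> carrier S" by (rule inner_End[OF xG])
  interpret f: group_hom G G "inner x" by (rule End_group_hom[OF fS])
  have wP: "w y = \<one>" if "y \<in> P" for y using factors_iff[OF wS] ew that by blast
  have "e \<cdot> inner x = w"
  proof (rule End_eq_on_P_b[OF End_mult_closed[OF e fS] wS])
    show "(e \<cdot> inner x) y = w y" if "y \<in> P" for y
      using that P.mem_carrier[OF that] by (simp add: End_mult_apply e_P wP)
    show "(e \<cdot> inner x) b = w b" using b by (simp add: End_mult_apply e_b inner_apply x(2))
  qed
  then show ?thesis using x(1) by (auto simp: F_def)
qed

lemma F_e:
  assumes f: "f \<in> F" shows "f \<cdot> e = e"
proof -
  obtain x where x: "x \<in> P" "f = inner x" using f unfolding F_def by (rule imageE)
  have xG: "x \<in> carrier G" using x(1) by (rule P.mem_carrier)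
  show ?thesis unfolding x(2)
    by (rule End_eqI[OF End_mult_closed[OF inner_End[OF xG] e] e])
       (use xG in \<open>simp add: End_mult_apply inner_apply e_P x(1)\<close>)
qed

lemma F_free:
  assumes f: "f \<in> F" and ef: "e \<cdot> f = e" shows "f = \<one>\<^bsub>S\<^esub>"
proof -
  obtain x where x: "x \<in> P" "f = inner x" using f unfolding F_def by (rule imageE)
  have xG: "x \<in> carrier G" using x(1) by (rule P.mem_carrier)
  have "inv x \<otimes> b \<otimes> x = b"
    using End_mult_apply[OF b, of e f] ef x(2) b by (simp add: e_b inner_apply)
  then have "x \<otimes> (inv x \<otimes> b \<otimes> x) = x \<otimes> b" by simp
  then have "x \<in> C" using xG b x(1) by (simp add: C_def m_assoc inv_cancel_left)
  then show ?thesis using inner_eq_one_iff_C[OF x(1)] x(2) by simp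
qed

text \<open>
  If \<open>s b = b\<^sup>i\<close> with \<open>i\<close> prime to \<open>q\<close>, then \<open>s\<close> is invertible in the corner. Otherwise \<open>s b\<close> is a power of the
  central element \<open>b\<^sup>q\<close>. A twin \<open>w\<close> maps \<open>b\<close> to a conjugate of \<open>b\<close> and fixes \<open>b\<^sup>q\<close>.
\<close>

lemma corner_nonunit:
  assumes s: "s \<in> corner S e" and w: "w \<in> twins S e"
  shows "(\<exists>u\<in>corner S e. s \<cdot> u = e) \<or> s \<cdot> w = s"
proof -
  obtain i where i: "s b = b [^] (i::int)" using corner_b[OF s] by blast
  show ?thesis
  proof (cases "int q dvd i")
    case False
    then have "coprime i (int (q ^ v))"
      using q by (metis coprime_commute coprime_power_right_iff of_nat_power prime_imp_coprime prime_nat_int_transfer)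
    then obtain j where j: "[i * j = 1] (mod int (q ^ v))" using cong_solve_coprime_int by blast
    obtain u where u: "u \<in> corner S e" "u b = b [^] j" using exists_corner by blast
    have ec: "e \<in> corner S e"
      unfolding corner_iff using e e_P e_b generate.incl[of b "{b}" G] by simp
    have "s \<cdot> u = e"
      by (rule corner_eqI[OF corner_mult(1)[OF s i u] ec])
        (use corner_mult(2)[OF s i u] j b_int_pow_cong[of "i * j" 1] b e_b in simp)
    then show ?thesis using u(1) by blast
  next
    case True
    then obtain j where j: "i = int q * j" by blast
    obtain f where f: "f \<in> F" "e \<cdot> f = w" using twin_conjugate[OF w] by blast
    obtain x where x: "x \<in> P" "f = inner x" using f(1) unfolding F_def by (rule imageE)
    have xG: "x \<in> carrier G" using x(1) by (rule P.mem_carrier)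
    have wS: "w \<in> carrier S" and sS: "s \<in> carrier S" using w s by (auto simp: twins_def corner_def)
    interpret w: group_hom G G w by (rule End_group_hom[OF wS])
    have wb: "w b = inv x \<otimes> b \<otimes> x"
      using End_mult_apply[OF b, of e f] f(2) x(2) b by (simp add: e_b inner_apply)
    interpret f: group_hom G G "inner x" by (rule End_group_hom[OF inner_End[OF xG]])
    have "w b = inner x b" using wb b by (simp add: inner_apply)
    then have "w (b [^] q) = inner x (b [^] q)" unfolding w.hom_nat_pow[OF b] f.hom_nat_pow[OF b] by simp
    also have "\<dots> = inv x \<otimes> (b [^] q \<otimes> x)" using xG b by (simp add: inner_apply m_assoc)
    also have "\<dots> = b [^] q" unfolding b_power_q_central[OF xG, symmetric] using xG b by (simp add: inv_cancel_left)
    finally have wq: "w (b [^] q) = b [^] q" .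
    have "b [^] i = (b [^] q) [^] j" unfolding j using b by (simp add: int_pow_pow flip: int_pow_int)
    then have "w (b [^] i) = b [^] i" using w.hom_int_pow[of "b [^] q" j] wq b by simp
    then have "s \<cdot> w = s"
      using s wS sS i b by (intro End_eq_on_P_b End_mult_closed)
        (auto simp: End_mult_apply P.mem_carrier corner_iff)
    then show ?thesis ..
  qed
qed

lemma beta_commutes:
  assumes d: "d \<in> carrier S" "d' \<in> carrier S" "d \<cdot> d' = \<one>\<^bsub>S\<^esub>" "d' \<cdot> d = \<one>\<^bsub>S\<^esub>" and db: "d b = b"
    and f: "f \<in> carrier V"
  shows "d' \<cdot> \<beta> f \<cdot> d = \<beta> (d' \<cdot> f \<cdot> d)"
proof -
  interpret d: group_hom G G d by (rule End_group_hom[OF d(1)])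
  obtain x where x: "x \<in> P" "f = inner x" using f unfolding V_simps F_def by (rule imageE)
  have xG: "x \<in> carrier G" using x(1) by (rule P.mem_carrier)
  show ?thesis
    unfolding x(2) beta_inner[OF x(1)]
      conjugate_inner[OF d(1,2,4) xG] conjugate_inner[OF d(1,2,4) P.mem_carrier[OF P.inv_op_closed1[OF b x(1)]]]
      beta_inner[OF End_P[OF d(1) x(1)]]
    using xG b db by simp
qed

text \<open>
  Automorphisms fixing \<open>b\<close> act on \<open>F\<close> as endomorphisms commuting with the irreducible \<open>\<beta>\<close>.
\<close>

lemma b_stabilizer_commutes:
  assumes c: "c \<in> carrier S" "c' \<in> carrier S" "c \<cdot> c' = \<one>\<^bsub>S\<^esub>" "c' \<cdot> c = \<one>\<^bsub>S\<^esub>" "c b = b"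
    and d: "d \<in> carrier S" "d' \<in> carrier S" "d \<cdot> d' = \<one>\<^bsub>S\<^esub>" "d' \<cdot> d = \<one>\<^bsub>S\<^esub>" "d b = b"
  shows "c \<cdot> d = d \<cdot> c"
proof (rule End_eq_if_inner_eq)
  show "c \<cdot> d \<in> carrier S" "d \<cdot> c \<in> carrier S" using c d by auto
  show "(c \<cdot> d) b = b" "(d \<cdot> c) b = b" using c d b by (simp_all add: End_mult_apply)
  fix x assume x: "x \<in> P"
  have xG: "x \<in> carrier G" using x by (rule P.mem_carrier)
  have f: "inner x \<in> carrier V" unfolding V_simps F_def using x by (rule imageI)
  have cd: "c x \<in> carrier G" "d x \<in> carrier G" using End_apply_closed xG c(1) d(1) by auto
  have "d' \<cdot> (c' \<cdot> inner x \<cdot> c) \<cdot> d = c' \<cdot> (d' \<cdot> inner x \<cdot> d) \<cdot> c"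
    by (rule V.commuting_endomorphisms_commute[OF beta_hom V_irreducible conjugation_hom[OF d(1-4)]
          beta_commutes[OF d] conjugation_hom[OF c(1-4)] beta_commutes[OF c] f])
  then have "inner (d (c x)) = inner (c (d x))"
    unfolding conjugate_inner[OF c(1,2,4) xG] conjugate_inner[OF d(1,2,4) xG]
      conjugate_inner[OF d(1,2,4) cd(1)] conjugate_inner[OF c(1,2,4) cd(2)] .
  then show "inner ((c \<cdot> d) x) = inner ((d \<cdot> c) x)" using xG by (simp add: End_mult_apply)
qed

lemma F_normalized:
  assumes s: "s \<in> carrier S" "s' \<in> carrier S" "s' \<cdot> s = \<one>\<^bsub>S\<^esub>" and f: "f \<in> F"
  shows "s' \<cdot> f \<cdot> s \<in> F"
proof -
  obtain x where x: "x \<in> P" "f = inner x" using f unfolding F_def by (rule imageE)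
  show ?thesis unfolding x(2) conjugate_inner[OF s P.mem_carrier[OF x(1)]] F_def
    using End_P[OF s(1) x(1)] by (rule imageI)
qed

lemma e_fixed_imp_b_fixed: "d \<in> carrier S \<Longrightarrow> e \<cdot> d = e \<Longrightarrow> d b = b"
  using End_mult_apply[OF b, of e d] e_b by simp

text \<open>
  An automorphism that is trivial modulo \<open>P\<close> moves \<open>b\<close> to a conjugate by an element of \<open>P\<close>.
\<close>

lemma split_automorphism:
  assumes a: "a \<in> carrier S" "a' \<in> carrier S" "a \<cdot> a' = \<one>\<^bsub>S\<^esub>" "a' \<cdot> a = \<one>\<^bsub>S\<^esub>" "a \<cdot> e = e"
  obtains d f where "d \<in> Units S" "d b = b" "f \<in> F" "f \<in> Units S" "a = d \<cdot> f"
proof -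
  have "e \<cdot> a \<in> twins S e"
    unfolding twins_def using a e S.m_assoc[of e a e] S.m_assoc[of e e a, symmetric] e_idem by simp
  then obtain f where f: "f \<in> F" "e \<cdot> f = e \<cdot> a" using twin_conjugate by blast
  obtain g where g: "g \<in> F" "f \<cdot> g = \<one>\<^bsub>S\<^esub>" using F_inv[OF f(1)] by blast
  have gf: "g \<cdot> f = \<one>\<^bsub>S\<^esub>" using F_comm[OF g(1) f(1)] g(2) by simp
  have c: "f \<in> carrier S" "g \<in> carrier S" using F_S f g by auto
  have fU: "f \<in> Units S" "g \<in> Units S" unfolding Units_def using c g(2) gf by auto
  have aU: "a \<in> Units S" unfolding Units_def using a by auto
  show thesis
  proof (rule that[of "a \<cdot> g" f])
    show "a \<cdot> g \<in> Units S" using aU fU(2) by simp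
    have "e \<cdot> (a \<cdot> g) = e \<cdot> (f \<cdot> g)"
      using a(1) c e f(2) by (simp flip: S.m_assoc)
    then have "e \<cdot> (a \<cdot> g) = e" using g(2) e by simp
    then show "(a \<cdot> g) b = b" using e_fixed_imp_b_fixed a(1) c by simp
    show "a = a \<cdot> g \<cdot> f" using a(1) c gf by (simp add: S.m_assoc)
  qed (use f(1) fU in auto)
qed

text \<open>
  Modulo the normal subgroup \<open>F\<close>, both automorphisms may be taken to fix \<open>b\<close>, and then they commute.
\<close>

lemma commutator_mod_F:
  assumes a: "a \<in> carrier S" "a' \<in> carrier S" "a \<cdot> a' = \<one>\<^bsub>S\<^esub>" "a' \<cdot> a = \<one>\<^bsub>S\<^esub>" "a \<cdot> e = e"
    and c: "c \<in> carrier S" "c' \<in> carrier S" "c \<cdot> c' = \<one>\<^bsub>S\<^esub>" "c' \<cdot> c = \<one>\<^bsub>S\<^esub>" "c \<cdot> e = e"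
  shows "a' \<cdot> c' \<cdot> a \<cdot> c \<in> F"
proof -
  obtain d f where d: "d \<in> Units S" "d b = b" and f: "f \<in> F" and af: "a = d \<cdot> f"
    by (rule split_automorphism[OF a])
  obtain t g where t: "t \<in> Units S" "t b = b" and g: "g \<in> F" and cg: "c = t \<cdot> g"
    by (rule split_automorphism[OF c])
  obtain d' where d': "d' \<in> carrier S" "d' \<cdot> d = \<one>\<^bsub>S\<^esub>" "d \<cdot> d' = \<one>\<^bsub>S\<^esub>" using d(1) unfolding Units_def by blast
  obtain t' where t': "t' \<in> carrier S" "t' \<cdot> t = \<one>\<^bsub>S\<^esub>" "t \<cdot> t' = \<one>\<^bsub>S\<^esub>" using t(1) unfolding Units_def by blast
  have dS: "d \<in> carrier S" and tS: "t \<in> carrier S" using d t by auto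
  have fS: "f \<in> carrier S" and gS: "g \<in> carrier S" using f g F_S by auto
  have dt: "d \<cdot> t = t \<cdot> d"
    by (rule b_stabilizer_commutes[OF dS d'(1,3,2) d(2) tS t'(1,3,2) t(2)])
  have move: "d \<cdot> f \<cdot> (t \<cdot> g) = d \<cdot> t \<cdot> (t' \<cdot> f \<cdot> t \<cdot> g)"
    if "d \<in> carrier S" "f \<in> carrier S" "t \<in> carrier S" "g \<in> carrier S" "t' \<in> carrier S" "t \<cdot> t' = \<one>\<^bsub>S\<^esub>" for d f t g t'
  proof -
    have "d \<cdot> t \<cdot> (t' \<cdot> f \<cdot> t \<cdot> g) = d \<cdot> (t \<cdot> t') \<cdot> f \<cdot> t \<cdot> g"
      using that(1-5) by (simp add: S.m_assoc)
    then show ?thesis using that by (simp add: S.m_assoc)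
  qed
  define h where "h = t' \<cdot> f \<cdot> t \<cdot> g"
  define l where "l = d' \<cdot> g \<cdot> d \<cdot> f"
  have h: "h \<in> F" unfolding h_def by (intro F_mult F_normalized tS t'(1,2) f g)
  have l: "l \<in> F" unfolding l_def by (intro F_mult F_normalized dS d'(1,2) f g)
  obtain l' where l': "l' \<in> F" "l \<cdot> l' = \<one>\<^bsub>S\<^esub>" using F_inv[OF l] by blast
  have hS: "h \<in> carrier S" and lS: "l \<in> carrier S" and l'S: "l' \<in> carrier S" using h l l' F_S by auto
  have ac: "a \<cdot> c = d \<cdot> t \<cdot> h"
    unfolding af cg h_def by (rule move) (use dS fS tS gS t' in auto)
  have ca: "c \<cdot> a = d \<cdot> t \<cdot> l"
    unfolding af cg l_def dt by (rule move) (use dS fS tS gS d' in auto)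
  have "c \<cdot> a \<cdot> l' = d \<cdot> t" unfolding ca using dS tS lS l'S l' by (simp add: S.m_assoc)
  then have ac': "a \<cdot> c = c \<cdot> a \<cdot> l' \<cdot> h" using ac by simp
  have "a' \<cdot> c' \<cdot> a \<cdot> c = a' \<cdot> c' \<cdot> (a \<cdot> c)" using a c by (simp add: S.m_assoc)
  also have "\<dots> = a' \<cdot> (c' \<cdot> c) \<cdot> a \<cdot> l' \<cdot> h"
    unfolding ac' using a(1,2) c(1,2) hS l'S by (simp add: S.m_assoc)
  also have "\<dots> = l' \<cdot> h" unfolding c(4) using a(1,2,4) hS l'S by simp
  finally show ?thesis using F_mult[OF l'(1) h] by simp
qed

lemma beta_pow_inner: "x \<in> P \<Longrightarrow> (\<beta> ^^ n) (inner x) = inner (inv (b [^] n) \<otimes> x \<otimes> b [^] n)"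
proof (induction n)
  case 0
  then show ?case using P.mem_carrier by simp
next
  case (Suc n)
  have xG: "x \<in> carrier G" using Suc.prems by (rule P.mem_carrier)
  have "inv (b [^] n) \<otimes> x \<otimes> b [^] n \<in> P" using P.inv_op_closed1[OF nat_pow_closed[OF b] Suc.prems] .
  from beta_inner[OF this] Suc show ?case using xG b by (simp add: word_simps)
qed

lemma beta_q: "f \<in> carrier V \<Longrightarrow> (\<beta> ^^ q) f = f"
proof -
  assume "f \<in> carrier V"
  then obtain x where x: "x \<in> P" "f = inner x" unfolding V_simps F_def by (rule imageE)
  have xG: "x \<in> carrier G" using x(1) by (rule P.mem_carrier)
  have "inv (b [^] q) \<otimes> x \<otimes> b [^] q = inv (b [^] q) \<otimes> (b [^] q \<otimes> x)"
    unfolding b_power_q_central[OF xG, symmetric] using xG b by (simp add: m_assoc)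
  also have "\<dots> = x" using xG b by (simp add: inv_cancel_left)
  finally show ?thesis unfolding x(2) beta_pow_inner[OF x(1)] by simp
qed

lemma End_pow_apply: "c \<in> carrier S \<Longrightarrow> x \<in> carrier G \<Longrightarrow> (c [^]\<^bsub>S\<^esub> (n::nat)) x = (c ^^ n) x"
  by (induction n) (simp_all add: End_mult_apply End_one_apply)

text \<open>
  Conjugation by \<open>c\<close> commutes with \<open>\<beta>\<close>, and both have order dividing \<open>q\<close>. If the action of \<open>c\<close> on \<open>F\<close> is
  trivial, then \<open>c\<close> is the identity; otherwise \<open>c\<close> is as irreducible as \<open>\<beta>\<close>.
\<close>

lemma F_irreducible:
  assumes c: "c \<in> carrier S" "c' \<in> carrier S" "c \<cdot> c' = \<one>\<^bsub>S\<^esub>" "c' \<cdot> c = \<one>\<^bsub>S\<^esub>"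
    and ec: "e \<cdot> c = e" and cq: "c [^]\<^bsub>S\<^esub> q = \<one>\<^bsub>S\<^esub>" and c1: "c \<noteq> \<one>\<^bsub>S\<^esub>"
    and W: "W \<subseteq> F" "\<one>\<^bsub>S\<^esub> \<in> W" "\<And>f g. f \<in> W \<Longrightarrow> g \<in> W \<Longrightarrow> f \<cdot> g \<in> W"
      "\<And>f. f \<in> W \<Longrightarrow> \<exists>g\<in>W. f \<cdot> g = \<one>\<^bsub>S\<^esub>" "\<And>f. f \<in> W \<Longrightarrow> c' \<cdot> f \<cdot> c \<in> W"
  shows "W = {\<one>\<^bsub>S\<^esub>} \<or> W = F"
proof -
  have cb: "c b = b" by (rule e_fixed_imp_b_fixed[OF c(1) ec])
  let ?k = "\<lambda>f. c' \<cdot> f \<cdot> c"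
  have kpow: "(?k ^^ n) (inner x) = inner ((c ^^ n) x) \<and> (c ^^ n) x \<in> P" if x: "x \<in> P" for n x
  proof (induction n)
    case 0
    then show ?case using x by simp
  next
    case (Suc n)
    then have "(c ^^ n) x \<in> P" "(?k ^^ n) (inner x) = inner ((c ^^ n) x)" by auto
    then show ?case
      using conjugate_inner[OF c(1,2,4), of "(c ^^ n) x"] End_P[OF c(1)] P.mem_carrier by simp
  qed
  have "W = {\<one>\<^bsub>V\<^esub>} \<or> W = carrier V"
  proof (rule ccontr)
    assume no: "\<not> ?thesis"
    have Wsub: "subgroup W V"
    proof (rule V.subgroupI)
      show "W \<subseteq> carrier V" using W(1) by (simp add: V_simps)
      show "W \<noteq> {}" using W(2) by blast
      show "f \<otimes>\<^bsub>V\<^esub> g \<in> W" if "f \<in> W" "g \<in> W" for f g using W(3)[OF that] by (simp add: V_simps)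
      fix f assume f: "f \<in> W"
      obtain g where g: "g \<in> W" "f \<cdot> g = \<one>\<^bsub>S\<^esub>" using W(4)[OF f] by blast
      have "inv\<^bsub>V\<^esub> f = g"
      proof (rule V.inv_equality)
        show "g \<otimes>\<^bsub>V\<^esub> f = \<one>\<^bsub>V\<^esub>" using g f W(1) F_comm[of g f] unfolding V_simps by auto
      qed (use f g W(1) in \<open>auto simp: V_simps\<close>)
      then show "inv\<^bsub>V\<^esub> f \<in> W" using g by simp
    qed
    have tor: "f = \<one>\<^bsub>V\<^esub>" if f: "f \<in> carrier V" "f [^]\<^bsub>V\<^esub> q = \<one>\<^bsub>V\<^esub>" for f
    proof (rule V.pow_coprime_eq_one[OF f(1) V_pow[OF f(1)] f(2)])
      show "coprime (p ^ k) q" using coprime_pq[of k 1] by simp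
    qed
    have fixed: "?k f = f" if f: "f \<in> carrier V" for f
    proof (rule ccontr)
      assume ne: "?k f \<noteq> f"
      have "W = {\<one>\<^bsub>V\<^esub>} \<or> W = carrier V"
      proof (rule V.irreducible_under_commuting_prime_order[OF q beta_hom beta_q V_irreducible conjugation_hom[OF c] _ beta_commutes[OF c cb] f ne tor Wsub])
        fix g assume "g \<in> carrier V"
        then obtain x where x: "x \<in> P" "g = inner x" unfolding V_simps F_def by (rule imageE)
        have xG: "x \<in> carrier G" using x(1) by (rule P.mem_carrier)
        have "(c ^^ q) x = x" using End_pow_apply[OF c(1) xG, of q] cq End_one_apply[OF xG] by simp
        then show "(?k ^^ q) g = g" using kpow[OF x(1), of q] x(2) by simp
      next
        show "?k ` W \<subseteq> W" using W(5) by blast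
      qed
      then show False using no by blast
    qed
    have "c = \<one>\<^bsub>S\<^esub>"
    proof (rule End_eq_if_inner_eq[OF c(1) S.one_closed cb])
      show "\<one>\<^bsub>S\<^esub> b = b" using End_one_apply[OF b] .
      fix x assume x: "x \<in> P"
      have xG: "x \<in> carrier G" using x by (rule P.mem_carrier)
      have "?k (inner x) = inner x" by (rule fixed) (simp add: V_simps F_def x)
      then show "inner (c x) = inner (\<one>\<^bsub>S\<^esub> x)"
        unfolding conjugate_inner[OF c(1,2,4) xG] End_one_apply[OF xG] .
    qed
    then show False using c1 by simp
  qed
  then show ?thesis by (simp add: V_simps)
qed

lemma finite_End: "finite (carrier S)"
proof -
  have "carrier S \<subseteq> carrier G \<rightarrow>\<^sub>E carrier G"
    using End_apply_closed by (auto simp: PiE_def End_carrier_iff)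
  moreover have "finite (carrier G \<rightarrow>\<^sub>E carrier G)" using finite_carrier by (intro finite_PiE) auto
  ultimately show ?thesis by (rule finite_subset)
qed

theorem End_schmidt_monoid: "\<exists>k. schmidt_monoid S p q v k e F"
proof -
  obtain j where j: "card (carrier V) = p ^ j"
    by (rule V.exponent_imp_prime_power_order[OF p finite_V V_pow])
  have "schmidt_monoid S p q v j e F"
  proof (unfold_locales)
    show "finite (carrier S)" by (rule finite_End)
    show "e \<in> carrier S" by (rule e)
    show "e \<cdot> e = e" by (rule e_idem)
    show "s \<in> Units S \<or> e \<cdot> s = s" if "s \<in> carrier S" for s
      using unit_or_kills_P[OF that] factors_iff[OF that] by blast
    show "card (corner S e) = q ^ v" by (rule corner_card)
    show "s \<cdot> t = t \<cdot> s" "\<exists>u\<in>corner S e. s = t \<cdot> u \<or> t = s \<cdot> u"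
      if "s \<in> corner S e" "t \<in> corner S e" for s t
      using corner_comm[OF that] corner_chain[OF that] .
    show "(\<exists>u\<in>corner S e. s \<cdot> u = e) \<or> s \<cdot> w = s" if "s \<in> corner S e" "w \<in> twins S e" for s w
      by (rule corner_nonunit[OF that])
    show "s = z" if z: "z \<in> carrier S" "\<And>t. t \<in> carrier S \<Longrightarrow> z \<cdot> t = z \<and> t \<cdot> z = z"
      and s: "s \<in> carrier S" "e \<cdot> s = s" "s \<cdot> e = z" for z s
    proof -
      let ?o = "restrict (\<lambda>x. \<one>) (carrier G)"
      have "(\<lambda>x. \<one>) \<in> hom G G" by (simp add: hom_def)
      then have o: "?o \<in> carrier S" by (rule End_restrictI)
      have zx: "z x = \<one>" if x: "x \<in> carrier G" for x
      proof -
        have "(z \<cdot> ?o) x = \<one>" using End_mult_apply[OF x, of z ?o] End_apply_closed[OF z(1) x] by simp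
        then show ?thesis using z(2)[OF o] by simp
      qed
      have "e (s x) = \<one>" if "x \<in> carrier G" for x
        using End_mult_apply[OF that, of s e] s(3) zx[OF that] by simp
      then have "s x = \<one>" if "x \<in> carrier G" for x using factor_zero[OF s(1,2)] that by blast
      then show ?thesis by (intro End_eqI[OF s(1) z(1)]) (simp add: zx)
    qed
    show "f \<in> carrier S" "\<exists>g\<in>F. f \<cdot> g = \<one>\<^bsub>S\<^esub>" "f \<cdot> e = e" if "f \<in> F" for f
      using F_S[OF that] F_inv[OF that] F_e[OF that] .
    show "\<one>\<^bsub>S\<^esub> \<in> F" by (rule F_one)
    show "f \<cdot> g \<in> F" "f \<cdot> g = g \<cdot> f" if "f \<in> F" "g \<in> F" for f g
      using F_mult[OF that] F_comm[OF that] .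
    show "card F = p ^ j" using j by (simp add: V_simps)
    show "F \<noteq> {\<one>\<^bsub>S\<^esub>}" by (rule F_nontrivial)
    show "f = \<one>\<^bsub>S\<^esub>" if "f \<in> F" "e \<cdot> f = e" for f by (rule F_free[OF that])
    show "a' \<cdot> c' \<cdot> a \<cdot> c \<in> F"
      if "a \<in> carrier S" "a' \<in> carrier S" "a \<cdot> a' = \<one>\<^bsub>S\<^esub>" "a' \<cdot> a = \<one>\<^bsub>S\<^esub>" "a \<cdot> e = e"
        "c \<in> carrier S" "c' \<in> carrier S" "c \<cdot> c' = \<one>\<^bsub>S\<^esub>" "c' \<cdot> c = \<one>\<^bsub>S\<^esub>" "c \<cdot> e = e" for a a' c c'
      by (rule commutator_mod_F[OF that])
    show "W = {\<one>\<^bsub>S\<^esub>} \<or> W = F"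
      if "c \<in> carrier S" "c' \<in> carrier S" "c \<cdot> c' = \<one>\<^bsub>S\<^esub>" "c' \<cdot> c = \<one>\<^bsub>S\<^esub>"
        "e \<cdot> c = e" "c \<cdot> e = e" "c [^]\<^bsub>S\<^esub> q = \<one>\<^bsub>S\<^esub>" "c \<noteq> \<one>\<^bsub>S\<^esub>"
        "W \<subseteq> F" "\<one>\<^bsub>S\<^esub> \<in> W" "\<And>f g. f \<in> W \<Longrightarrow> g \<in> W \<Longrightarrow> f \<cdot> g \<in> W"
        "\<And>f. f \<in> W \<Longrightarrow> \<exists>g\<in>W. f \<cdot> g = \<one>\<^bsub>S\<^esub>" "\<And>f. f \<in> W \<Longrightarrow> c' \<cdot> f \<cdot> c \<in> W" for c c' W
      by (rule F_irreducible[OF that(1-5) that(7-13)])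
  qed
  then show ?thesis by blast
qed

end

section \<open>Recovering the group from the monoid\<close>

text \<open>
  A group \<open>G\<close>, possibly infinite, whose endomorphism monoid has the properties of \<open>schmidt_monoid\<close>. Below,
  \<open>M\<close> and \<open>K\<close> are to become the derived subgroup and its cyclic complement.
\<close>

locale schmidt_End = group G for G (structure) +
  fixes p q v k :: nat and e :: "'a \<Rightarrow> 'a" and F :: "('a \<Rightarrow> 'a) set"
  assumes monoid_data: "schmidt_monoid (End_semigroup G) p q v k e F"
    and p: "Factorial_Ring.prime p" and q: "Factorial_Ring.prime q" and pq: "p \<noteq> q" and v: "v \<ge> 1"
begin

abbreviation S where "S \<equiv> End_semigroup G"
abbreviation S_mult (infixl "\<cdot>" 70) where "s \<cdot> t \<equiv> s \<otimes>\<^bsub>S\<^esub> t"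

sublocale S: schmidt_monoid S p q v k e F by (rule monoid_data)
sublocale e: group_hom G G e by (rule End_group_hom[OF S.e_closed])

definition M where "M = kernel G G e"
definition K where "K = e ` carrier G"

sublocale M: normal M G unfolding M_def by (rule e.normal_kernel)
sublocale K: subgroup K G unfolding K_def by (rule e.img_is_subgroup)

lemma M_iff: "x \<in> M \<longleftrightarrow> x \<in> carrier G \<and> e x = \<one>"
  unfolding M_def kernel_def by simp

lemma e_e: "x \<in> carrier G \<Longrightarrow> e (e x) = e x"
  by (rule End_mult_eqD[OF S.e_idem])

lemma e_K: "y \<in> K \<Longrightarrow> e y = y"
  unfolding K_def by (erule imageE) (simp only: e_e)

lemma e_in_K: "x \<in> carrier G \<Longrightarrow> e x \<in> K"
  by (simp add: K_def)

lemma M_part: "x \<in> carrier G \<Longrightarrow> x \<otimes> inv (e x) \<in> M"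
  unfolding M_iff by (simp add: e_e)

lemma semidirect_M_K: "semidirect_of G M K"
  unfolding semidirect_of_def
proof (intro conjI)
  show "M \<lhd> G" unfolding M_def by (rule e.normal_kernel)
  show "subgroup K G" by (rule K.is_subgroup)
  show "M \<inter> K = {\<one>}" using e_K M.one_closed K.one_closed by (auto simp: M_iff)
  show "M <#> K = carrier G"
  proof
    show "M <#> K \<subseteq> carrier G" by (rule set_mult_closed[OF M.subset K.subset])
    show "carrier G \<subseteq> M <#> K"
    proof
      fix x assume x: "x \<in> carrier G"
      then have "x = (x \<otimes> inv (e x)) \<otimes> e x" by (simp add: m_assoc)
      then show "x \<in> M <#> K" unfolding set_mult_def using M_part[OF x] e_in_K[OF x] by blast
    qed
  qed
qed

lemma factors_iff:
  assumes s: "s \<in> carrier S"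
  shows "e \<cdot> s = s \<longleftrightarrow> (\<forall>x\<in>M. s x = \<one>)"
proof -
  interpret s: group_hom G G s by (rule End_group_hom[OF s])
  show ?thesis
  proof
    assume a: "e \<cdot> s = s"
    show "\<forall>x\<in>M. s x = \<one>"
    proof
      fix x assume "x \<in> M"
      then have "e x = \<one>" "x \<in> carrier G" by (simp_all add: M_iff)
      then show "s x = \<one>" using End_mult_eqD[OF a, of x, symmetric] by simp
    qed
  next
    assume a: "\<forall>x\<in>M. s x = \<one>"
    show "e \<cdot> s = s"
    proof (rule End_eqI[OF End_mult_closed[OF S.e_closed s] s])
      fix x assume x: "x \<in> carrier G"
      have "x = (x \<otimes> inv (e x)) \<otimes> e x" using x by (simp add: m_assoc)
      then have "s x = s (x \<otimes> inv (e x)) \<otimes> s (e x)" using x by (metis s.hom_mult e.hom_closed inv_closed m_closed)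
      also have "\<dots> = s (e x)" using a M_part[OF x] x by simp
      finally show "(e \<cdot> s) x = s x" using x by (simp add: End_mult_apply)
    qed
  qed
qed

lemma nonunit_kills_M: "s \<in> carrier S \<Longrightarrow> s \<notin> Units S \<Longrightarrow> x \<in> M \<Longrightarrow> s x = \<one>"
  using S.unit_or_factors factors_iff by blast

abbreviation KG where "KG \<equiv> G\<lparr>carrier := K\<rparr>"

sublocale KG: group KG by (rule subgroup_imp_group[OF K.is_subgroup])

text \<open>
  Identifies the endomorphisms of \<open>K\<close> with the corner of \<open>e\<close>.
\<close>

definition ext where "ext f = (\<lambda>x\<in>carrier G. f (e x))"

lemma ext_corner:
  assumes f: "f \<in> carrier (End_semigroup KG)"
  shows "ext f \<in> corner S e"
proof -
  have fK: "f y \<in> K" if "y \<in> K" for y using KG.End_apply_closed[OF f] that by simp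
  have fm: "f (x \<otimes> y) = f x \<otimes> f y" if "x \<in> K" "y \<in> K" for x y
    using f that by (auto simp: End_carrier_iff hom_def)
  have c: "ext f \<in> carrier S" unfolding ext_def
    by (rule End_restrictI, rule homI) (use fK fm e_in_K K.mem_carrier in auto)
  moreover have "e \<cdot> ext f = ext f"
    by (rule End_eqI[OF End_mult_closed[OF S.e_closed c] c]) (simp add: End_mult_apply ext_def e_e)
  moreover have "ext f \<cdot> e = ext f"
    by (rule End_eqI[OF End_mult_closed[OF c S.e_closed] c]) (simp add: End_mult_apply ext_def e_K fK e_in_K)
  ultimately show ?thesis by (simp add: corner_def)
qed

lemma ext_apply: "y \<in> K \<Longrightarrow> ext f y = f y"
  by (simp add: ext_def e_K K.mem_carrier)

lemma ext_inj: "f \<in> carrier (End_semigroup KG) \<Longrightarrow> g \<in> carrier (End_semigroup KG) \<Longrightarrow> ext f = ext g \<Longrightarrow> f = g"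
proof (rule End_eqI[of f KG g])
  fix x assume eq: "ext f = ext g" and "x \<in> carrier KG"
  then have x: "x \<in> K" by simp
  show "f x = g x" using fun_cong[OF eq, of x] unfolding ext_apply[OF x] .
qed

lemma ext_surj:
  assumes u: "u \<in> corner S e"
  shows "\<exists>f\<in>carrier (End_semigroup KG). u = ext f"
proof -
  have uS: "u \<in> carrier S" and eu: "e \<cdot> u = u" and ue: "u \<cdot> e = u" using u by (auto simp: corner_def)
  interpret u: group_hom G G u by (rule End_group_hom[OF uS])
  have uK: "u y \<in> K" if "y \<in> carrier G" for y
    using e_in_K[of "u y"] that by (simp add: End_mult_eqD[OF ue])
  have "u \<in> hom KG KG" by (rule homI) (use uK K.mem_carrier in auto)
  then have f: "restrict u K \<in> carrier (End_semigroup KG)" using KG.End_restrictI[of u] by simp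
  have "u = ext (restrict u K)"
  proof (rule End_eqI[OF uS])
    show "ext (restrict u K) \<in> carrier S" using ext_corner[OF f] by (simp add: corner_def)
    fix x assume x: "x \<in> carrier G"
    then show "u x = ext (restrict u K) x" using e_in_K[OF x] by (simp add: ext_def End_mult_eqD[OF eu])
  qed
  then show ?thesis using f by blast
qed

lemma ext_mult:
  assumes f: "f \<in> carrier (End_semigroup KG)" and g: "g \<in> carrier (End_semigroup KG)"
  shows "ext (f \<otimes>\<^bsub>End_semigroup KG\<^esub> g) = ext f \<cdot> ext g"
proof (rule End_eqI)
  have fK: "f y \<in> K" if "y \<in> K" for y using KG.End_apply_closed[OF f] that by simp
  show "ext (f \<otimes>\<^bsub>End_semigroup KG\<^esub> g) \<in> carrier S" "ext f \<cdot> ext g \<in> carrier S"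
    using ext_corner[OF f] ext_corner[OF g] ext_corner[OF KG.End_mult_closed[OF f g]]
    by (auto simp: corner_def End_mult_closed)
  fix x assume x: "x \<in> carrier G"
  then show "ext (f \<otimes>\<^bsub>End_semigroup KG\<^esub> g) x = (ext f \<cdot> ext g) x"
    using End_mult_apply[of "e x" KG f g] e_in_K[OF x] fK[OF e_in_K[OF x]] K.mem_carrier
    by (simp add: End_mult_apply ext_def e_K)
qed

sublocale KG: chain_endomorphisms KG
proof
  fix f g assume f: "f \<in> carrier (End_semigroup KG)" and g: "g \<in> carrier (End_semigroup KG)"
  note fg = ext_corner[OF f] ext_corner[OF g]
  show "f \<otimes>\<^bsub>End_semigroup KG\<^esub> g = g \<otimes>\<^bsub>End_semigroup KG\<^esub> f"
    by (rule ext_inj) (simp_all add: KG.End_mult_closed f g ext_mult S.corner_comm[OF fg])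
  obtain u where u: "u \<in> corner S e" and or: "ext f = ext g \<cdot> u \<or> ext g = ext f \<cdot> u"
    using S.corner_chain[OF fg] by blast
  obtain t where t: "t \<in> carrier (End_semigroup KG)" "u = ext t" using ext_surj[OF u] by blast
  have "f = g \<otimes>\<^bsub>End_semigroup KG\<^esub> t \<or> g = f \<otimes>\<^bsub>End_semigroup KG\<^esub> t"
    using or unfolding t(2) ext_mult[OF g t(1), symmetric] ext_mult[OF f t(1), symmetric]
    using ext_inj f g KG.End_mult_closed t(1) by blast
  then show "\<exists>u\<in>carrier (End_semigroup KG). f = g \<otimes>\<^bsub>End_semigroup KG\<^esub> u \<or> g = f \<otimes>\<^bsub>End_semigroup KG\<^esub> u"
    using t(1) by blast
qed

lemma K_cyclic: "\<exists>b. b \<in> K \<and> generate G {b} = K \<and> ord b = q ^ v"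
proof -
  have "bij_betw ext (carrier (End_semigroup KG)) (corner S e)"
  proof (rule bij_betw_imageI)
    show "inj_on ext (carrier (End_semigroup KG))" by (rule inj_onI) (rule ext_inj)
    show "ext ` carrier (End_semigroup KG) = corner S e" using ext_corner ext_surj by blast
  qed
  then have "card (carrier (End_semigroup KG)) = q ^ v" using S.corner_card by (simp add: bij_betw_same_card)
  then obtain b where b: "b \<in> carrier KG" "carrier KG = generate KG {b}" "KG.ord b = q ^ v"
    by (rule KG.cyclic_of_card_End[OF _ q v])
  have gen: "generate G {b} = K"
    using b(1,2) generate_consistent[of "{b}" K] K.is_subgroup by simp
  moreover have "ord b = q ^ v"
    using KG.generate_pow_card[OF b(1)] generate_pow_card[of b] b gen K.mem_carrier by simp
  ultimately show ?thesis using b(1) by auto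
qed

definition b where "b = (SOME b. b \<in> K \<and> generate G {b} = K \<and> ord b = q ^ v)"

lemma b_K: "b \<in> K" and generate_b: "generate G {b} = K" and ord_b: "ord b = q ^ v"
  using someI_ex[OF K_cyclic] by (auto simp: b_def)

lemma b: "b \<in> carrier G"
  using b_K by (rule K.mem_carrier)

lemma e_b: "e b = b"
  using b_K by (rule e_K)

lemma b_pow: "b [^] (q ^ v) = \<one>"
  using pow_ord_eq_1[OF b] ord_b by simp

lemma K_powers: "y \<in> K \<Longrightarrow> \<exists>i::int. y = b [^] i"
  unfolding generate_b[symmetric] generate_pow[OF b] by blast

lemma decompose:
  assumes x: "x \<in> carrier G"
  shows "\<exists>m\<in>M. \<exists>i::int. x = m \<otimes> b [^] i \<and> e x = b [^] i"
proof -
  obtain i where i: "e x = b [^] (i::int)" using K_powers[OF e_in_K[OF x]] by blast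
  have "x = (x \<otimes> inv (e x)) \<otimes> b [^] i" using x b unfolding i by (simp add: m_assoc)
  then show ?thesis using M_part[OF x] i by blast
qed

lemma End_eq_on_b:
  assumes s: "s \<in> carrier S" "t \<in> carrier S" and M: "\<And>x. x \<in> M \<Longrightarrow> s x = t x" and "s b = t b"
  shows "s = t"
proof (rule End_eqI[OF s])
  interpret s: group_hom G G s by (rule End_group_hom[OF s(1)])
  interpret t: group_hom G G t by (rule End_group_hom[OF s(2)])
  fix x assume "x \<in> carrier G"
  then obtain y i where y: "y \<in> M" "x = y \<otimes> b [^] (i::int)" using decompose by blast
  then show "s x = t x" using b assms(4) M[OF y(1)] M.mem_carrier[OF y(1)] by (simp add: s.hom_int_pow t.hom_int_pow)
qed

lemma exists_End:
  assumes g: "g \<in> carrier G" "g [^] (q ^ v) = \<one>"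
  obtains s where "s \<in> carrier S" "s b = g" "\<And>x. x \<in> M \<Longrightarrow> s x = \<one>"
proof -
  have g': "g [^] ord b = \<one>" using g ord_b by simp
  have sd: "semidirect_of G M (generate G {b})" using semidirect_M_K generate_b by simp
  obtain f where f: "f \<in> hom G G" "f b = g" "\<And>x. x \<in> M \<Longrightarrow> f x = \<one>"
    using semidirect_hom[OF sd b is_group g(1) g'] by blast
  show thesis
    by (rule that[OF End_restrictI[OF f(1)]]) (use f b M.mem_carrier in auto)
qed

text \<open>
  The endomorphism that kills \<open>M\<close> and maps \<open>b\<close> to \<open>y\<close> becomes zero when followed by \<open>e\<close>; by
  \<open>factor_zero\<close> it is zero itself.
\<close>

lemma M_torsion:
  assumes y: "y \<in> M" "y [^] (q ^ v) = \<one>"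
  shows "y = \<one>"
proof -
  have yG: "y \<in> carrier G" using y(1) by (rule M.mem_carrier)
  obtain s where s: "s \<in> carrier S" "s b = y" "\<And>x. x \<in> M \<Longrightarrow> s x = \<one>" using exists_End[OF yG y(2)] by blast
  interpret s: group_hom G G s by (rule End_group_hom[OF s(1)])
  let ?o = "restrict (\<lambda>x. \<one>) (carrier G)"
  have "(\<lambda>x. \<one>) \<in> hom G G" by (simp add: hom_def)
  then have o: "?o \<in> carrier S" by (rule End_restrictI)
  have "s = ?o"
  proof (rule S.factor_zero[OF o _ s(1)])
    fix t assume t: "t \<in> carrier S"
    interpret t: group_hom G G t by (rule End_group_hom[OF t])
    have "?o \<cdot> t = ?o" by (rule End_eqI[OF End_mult_closed[OF o t] o]) (simp add: End_mult_apply)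
    moreover have "t \<cdot> ?o = ?o" by (rule End_eqI[OF End_mult_closed[OF t o] o]) (simp add: End_mult_apply)
    ultimately show "?o \<cdot> t = ?o \<and> t \<cdot> ?o = ?o" ..
  next
    show "e \<cdot> s = s" using factors_iff[OF s(1)] s(3) by blast
    show "s \<cdot> e = ?o"
    proof (rule End_eq_on_b[OF End_mult_closed[OF s(1) S.e_closed] o])
      show "(s \<cdot> e) x = ?o x" if "x \<in> M" for x
        using End_mult_apply[OF M.mem_carrier[OF that], of s e] s(3)[OF that] M.mem_carrier[OF that] by simp
      show "(s \<cdot> e) b = ?o b"
        using End_mult_apply[OF b, of s e] s(2) y(1) b unfolding M_iff by simp
    qed
  qed
  then show ?thesis using s(2) b by simp
qed

lemma M_torsion_q:
  assumes y: "y \<in> M" "y [^] q = \<one>"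
  shows "y = \<one>"
proof (rule M_torsion[OF y(1)])
  obtain w where w: "v = Suc w" using v by (cases v) auto
  have "y [^] (q ^ v) = (y [^] q) [^] (q ^ w)" using M.mem_carrier[OF y(1)] by (simp add: w nat_pow_pow)
  then show "y [^] (q ^ v) = \<one>" using y(2) by simp
qed

lemma inner_twin:
  assumes x: "x \<in> M"
  shows "e \<cdot> inner x \<in> twins S e"
proof -
  have xG: "x \<in> carrier G" using x by (rule M.mem_carrier)
  have i: "inner x \<in> carrier S" by (rule inner_End[OF xG])
  have "inner x \<cdot> e = e"
    by (rule End_eqI[OF End_mult_closed[OF i S.e_closed] S.e_closed])
      (use x in \<open>simp add: End_mult_apply inner_apply M_iff\<close>)
  then show ?thesis
    using S.e_idem S.m_assoc[OF S.e_closed S.e_closed i] S.m_assoc[OF S.e_closed i S.e_closed] S.e_closed i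
    by (simp add: twins_def)
qed

lemma central_if_commutes:
  assumes y: "y \<in> carrier G" and M: "\<And>x. x \<in> M \<Longrightarrow> y \<otimes> x = x \<otimes> y" and yb: "y \<otimes> b = b \<otimes> y"
    and g: "g \<in> carrier G"
  shows "y \<otimes> g = g \<otimes> y"
proof -
  have Z: "subgroup {z \<in> carrier G. y \<otimes> z = z \<otimes> y} G" by (rule centralizer_subgroup[OF y])
  obtain m i where m: "m \<in> M" "g = m \<otimes> b [^] (i::int)" using decompose[OF g] by blast
  have "m \<in> {z \<in> carrier G. y \<otimes> z = z \<otimes> y}" using M[OF m(1)] M.mem_carrier[OF m(1)] by simp
  moreover have "b [^] i \<in> {z \<in> carrier G. y \<otimes> z = z \<otimes> y}"
    using yb b by (intro subgroup_int_pow_closed[OF Z]) simp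
  ultimately have "g \<in> {z \<in> carrier G. y \<otimes> z = z \<otimes> y}" unfolding m(2) by (rule subgroup.m_closed[OF Z])
  then show ?thesis by simp
qed

lemma b_powers_commute: "b [^] (i::int) \<otimes> b [^] (j::int) = b [^] j \<otimes> b [^] i"
  unfolding int_pow_mult[OF b, symmetric] by (simp add: add.commute)

text \<open>
  The endomorphism \<open>n\<close> that kills \<open>M\<close> and maps \<open>b\<close> to \<open>b\<^sup>q\<close> is in the corner but not invertible there. By
  \<open>corner_nonunit\<close> it is unchanged when followed by \<open>e\<close> and the inner automorphism by \<open>x\<close>; so \<open>x\<close> commutes
  with \<open>b\<^sup>q\<close>.
\<close>

lemma b_power_q_central:
  assumes g: "g \<in> carrier G"
  shows "b [^] q \<otimes> g = g \<otimes> b [^] q"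
proof (rule central_if_commutes[OF nat_pow_closed[OF b] _ _ g])
  show "b [^] q \<otimes> b = b \<otimes> b [^] q" using b_powers_commute[of "int q" 1] b by (simp add: int_pow_int)
  fix x assume x: "x \<in> M"
  have xG: "x \<in> carrier G" using x by (rule M.mem_carrier)
  have "(b [^] q) [^] (q ^ v) = (b [^] (q ^ v)) [^] q" using b by (simp add: nat_pow_pow mult.commute)
  then have "(b [^] q) [^] (q ^ v) = \<one>" using b_pow by simp
  then obtain n where n: "n \<in> carrier S" "n b = b [^] q" "\<And>x. x \<in> M \<Longrightarrow> n x = \<one>"
    using exists_End[OF nat_pow_closed[OF b]] by blast
  have ebq: "e (b [^] q) = b [^] q" using e.hom_nat_pow[OF b, of q] e_b by simp
  have "n \<cdot> e = n"
  proof (rule End_eq_on_b[OF End_mult_closed[OF n(1) S.e_closed] n(1)])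
    show "(n \<cdot> e) x = n x" if "x \<in> M" for x
      using End_mult_apply[OF M.mem_carrier[OF that], of n e] n(3)[OF that] by simp
    show "(n \<cdot> e) b = n b" using End_mult_apply[OF b, of n e] n(2) ebq by simp
  qed
  then have nc: "n \<in> corner S e" using factors_iff[OF n(1)] n by (simp add: corner_def)
  have "\<not> (\<exists>u\<in>corner S e. n \<cdot> u = e)"
  proof
    assume "\<exists>u\<in>corner S e. n \<cdot> u = e"
    then obtain u where u: "u \<in> corner S e" "n \<cdot> u = e" by blast
    then have uS: "u \<in> carrier S" and ue: "u \<cdot> e = u" by (auto simp: corner_def)
    interpret u: group_hom G G u by (rule End_group_hom[OF uS])
    have "u b \<in> K" using e_in_K[of "u b"] b by (simp add: End_mult_eqD[OF ue])
    then obtain j where j: "u b = b [^] (j::int)" using K_powers by blast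
    have "u (n b) = b" using End_mult_eqD[OF u(2) b] e_b by simp
    then have "(b [^] j) [^] q = b" unfolding n(2) u.hom_nat_pow[OF b] j .
    then have "b [^] (j * int q) = b [^] (1::int)" using b by (simp flip: int_pow_int add: int_pow_pow)
    then have "int (q ^ v) dvd 1 - j * int q" using int_pow_eq[OF b] ord_b by simp
    moreover have "int q dvd int (q ^ v)" using v by (simp add: dvd_power)
    ultimately have "int q dvd 1 - j * int q" by (rule dvd_trans[rotated])
    then have "int q dvd 1" by (simp add: dvd_diff_left_iff)
    then show False using q by simp
  qed
  then have nw: "n \<cdot> (e \<cdot> inner x) = n" using S.corner_nonunit[OF nc inner_twin[OF x]] by blast
  have "inner x (e (n b)) = n b"
    using End_mult_eqD[OF nw b] End_mult_apply[of "n b" G e "inner x"] n(2) b by simp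
  then have "inv x \<otimes> b [^] q \<otimes> x = b [^] q" unfolding n(2) ebq using b by (simp add: inner_apply)
  then have "x \<otimes> (inv x \<otimes> b [^] q \<otimes> x) = x \<otimes> b [^] q" by simp
  then show "b [^] q \<otimes> x = x \<otimes> b [^] q" using xG b by (simp add: m_assoc inv_cancel_left)
qed

lemma F_S: "f \<in> F \<Longrightarrow> f \<in> carrier S"
  by (rule S.F_closed)

lemma inner_e:
  assumes g: "g \<in> carrier G"
  shows "inner g \<cdot> e = e"
proof (rule End_eqI[OF End_mult_closed[OF inner_End[OF g] S.e_closed] S.e_closed])
  fix x assume x: "x \<in> carrier G"
  obtain i j where i: "e g = b [^] (i::int)" and j: "e x = b [^] (j::int)"
    using K_powers e_in_K g x by metis
  have "e (inv g \<otimes> x \<otimes> g) = inv (b [^] i) \<otimes> (b [^] j \<otimes> b [^] i)"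
    using g x b by (simp add: i j m_assoc)
  also have "\<dots> = e x" unfolding b_powers_commute[of j i] j using b by (simp add: inv_cancel_left)
  finally show "(inner g \<cdot> e) x = e x" using x by (simp add: End_mult_apply inner_apply)
qed

lemma commutator_in_F:
  assumes "g \<in> carrier G" "h \<in> carrier G"
  shows "inner (g \<otimes> h \<otimes> inv g \<otimes> inv h) \<in> F"
proof -
  have "inner (inv (inv g)) \<cdot> inner (inv (inv h)) \<cdot> inner (inv g) \<cdot> inner (inv h) \<in> F"
    by (rule S.F_commutators) (use assms in \<open>auto intro!: inner_End inner_e inner_r_inv inner_l_inv\<close>)
  then show ?thesis using assms by (simp add: inner_mult)
qed

lemma F_acts_freely:
  assumes f: "f \<in> F" "g \<in> F" and eq: "f b = g b"
  shows "f = g"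
proof -
  obtain h where h: "h \<in> F" "g \<cdot> h = \<one>\<^bsub>S\<^esub>" using S.F_inv[OF f(2)] by blast
  have c: "f \<in> carrier S" "g \<in> carrier S" "h \<in> carrier S" using f h F_S by auto
  interpret h: group_hom G G h by (rule End_group_hom[OF c(3)])
  have "(f \<cdot> h) b = b"
    using End_mult_apply[OF b, of f h] End_mult_eqD[OF h(2) b] End_one_apply[OF b] eq by simp
  then have "e \<cdot> (f \<cdot> h) = e"
  proof (intro End_eq_on_b)
    have fh: "f \<cdot> h \<in> carrier S" using c by simp
    interpret fh: group_hom G G "f \<cdot> h" by (rule End_group_hom[OF fh])
    show "(e \<cdot> (f \<cdot> h)) x = e x" if "x \<in> M" for x
      using End_mult_apply[OF M.mem_carrier[OF that], of e "f \<cdot> h"] that unfolding M_iff by simp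
    assume "(f \<cdot> h) b = b"
    then show "(e \<cdot> (f \<cdot> h)) b = e b"
      using End_mult_apply[OF b, of e "f \<cdot> h"] e_b by simp
  qed (use c S.e_closed in auto)
  then have "f \<cdot> h = \<one>\<^bsub>S\<^esub>" by (rule S.F_free[OF S.F_mult[OF f(1) h(1)]])
  then have "f \<cdot> h \<cdot> g = g" using c by simp
  moreover have "h \<cdot> g = \<one>\<^bsub>S\<^esub>" using S.F_comm[OF h(1) f(2)] h(2) by simp
  ultimately show ?thesis using c by (simp add: S.m_assoc)
qed

lemma F_moves_b_in_coset:
  assumes f: "f \<in> F"
  shows "inv (f b) \<otimes> b \<in> M"
proof -
  interpret f: group_hom G G f by (rule End_group_hom[OF F_S[OF f]])
  show ?thesis using b End_mult_eqD[OF S.F_e[OF f] b] by (simp add: M_iff e_b)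
qed

text \<open>
  Commutation with the inner automorphism by \<open>b\<close> maps \<open>f\<close> in \<open>F\<close> to the inner automorphism by
  \<open>(f b)\<^sup>-\<^sup>1 b\<close>, which is again in \<open>F\<close>. This map \<open>\<chi>\<close> is injective: if \<open>f\<close> and \<open>g\<close> have the same value, \<open>f b\<close> and
  \<open>g b\<close> differ by a central factor in \<open>M\<close> of order dividing \<open>q\<^sup>v\<close>, which is trivial. As \<open>F\<close> is finite, \<open>\<chi>\<close> is
  onto.
\<close>

lemma F_subset_inner: "F \<subseteq> inner ` M"
proof -
  define \<chi> where "\<chi> f = inner (inv (f b) \<otimes> b)" for f :: "'a \<Rightarrow> 'a"
  have chiF: "\<chi> f \<in> F" if f: "f \<in> F" for f
  proof -
    obtain f' where f': "f' \<in> F" "f \<cdot> f' = \<one>\<^bsub>S\<^esub>" using S.F_inv[OF f] by blast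
    have f'f: "f' \<cdot> f = \<one>\<^bsub>S\<^esub>" using S.F_comm[OF f'(1) f] f'(2) by simp
    have c: "f \<in> carrier S" "f' \<in> carrier S" using f f' F_S by auto
    interpret f: group_hom G G f by (rule End_group_hom[OF c(1)])
    have "f' \<cdot> inner (inv b) \<cdot> f \<cdot> inner b \<in> F"
      by (rule S.F_commutators) (use c f'(2) f'f b S.F_e[OF f] in \<open>auto intro!: inner_End inner_e inner_r_inv inner_l_inv\<close>)
    also have "f' \<cdot> inner (inv b) \<cdot> f = inner (f (inv b))"
      by (rule conjugate_inner[OF c f'f inv_closed[OF b]])
    finally show ?thesis unfolding \<chi>_def using b by (simp add: inner_mult)
  qed
  have "inj_on \<chi> F"
  proof (rule inj_onI, rule F_acts_freely)
    fix f g assume f: "f \<in> F" and g: "g \<in> F" and eq: "\<chi> f = \<chi> g"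
    interpret f: group_hom G G f by (rule End_group_hom[OF F_S[OF f]])
    interpret g: group_hom G G g by (rule End_group_hom[OF F_S[OF g]])
    let ?x = "f b" and ?y = "g b"
    have xy: "?x \<in> carrier G" "?y \<in> carrier G" using b by auto
    define z where "z = inv ?x \<otimes> ?y"
    have "(inv ?x \<otimes> b) \<otimes> inv (inv ?y \<otimes> b) = z" unfolding z_def using xy b by (simp add: word_simps)
    then have zc: "z \<otimes> u = u \<otimes> z" if "u \<in> carrier G" for u
      using eq inner_eq_iff[of "inv ?x \<otimes> b" "inv ?y \<otimes> b"] xy b that unfolding \<chi>_def by simp
    have "z = (inv ?x \<otimes> b) \<otimes> inv (inv ?y \<otimes> b)" unfolding z_def using xy b by (simp add: word_simps)
    then have zM: "z \<in> M" using F_moves_b_in_coset[OF f] F_moves_b_in_coset[OF g] by simp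
    have zG: "z \<in> carrier G" using zM by (rule M.mem_carrier)
    have y: "?y = ?x \<otimes> z" unfolding z_def using xy by (simp add: inv_cancel_left)
    have "?y [^] (q ^ v) = ?x [^] (q ^ v) \<otimes> z [^] (q ^ v)"
      unfolding y by (rule pow_mult_distrib) (use zc xy zG in auto)
    moreover have "?y [^] (q ^ v) = \<one>" "?x [^] (q ^ v) = \<one>"
      using b b_pow by (simp_all flip: f.hom_nat_pow g.hom_nat_pow)
    ultimately have "z [^] (q ^ v) = \<one>" using zG by simp
    then have "z = \<one>" by (rule M_torsion[OF zM])
    then show "?x = ?y" using y xy by simp
  qed
  moreover have "finite F" using finite_subset[OF _ S.finite_carrier] F_S by blast
  ultimately have "\<chi> ` F = F" using chiF by (intro endo_inj_surj) auto
  then show ?thesis using F_moves_b_in_coset unfolding \<chi>_def by blast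
qed

lemma b_not_central: "\<exists>x\<in>M. x \<otimes> b \<noteq> b \<otimes> x"
proof -
  obtain f where f: "f \<in> F" "f \<noteq> \<one>\<^bsub>S\<^esub>" using S.F_nontrivial S.F_one by blast
  obtain x where x: "x \<in> M" "f = inner x" using f F_subset_inner by blast
  have xG: "x \<in> carrier G" using x(1) by (rule M.mem_carrier)
  have "x \<otimes> b \<noteq> b \<otimes> x"
  proof
    assume "x \<otimes> b = b \<otimes> x"
    then have "inv x \<otimes> b \<otimes> x = b" using xG b by (metis inv_cancel_left(1) inv_closed m_assoc)
    then have "f b = \<one>\<^bsub>S\<^esub> b" using x(2) b by (simp add: inner_apply End_one_apply)
    then show False using F_acts_freely[OF f(1) S.F_one] f(2) by simp
  qed
  then show ?thesis using x(1) by blast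
qed

text \<open>
  Together with the central \<open>b\<^sup>q\<close>, such a power generates \<open>\<langle>b\<rangle>\<close>, which is not central.
\<close>

lemma b_power_not_central:
  assumes i: "\<not> int q dvd i" shows "\<exists>x\<in>M. x \<otimes> b [^] i \<noteq> b [^] i \<otimes> x"
proof (rule ccontr)
  assume "\<not> ?thesis"
  then have c: "x \<otimes> b [^] i = b [^] i \<otimes> x" if "x \<in> M" for x using that by blast
  obtain a c where ac: "i * a + int q * c = 1" by (rule prime_not_dvd_bezout[OF q i])
  have "x \<otimes> b = b \<otimes> x" if x: "x \<in> M" for x
  proof -
    have xG: "x \<in> carrier G" using x by (rule M.mem_carrier)
    let ?Z = "{z \<in> carrier G. x \<otimes> z = z \<otimes> x}"
    have Z: "subgroup ?Z G" by (rule centralizer_subgroup[OF xG])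
    have "b [^] i \<in> ?Z" using c[OF x] b by simp
    moreover have "b [^] int q \<in> ?Z" using b_power_q_central[OF xG] b by (simp add: int_pow_int)
    ultimately have "(b [^] i) [^] a \<otimes> (b [^] int q) [^] c \<in> ?Z"
      using subgroup.m_closed[OF Z subgroup_int_pow_closed[OF Z, of _ a] subgroup_int_pow_closed[OF Z, of _ c]] by blast
    also have "(b [^] i) [^] a \<otimes> (b [^] int q) [^] c = b"
      using b ac by (simp add: int_pow_pow flip: int_pow_mult)
    finally show ?thesis by simp
  qed
  then show False using b_not_central by blast
qed

lemma kernel_inner: "g \<in> carrier G \<Longrightarrow> inner g = \<one>\<^bsub>S\<^esub> \<Longrightarrow> h \<in> carrier G \<Longrightarrow> g \<otimes> h = h \<otimes> g"
  using inner_eq_one_iff by blast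

lemma inner_Units: "g \<in> carrier G \<Longrightarrow> inner g \<in> Units S"
  unfolding Units_def using inner_End[of g] inner_End[of "inv g"] inner_r_inv[of g] inner_l_inv[of g] by auto

sublocale U: group "units_of S" by (rule S.units_group)

lemma inner_hom: "inner \<in> hom G (units_of S)"
  by (rule homI) (auto simp: units_of_carrier units_of_mult inner_Units inner_mult)

lemma inner_group_hom: "group_hom G (units_of S) inner"
  by (unfold_locales, rule inner_hom)

lemmas inner_U_pow = group_hom.hom_nat_pow[OF inner_group_hom]
  and inner_U_int_pow = group_hom.hom_int_pow[OF inner_group_hom]
  and inner_U_closed = group_hom.hom_closed[OF inner_group_hom]

lemma finite_inner: "finite (inner ` carrier G)"
  by (rule finite_subset[OF _ S.finite_carrier]) (auto intro: inner_End)

text \<open>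
  The transfer into the centre, for the finite group of inner automorphisms. Its image is central
  whereas \<open>b\<close> is not, so it is not an automorphism and kills \<open>M\<close>.
\<close>

lemma central_power:
  assumes z: "z \<in> M" "inner z = \<one>\<^bsub>S\<^esub>"
  shows "z [^] card (inner ` carrier G) = \<one>"
proof -
  obtain t where t: "t \<in> hom G G" "\<And>g. g \<in> carrier G \<Longrightarrow> inner (t g) = \<one>\<^bsub>units_of S\<^esub>"
    and tz: "\<And>z. z \<in> carrier G \<Longrightarrow> inner z = \<one>\<^bsub>units_of S\<^esub> \<Longrightarrow> t z = z [^] card (inner ` carrier G)"
  proof (rule transfer_hom[OF inner_group_hom finite_inner])
    show "z \<otimes> g = g \<otimes> z" if "z \<in> carrier G" "g \<in> carrier G" "inner z = \<one>\<^bsub>units_of S\<^esub>" for z g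
      using kernel_inner that by (simp add: units_of_one)
  qed blast
  let ?t = "restrict t (carrier G)"
  have tS: "?t \<in> carrier S" by (rule End_restrictI[OF t(1)])
  have "?t \<notin> Units S"
  proof
    assume "?t \<in> Units S"
    then have "b \<in> ?t ` carrier G" using End_Units_bij[of ?t] b unfolding bij_betw_def by blast
    then obtain g where "g \<in> carrier G" "b = t g" by auto
    then have "inner b = \<one>\<^bsub>S\<^esub>" using t(2) by (simp add: units_of_one)
    then have "x \<otimes> b = b \<otimes> x" if "x \<in> M" for x using kernel_inner[OF b] M.mem_carrier[OF that] by simp
    then show False using b_not_central by blast
  qed
  then have "?t z = \<one>" by (rule nonunit_kills_M[OF tS _ z(1)])
  then show ?thesis using tz[of z] z M.mem_carrier[OF z(1)] by (simp add: units_of_one)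
qed

lemma M_exponent: "\<exists>n>0. \<forall>x\<in>M. x [^] (n::nat) = \<one>"
proof -
  (* The power x^o' is central, and central elements of M have exponent dividing N. *)
  define o' where "o' = order (units_of S)"
  define N where "N = card (inner ` carrier G)"
  have fin: "finite (carrier (units_of S))"
    by (rule finite_subset[OF _ S.finite_carrier]) (auto simp: units_of_carrier)
  have "o' > 0" unfolding o'_def order_def using fin U.one_closed by (auto simp: card_gt_0_iff)
  moreover have "N > 0" unfolding N_def using finite_inner one_closed by (auto simp: card_gt_0_iff)
  moreover have "x [^] (o' * N) = \<one>" if x: "x \<in> M" for x
  proof -
    have xG: "x \<in> carrier G" using x by (rule M.mem_carrier)
    have "inner (x [^] o') = \<one>\<^bsub>units_of S\<^esub>"
      unfolding inner_U_pow[OF xG] o'_def by (rule U.pow_order_eq_1[OF inner_U_closed[OF xG]])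
    moreover have "x [^] o' \<in> M"
      using M.is_subgroup x subgroup_int_pow_closed[of M x "int o'"] by (simp add: int_pow_int)
    ultimately have "(x [^] o') [^] N = \<one>" unfolding N_def using central_power by (simp add: units_of_one)
    then show ?thesis using xG by (simp add: nat_pow_pow)
  qed
  ultimately show ?thesis by (intro exI[of _ "o' * N"]) simp
qed

lemma derived_subset_M: "derived G (carrier G) \<subseteq> M"
  unfolding derived_def
proof (rule generate_subgroup_incl[OF _ M.is_subgroup], safe)
  fix g h assume gh: "g \<in> carrier G" "h \<in> carrier G"
  obtain i j where i: "e g = b [^] (i::int)" and j: "e h = b [^] (j::int)"
    using K_powers e_in_K gh by metis
  have "e (g \<otimes> h \<otimes> inv g \<otimes> inv h) = b [^] i \<otimes> b [^] j \<otimes> inv (b [^] i) \<otimes> inv (b [^] j)"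
    using gh by (simp add: i j)
  also have "\<dots> = \<one>" by (rule commutator_eq_one_iff[THEN iffD2]) (use b b_powers_commute in auto)
  finally have "e (g \<otimes> h \<otimes> inv g \<otimes> inv h) = \<one>" .
  moreover have "g \<otimes> h \<otimes> inv g \<otimes> inv h \<in> carrier G" using gh by simp
  ultimately show "g \<otimes> h \<otimes> inv g \<otimes> inv h \<in> M" unfolding M_iff by blast
qed

text \<open>
  Otherwise \<open>G' K\<close> is a proper subgroup, and as \<open>M\<close> has bounded exponent there is a homomorphism of \<open>G\<close>
  that kills \<open>G' K\<close> and maps some \<open>x\<close> in \<open>M\<close> to an element \<open>u \<noteq> \<one>\<close> of prime order. It kills \<open>b\<close>, so it is
  not an automorphism and must kill \<open>M\<close>.
\<close>

lemma derived_eq_M: "derived G (carrier G) = M"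
proof (rule ccontr)
  let ?D = "derived G (carrier G)"
  assume ne: "?D \<noteq> M"
  interpret D: normal ?D G by (rule derived_is_normal[OF normal_self])
  let ?N = "{x \<otimes> b [^] (i::int) | x i. x \<in> ?D}"
  have N: "subgroup ?N G"
    by (rule subgroup_powers_extension[OF D.is_subgroup b]) (use b D.inv_op_closed1 D.inv_op_closed2 in auto)
  have DN: "?D \<subseteq> ?N" using powers_extension_mem(1)[OF D.is_subgroup b] by (rule subsetI)
  have bN: "b [^] (i::int) \<in> ?N" for i by (rule powers_extension_mem(2)[OF D.is_subgroup b])
  have proper: "?N \<noteq> carrier G"
  proof
    assume eq: "?N = carrier G"
    have "M \<subseteq> ?D"
    proof
      fix m assume m: "m \<in> M"
      have "m \<in> ?N" unfolding eq using m by (rule M.mem_carrier)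
      then obtain d and i :: int where d: "d \<in> ?D" "m = d \<otimes> b [^] i" by blast
      have dG: "d \<in> carrier G" using d(1) by (rule D.mem_carrier)
      have "e m = b [^] i"
        unfolding d(2) using dG b derived_subset_M d(1) by (auto simp: e.hom_int_pow e_b M_iff)
      then have "b [^] i = \<one>" using m by (simp add: M_iff)
      then show "m \<in> ?D" using d dG by simp
    qed
    then show False using ne derived_subset_M by blast
  qed
  obtain n where n: "n > 0" "\<And>x. x \<in> M \<Longrightarrow> x [^] (n::nat) = \<one>" using M_exponent by blast
  obtain r x u where "Factorial_Ring.prime r" and x: "x \<in> M" and u: "u \<in> M" "u \<noteq> \<one>" "u [^] (r::nat) = \<one>"
    and homs: "\<And>u. u \<in> carrier G \<Longrightarrow> u [^] r = \<one> \<Longrightarrow> \<exists>f. f \<in> hom G G \<and> f x = u \<and> (\<forall>y\<in>?N. f y = \<one>) \<and>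
        (\<forall>h\<in>carrier G. \<exists>i::int. f h = u [^] i)"
  proof (rule exists_hom_onto_prime_order[OF N DN proper M.subset n])
    show "m [^] i \<in> M" if "m \<in> M" for m and i :: nat
      using subgroup_int_pow_closed[OF M.is_subgroup that, of "int i"] by (simp add: int_pow_int)
    show "\<exists>m\<in>M. \<exists>y\<in>?N. h = m \<otimes> y" if "h \<in> carrier G" for h
      using decompose[OF that] bN by blast
    fix r x u
    assume h: "Factorial_Ring.prime r" "x \<in> M" "u \<in> M" "u \<noteq> \<one>" "u [^] (r::nat) = \<one>"
      and homs: "\<And>u. u \<in> carrier G \<Longrightarrow> u [^] r = \<one> \<Longrightarrow> \<exists>f. f \<in> hom G G \<and> f x = u \<and> (\<forall>y\<in>?N. f y = \<one>) \<and>
        (\<forall>h\<in>carrier G. \<exists>i::int. f h = u [^] i)"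
    show thesis by (rule that[OF h homs])
  qed
  obtain f where f: "f \<in> hom G G" "f x = u" "\<And>y. y \<in> ?N \<Longrightarrow> f y = \<one>"
    using homs[OF M.mem_carrier[OF u(1)] u(3)] by blast
  let ?f = "restrict f (carrier G)"
  have fS: "?f \<in> carrier S" by (rule End_restrictI[OF f(1)])
  have fb: "f b = \<one>" using f(3)[OF bN[of 1]] b by simp
  have f1: "f \<one> = \<one>" using f(3) DN D.one_closed by blast
  have "b \<noteq> \<one>" using b_not_central M.mem_carrier by auto
  then have "?f \<notin> Units S"
    using End_Units_bij[of ?f] fb f1 b unfolding bij_betw_def inj_on_def by auto
  then have "?f x = \<one>" by (rule nonunit_kills_M[OF fS _ x])
  then show False using f(2) u(2) M.mem_carrier[OF x] by simp
qed

lemma inner_M_subset_F: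
  assumes x: "x \<in> M" shows "inner x \<in> F"
proof -
  have "subgroup {x \<in> carrier G. inner x \<in> F} G"
  proof (rule subgroupI)
    have "inner \<one> \<in> F" unfolding inner_one by (rule S.F_one)
    then show "{x \<in> carrier G. inner x \<in> F} \<noteq> {}" using one_closed by blast
    show "x \<otimes> y \<in> {x \<in> carrier G. inner x \<in> F}"
      if "x \<in> {x \<in> carrier G. inner x \<in> F}" "y \<in> {x \<in> carrier G. inner x \<in> F}" for x y
    proof -
      have "inner x \<cdot> inner y \<in> F" using that by (intro S.F_mult) simp_all
      then show ?thesis using that by (simp add: inner_mult)
    qed
    fix x assume x: "x \<in> {x \<in> carrier G. inner x \<in> F}"
    then have xG: "x \<in> carrier G" and xF: "inner x \<in> F" by auto
    obtain f where f: "f \<in> F" "inner x \<cdot> f = \<one>\<^bsub>S\<^esub>" using S.F_inv[OF xF] by blast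
    have "inner (inv x) = inner (inv x) \<cdot> (inner x \<cdot> f)"
      unfolding f(2) using inner_End[OF inv_closed[OF xG]] by (simp only: S.r_one)
    also have "\<dots> = inner (inv x) \<cdot> inner x \<cdot> f"
      by (rule S.m_assoc[symmetric]) (use xG F_S[OF f(1)] in \<open>auto intro: inner_End\<close>)
    also have "\<dots> = f"
      unfolding inner_l_inv[OF xG] by (rule S.l_one[OF F_S[OF f(1)]])
    finally show "inv x \<in> {x \<in> carrier G. inner x \<in> F}" using f(1) xG by simp
  qed auto
  then have "derived G (carrier G) \<subseteq> {x \<in> carrier G. inner x \<in> F}"
    unfolding derived_def by (rule generate_subgroup_incl[rotated]) (auto intro: commutator_in_F)
  then show ?thesis using x derived_eq_M by blast
qed

lemma F_eq_inner_M: "F = inner ` M"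
  using F_subset_inner inner_M_subset_F by blast

text \<open>
  Every inner automorphism is uniquely the product of one in \<open>F\<close> and one by \<open>b\<^sup>i\<close> with \<open>0 \<le> i < q\<close>:
  existence holds because \<open>b\<^sup>q\<close> is central, and uniqueness because \<open>F\<close> acts freely while powers of \<open>b\<close> fix \<open>b\<close>.
\<close>

lemma card_inner: "card (inner ` carrier G) = p ^ k * q"
proof -
  let ?h = "\<lambda>(f, i). f \<cdot> inner (b [^] (i::nat))"
  have q0: "q > 0" using q by (rule prime_gt_0_nat)
  have bq: "inner (b [^] q) = \<one>\<^bsub>S\<^esub>"
    using inner_eq_one_iff[of "b [^] q"] b b_power_q_central by simp
  have img: "?h ` (F \<times> {..<q}) = inner ` carrier G"
  proof
    show "?h ` (F \<times> {..<q}) \<subseteq> inner ` carrier G"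
    proof safe
      fix f and i :: nat assume "f \<in> F"
      then obtain m where m: "m \<in> M" "f = inner m" unfolding F_eq_inner_M by blast
      have mG: "m \<in> carrier G" using m(1) by (rule M.mem_carrier)
      have "f \<cdot> inner (b [^] i) = inner (m \<otimes> b [^] i)" unfolding m(2) by (rule inner_mult) (use mG b in auto)
      moreover have "m \<otimes> b [^] i \<in> carrier G" using mG b by simp
      ultimately show "f \<cdot> inner (b [^] i) \<in> inner ` carrier G" by (rule image_eqI)
    qed
    show "inner ` carrier G \<subseteq> ?h ` (F \<times> {..<q})"
    proof safe
      fix g assume g: "g \<in> carrier G"
      obtain m i where m: "m \<in> M" "g = m \<otimes> b [^] (i::int)" using decompose[OF g] by blast
      have mG: "m \<in> carrier G" using m(1) by (rule M.mem_carrier)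
      let ?r = "nat (i mod int q)"
      have "i = int ?r + int q * (i div int q)" using q0 by simp
      then have "b [^] i = b [^] (int ?r) \<otimes> (b [^] int q) [^] (i div int q)"
        unfolding int_pow_pow[OF b] int_pow_mult[OF b, symmetric] by simp
      then have bi: "b [^] i = b [^] ?r \<otimes> (b [^] q) [^] (i div int q)" by (simp add: int_pow_int)
      have "inner ((b [^] q) [^] (i div int q)) = inner (b [^] q) [^]\<^bsub>units_of S\<^esub> (i div int q)"
        by (rule inner_U_int_pow[OF nat_pow_closed[OF b]])
      also have "inner (b [^] q) = \<one>\<^bsub>units_of S\<^esub>" unfolding bq units_of_one ..
      also have "\<one>\<^bsub>units_of S\<^esub> [^]\<^bsub>units_of S\<^esub> (i div int q) = \<one>\<^bsub>units_of S\<^esub>" by (rule U.int_pow_one)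
      also have "\<one>\<^bsub>units_of S\<^esub> = \<one>\<^bsub>S\<^esub>" by (rule units_of_one)
      finally have "inner (b [^] i) = inner (b [^] ?r)"
        unfolding bi using inner_mult[of "b [^] ?r" "(b [^] q) [^] (i div int q)"] b
        by (simp add: inner_End)
      then have "inner g = ?h (inner m, ?r)" unfolding m(2) using inner_mult[OF mG, of "b [^] i"] b by simp
      moreover have "(inner m, ?r) \<in> F \<times> {..<q}"
        using inner_M_subset_F[OF m(1)] q0 by (simp add: nat_less_iff)
      ultimately show "inner g \<in> ?h ` (F \<times> {..<q})" by (rule image_eqI)
    qed
  qed
  have main: "i = j" if f: "f \<in> F" "f' \<in> F" and ij: "i < q" "j < q" "i \<le> j"
    and eq: "f \<cdot> inner (b [^] i) = f' \<cdot> inner (b [^] j)" for f f' and i j :: nat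
  proof (rule ccontr)
    assume ne: "i \<noteq> j"
    obtain m m' where m: "m \<in> M" "f = inner m" and m': "m' \<in> M" "f' = inner m'" using f unfolding F_eq_inner_M by blast
    have mG: "m \<in> carrier G" "m' \<in> carrier G" using m(1) m'(1) M.mem_carrier by auto
    have bG: "b [^] i \<in> carrier G" "b [^] j \<in> carrier G" "b [^] (j - i) \<in> carrier G" using b by auto
    have bj: "b [^] j = b [^] (j - i) \<otimes> b [^] i" using b ij(3) by (simp add: nat_pow_mult)
    have "inner (m \<otimes> b [^] i) = inner (m' \<otimes> b [^] j)"
      using eq unfolding m(2) m'(2) inner_mult[OF mG(1) bG(1)] inner_mult[OF mG(2) bG(2)] .
    then have c: "(m \<otimes> b [^] i \<otimes> inv (m' \<otimes> b [^] j)) \<otimes> x = x \<otimes> (m \<otimes> b [^] i \<otimes> inv (m' \<otimes> b [^] j))" if "x \<in> carrier G" for x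
      using inner_eq_iff[of "m \<otimes> b [^] i" "m' \<otimes> b [^] j"] mG bG that by simp
    define d where "d = m \<otimes> inv (b [^] (j - i)) \<otimes> inv m'"
    have d: "m \<otimes> b [^] i \<otimes> inv (m' \<otimes> b [^] j) = d"
      unfolding bj d_def using mG bG by (simp add: word_simps)
    have dG: "d \<in> carrier G" unfolding d_def using mG bG by simp
    have "inner d = \<one>\<^bsub>S\<^esub>" using inner_eq_one_iff[OF dG] c unfolding d by simp
    moreover have "b [^] (j - i) = inv m' \<otimes> inv d \<otimes> m"
      unfolding d_def using mG bG by (simp add: word_simps)
    moreover have "inner (inv d) = \<one>\<^bsub>S\<^esub>"
      using \<open>inner d = \<one>\<^bsub>S\<^esub>\<close> inner_r_inv[OF dG] inner_End[OF inv_closed[OF dG]] by (metis S.l_one)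
    ultimately have "inner (b [^] (j - i)) = inner (inv m') \<cdot> inner m"
      using mG dG inner_mult[of "inv m' \<otimes> inv d" m] inner_mult[of "inv m'" "inv d"]
        inner_End[of "inv m'"] S.r_one[of "inner (inv m')"] by (metis inv_closed m_closed)
    also have "\<dots> \<in> F" using inner_M_subset_F m(1) m'(1) by (intro S.F_mult) auto
    finally have inF: "inner (b [^] (j - i)) \<in> F" .
    have "inner (b [^] (j - i)) b = \<one>\<^bsub>S\<^esub> b"
      using b_powers_commute[of 1 "int (j - i)"] b
      by (simp add: inner_apply End_one_apply int_pow_int m_assoc inv_cancel_left)
    then have "inner (b [^] (j - i)) = \<one>\<^bsub>S\<^esub>" by (rule F_acts_freely[OF inF S.F_one])
    then have "x \<otimes> b [^] int (j - i) = b [^] int (j - i) \<otimes> x" if "x \<in> M" for x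
      using kernel_inner[OF bG(3), of x] M.mem_carrier[OF that] by (simp add: int_pow_int)
    then have "int q dvd int (j - i)" using b_power_not_central by blast
    then have "q dvd j - i" by (simp only: int_dvd_int_iff)
    then show False using ne ij by (auto dest!: dvd_imp_le)
  qed
  have "inj_on ?h (F \<times> {..<q})"
  proof (rule inj_onI)
    fix u w assume u: "u \<in> F \<times> {..<q}" and w: "w \<in> F \<times> {..<q}" and uw: "?h u = ?h w"
    obtain f i where fi: "u = (f, i)" by (cases u)
    obtain f' j where fj: "w = (f', j)" by (cases w)
    have f: "f \<in> F" "f' \<in> F" and lt: "i < q" "j < q" using u w by (simp_all add: fi fj)
    have eq: "f \<cdot> inner (b [^] i) = f' \<cdot> inner (b [^] j)" using uw by (simp add: fi fj)
    have ij': "i = j"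
    proof (cases "i \<le> j")
      case True
      show ?thesis by (rule main[OF f lt True eq])
    next
      case False
      then have "j \<le> i" by simp
      show ?thesis by (rule main[OF f(2,1) lt(2,1) \<open>j \<le> i\<close> eq[symmetric], symmetric])
    qed
    have bj: "b [^] j \<in> carrier G" using b by simp
    have c: "inner (b [^] j) \<in> carrier S" "inner (inv (b [^] j)) \<in> carrier S" using bj by (auto intro: inner_End)
    have cancel: "g \<cdot> inner (b [^] j) \<cdot> inner (inv (b [^] j)) = g" if "g \<in> F" for g
      unfolding S.m_assoc[OF F_S[OF that] c] inner_r_inv[OF bj] by (rule S.r_one[OF F_S[OF that]])
    have "f = f \<cdot> inner (b [^] j) \<cdot> inner (inv (b [^] j))" by (rule cancel[OF f(1), symmetric])
    also have "\<dots> = f' \<cdot> inner (b [^] j) \<cdot> inner (inv (b [^] j))" by (simp only: eq[unfolded ij'])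
    also have "\<dots> = f'" by (rule cancel[OF f(2)])
    finally have "f = f'" .
    then show "u = w" using ij' by (simp add: fi fj)
  qed
  then have "card (inner ` carrier G) = card (F \<times> {..<q})" unfolding img[symmetric] by (rule card_image)
  then show ?thesis using S.F_card by (simp add: card_cartesian_product)
qed

text \<open>
  Central elements of \<open>M\<close> have order dividing \<open>p\<^sup>k q\<close> by the transfer, and hence \<open>p\<^sup>k\<close> as there is no
  \<open>q\<close>-torsion. The inner automorphisms by elements of \<open>M\<close> form the group \<open>F\<close> of order \<open>p\<^sup>k\<close>.
\<close>

lemma M_exponent_prime_power:
  assumes x: "x \<in> M"
  shows "x [^] (p ^ (k + k)) = \<one>"
proof -
  have central: "z [^] (p ^ k) = \<one>" if z: "z \<in> M" "inner z = \<one>\<^bsub>S\<^esub>" for z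
  proof (rule M_torsion_q)
    show "z [^] (p ^ k) \<in> M"
      using subgroup_int_pow_closed[OF M.is_subgroup z(1), of "int (p ^ k)"] by (simp add: int_pow_int del: of_nat_power)
    show "(z [^] (p ^ k)) [^] q = \<one>"
      using central_power[OF z] M.mem_carrier[OF z(1)] by (simp add: card_inner nat_pow_pow)
  qed
  have xG: "x \<in> carrier G" using x by (rule M.mem_carrier)
  have sub: "subgroup F (units_of S)"
    unfolding F_eq_inner_M by (rule group_hom.subgroup_img_is_subgroup[OF inner_group_hom M.is_subgroup])
  interpret FG: group "units_of S\<lparr>carrier := F\<rparr>" by (rule U.subgroup_imp_group[OF sub])
  have "inner x [^]\<^bsub>units_of S\<lparr>carrier := F\<rparr>\<^esub> (p ^ k) = \<one>\<^bsub>units_of S\<^esub>"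
    using FG.pow_order_eq_1[of "inner x"] inner_M_subset_F[OF x] S.F_card by (simp add: order_def)
  then have "inner x [^]\<^bsub>units_of S\<^esub> (p ^ k) = \<one>\<^bsub>units_of S\<^esub>"
    by (simp flip: U.nat_pow_consistent)
  then have "inner (x [^] (p ^ k)) = \<one>\<^bsub>S\<^esub>" using xG by (simp add: inner_U_pow units_of_one)
  moreover have "x [^] (p ^ k) \<in> M"
    using subgroup_int_pow_closed[OF M.is_subgroup x, of "int (p ^ k)"] by (simp add: int_pow_int del: of_nat_power)
  ultimately have "(x [^] (p ^ k)) [^] (p ^ k) = \<one>" by (rule central[rotated])
  then show ?thesis using xG by (simp add: nat_pow_pow power_add)
qed

lemma M_commutator_central:
  assumes m: "m \<in> M" "m' \<in> M" and g: "g \<in> carrier G"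
  shows "(m \<otimes> m' \<otimes> inv m \<otimes> inv m') \<otimes> g = g \<otimes> (m \<otimes> m' \<otimes> inv m \<otimes> inv m')"
proof -
  have G: "m \<in> carrier G" "m' \<in> carrier G" using m M.mem_carrier by auto
  have "inner (m \<otimes> m') = inner (m' \<otimes> m)"
    using S.F_comm[OF inner_M_subset_F[OF m(1)] inner_M_subset_F[OF m(2)]] G by (simp add: inner_mult)
  then show ?thesis using inner_eq_iff[of "m \<otimes> m'" "m' \<otimes> m"] G g by (simp add: word_simps)
qed

text \<open>
  A commutator depends only on the two inner automorphisms, of which there are finitely many.
\<close>

lemma finite_commutators: "finite {g \<otimes> h \<otimes> inv g \<otimes> inv h | g h. g \<in> carrier G \<and> h \<in> carrier G}"
proof -
  define s where "s c = (SOME g. g \<in> carrier G \<and> inner g = c)" for c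
  have s: "s (inner g) \<in> carrier G" "inner (s (inner g)) = inner g" if "g \<in> carrier G" for g
    using someI[of "\<lambda>h. h \<in> carrier G \<and> inner h = inner g" g] that unfolding s_def by auto
  have one: "g \<otimes> h \<otimes> inv g \<otimes> inv h = g' \<otimes> h \<otimes> inv g' \<otimes> inv h"
    if "g \<in> carrier G" "g' \<in> carrier G" "h \<in> carrier G" and eq: "inner g = inner g'" for g g' h
  proof -
    have "(g \<otimes> inv g') \<otimes> (g' \<otimes> h \<otimes> inv g') = (g' \<otimes> h \<otimes> inv g') \<otimes> (g \<otimes> inv g')"
      using inner_eq_iff[OF that(1,2)] eq that by simp
    then have "g \<otimes> h \<otimes> inv g' \<otimes> (g' \<otimes> inv g \<otimes> inv h) = g' \<otimes> h \<otimes> inv g' \<otimes> g \<otimes> inv g' \<otimes> (g' \<otimes> inv g \<otimes> inv h)"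
      using that(1-3) by (simp add: word_simps)
    then show ?thesis using that(1-3) by (simp add: word_simps)
  qed
  have two: "g \<otimes> h \<otimes> inv g \<otimes> inv h = g \<otimes> h' \<otimes> inv g \<otimes> inv h'"
    if "g \<in> carrier G" "h \<in> carrier G" "h' \<in> carrier G" and "inner h = inner h'" for g h h'
  proof -
    have "inv (h \<otimes> g \<otimes> inv h \<otimes> inv g) = inv (h' \<otimes> g \<otimes> inv h' \<otimes> inv g)"
      using one[OF that(2,3,1,4)] by simp
    then show ?thesis unfolding commutator_inv[OF that(2,1)] commutator_inv[OF that(3,1)] .
  qed
  have "{g \<otimes> h \<otimes> inv g \<otimes> inv h | g h. g \<in> carrier G \<and> h \<in> carrier G}
    \<subseteq> (\<lambda>(c, d). s c \<otimes> s d \<otimes> inv (s c) \<otimes> inv (s d)) ` (inner ` carrier G \<times> inner ` carrier G)"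
  proof safe
    fix g h assume g: "g \<in> carrier G" and h: "h \<in> carrier G"
    have "g \<otimes> h \<otimes> inv g \<otimes> inv h = s (inner g) \<otimes> h \<otimes> inv (s (inner g)) \<otimes> inv h"
      by (rule one[OF g s(1)[OF g] h s(2)[OF g, symmetric]])
    also have "\<dots> = s (inner g) \<otimes> s (inner h) \<otimes> inv (s (inner g)) \<otimes> inv (s (inner h))"
      by (rule two[OF s(1)[OF g] h s(1)[OF h] s(2)[OF h, symmetric]])
    finally have "g \<otimes> h \<otimes> inv g \<otimes> inv h
      = (\<lambda>(c, d). s c \<otimes> s d \<otimes> inv (s c) \<otimes> inv (s d)) (inner g, inner h)" by simp
    moreover have "(inner g, inner h) \<in> inner ` carrier G \<times> inner ` carrier G" using g h by simp
    ultimately show "g \<otimes> h \<otimes> inv g \<otimes> inv h \<in> (\<lambda>(c, d). s c \<otimes> s d \<otimes> inv (s c) \<otimes> inv (s d)) ` (inner ` carrier G \<times> inner ` carrier G)"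
      by (rule image_eqI)
  qed
  then show ?thesis by (rule finite_subset) (use finite_inner in auto)
qed

text \<open>
  The derived subgroup \<open>A\<close> of \<open>M\<close> is abelian and generated by finitely many commutators of finite order,
  so it is finite. Over \<open>A\<close>, the group \<open>M\<close> is again generated by finitely many commutators of finite
  order.
\<close>

lemma finite_M: "finite M"
proof -
  let ?T = "{g \<otimes> h \<otimes> inv g \<otimes> inv h | g h. g \<in> carrier G \<and> h \<in> carrier G}"
  let ?T1 = "{g \<otimes> h \<otimes> inv g \<otimes> inv h | g h. g \<in> M \<and> h \<in> M}"
  let ?A = "derived G M"
  have TM: "?T \<subseteq> M" using commutator_in_derived derived_eq_M by blast
  have T1T: "?T1 \<subseteq> ?T" using M.mem_carrier by blast
  have A: "subgroup ?A G" by (rule derived_is_subgroup[OF M.subset])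
  have AM: "?A \<subseteq> M" by (rule derived_incl[OF order_refl M.is_subgroup])
  have T1: "(\<Union>h1\<in>M. \<Union>h2\<in>M. {h1 \<otimes> h2 \<otimes> inv h1 \<otimes> inv h2}) = ?T1" by blast
  have Agen: "?A = generate G ?T1" unfolding derived_def T1 ..
  obtain n where n: "n > 0" "\<And>x. x \<in> M \<Longrightarrow> x [^] (n::nat) = \<one>" using M_exponent by blast
  interpret AG: group "G\<lparr>carrier := ?A\<rparr>" by (rule subgroup_imp_group[OF A])
  have A_central: "a \<otimes> g = g \<otimes> a" if a: "a \<in> ?A" and g: "g \<in> carrier G" for a g
  proof -
    have "generate G ?T1 \<subseteq> {y \<in> carrier G. g \<otimes> y = y \<otimes> g}"
    proof (rule generate_subgroup_incl[OF _ centralizer_subgroup[OF g]], safe)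
      fix m m' assume m: "m \<in> M" "m' \<in> M"
      show "m \<otimes> m' \<otimes> inv m \<otimes> inv m' \<in> carrier G" using M.mem_carrier[OF m(1)] M.mem_carrier[OF m(2)] by simp
      show "g \<otimes> (m \<otimes> m' \<otimes> inv m \<otimes> inv m') = m \<otimes> m' \<otimes> inv m \<otimes> inv m' \<otimes> g"
        by (rule M_commutator_central[OF m g, symmetric])
    qed
    then show ?thesis using a unfolding Agen by auto
  qed
  have "finite ?A"
  proof -
    interpret AC: comm_group "G\<lparr>carrier := ?A\<rparr>"
      by (rule AG.group_comm_groupI) (use A_central subgroup.mem_carrier[OF A] in simp)
    have der: "derived (G\<lparr>carrier := ?A\<rparr>) (carrier (G\<lparr>carrier := ?A\<rparr>)) \<subseteq> {\<one>\<^bsub>G\<lparr>carrier := ?A\<rparr>\<^esub>}"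
      using AC.derived_eq_singleton by simp
    have T1A: "?T1 \<subseteq> ?A" unfolding Agen by (auto intro: generate.incl)
    obtain U where U: "subgroup U (G\<lparr>carrier := ?A\<rparr>)" "finite U" "?T1 \<subseteq> U"
    proof (rule AG.finite_subgroup_over_derived[OF finite_subset[OF T1T finite_commutators] _ _ AG.triv_subgroup _ der])
      show "?T1 \<subseteq> carrier (G\<lparr>carrier := ?A\<rparr>)" using T1A by simp
      show "\<exists>n>0. t [^]\<^bsub>G\<lparr>carrier := ?A\<rparr>\<^esub> (n::nat) = \<one>\<^bsub>G\<lparr>carrier := ?A\<rparr>\<^esub>" if "t \<in> ?T1" for t
        using n T1T TM that by (intro exI[of _ n]) (auto simp flip: nat_pow_consistent)
    qed auto
    have "subgroup U G" by (rule incl_subgroup[OF A U(1)])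
    then have "?A \<subseteq> U" unfolding Agen using U(3) by (rule generate_subgroup_incl[rotated])
    then show "finite ?A" using U(2) by (rule finite_subset)
  qed
  interpret MG: group "G\<lparr>carrier := M\<rparr>" by (rule subgroup_imp_group[OF M.is_subgroup])
  have Asub: "subgroup ?A (G\<lparr>carrier := M\<rparr>)" by (rule subgroup_incl[OF A M.is_subgroup AM])
  have der: "derived (G\<lparr>carrier := M\<rparr>) (carrier (G\<lparr>carrier := M\<rparr>)) \<subseteq> ?A"
    using derived_consistent[OF order_refl M.is_subgroup] by simp
  obtain U where U: "subgroup U (G\<lparr>carrier := M\<rparr>)" "finite U" "?T \<subseteq> U"
  proof (rule MG.finite_subgroup_over_derived[OF finite_commutators _ _ Asub \<open>finite ?A\<close> der])
    show "?T \<subseteq> carrier (G\<lparr>carrier := M\<rparr>)" using TM by simp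
    show "\<exists>n>0. t [^]\<^bsub>G\<lparr>carrier := M\<rparr>\<^esub> (n::nat) = \<one>\<^bsub>G\<lparr>carrier := M\<rparr>\<^esub>" if "t \<in> ?T" for t
      using n TM that by (intro exI[of _ n]) (auto simp flip: nat_pow_consistent)
  qed auto
  have "subgroup U G" by (rule incl_subgroup[OF M.is_subgroup U(1)])
  then have "generate G ?T \<subseteq> U" using U(3) by (rule generate_subgroup_incl[rotated])
  moreover have "generate G ?T = M"
  proof -
    have "(\<Union>h1\<in>carrier G. \<Union>h2\<in>carrier G. {h1 \<otimes> h2 \<otimes> inv h1 \<otimes> inv h2}) = ?T" by blast
    then show ?thesis using derived_eq_M unfolding derived_def by simp
  qed
  ultimately show ?thesis using U(2) finite_subset by simp
qed

lemma finite_G: "finite (carrier G)"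
proof -
  have "finite K" using ord_b generate_pow_card[OF b] generate_b q
    by (metis card.infinite not_prime_0 power_not_zero)
  then have "finite ((\<lambda>(m, y). m \<otimes> y) ` (M \<times> K))" using finite_M by simp
  moreover have "carrier G \<subseteq> (\<lambda>(m, y). m \<otimes> y) ` (M \<times> K)"
  proof
    fix g assume "g \<in> carrier G"
    then have "g \<in> M <#> K" using semidirect_M_K by (simp add: semidirect_of_def)
    then obtain m y where "m \<in> M" "y \<in> K" "g = m \<otimes> y" unfolding set_mult_def by blast
    then show "g \<in> (\<lambda>(m, y). m \<otimes> y) ` (M \<times> K)" by (intro image_eqI[of _ _ "(m, y)"]) simp_all
  qed
  ultimately show ?thesis by (rule finite_subset[rotated])
qed

lemma card_M: "\<exists>j. card M = p ^ j"
proof -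
  interpret MG: group "G\<lparr>carrier := M\<rparr>" by (rule subgroup_imp_group[OF M.is_subgroup])
  obtain j where "card (carrier (G\<lparr>carrier := M\<rparr>)) = p ^ j"
    by (rule MG.exponent_imp_prime_power_order[OF p, of "k + k"])
      (use finite_M M_exponent_prime_power in \<open>auto simp flip: nat_pow_consistent\<close>)
  then show ?thesis by auto
qed

text \<open>
  \<open>G\<close> is generated by \<open>b\<close> and its derived subgroup \<open>M\<close>, so it would be abelian.
\<close>

lemma not_nilpotent: "\<not> nilpotent_group G"
proof
  assume nil: "nilpotent_group G"
  let ?R = "generate G (insert b (derived G (carrier G)))"
  have R: "subgroup ?R G" by (rule generate_is_subgroup) (use b derived_in_carrier in auto)
  have "carrier G \<subseteq> ?R"
  proof
    fix g assume "g \<in> carrier G"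
    then obtain m i where m: "m \<in> M" "g = m \<otimes> b [^] (i::int)" using decompose by blast
    have "m \<in> ?R" using m(1) derived_eq_M by (auto intro: generate.incl)
    moreover have "b [^] i \<in> ?R" by (rule subgroup_int_pow_closed[OF R]) (auto intro: generate.incl)
    ultimately show "g \<in> ?R" unfolding m(2) by (rule subgroup.m_closed[OF R])
  qed
  then have "x \<otimes> b = b \<otimes> x" if "x \<in> M" for x
    using nilpotent_cyclic_mod_derived[OF nil b _ M.mem_carrier[OF that] b] by blast
  then show False using b_not_central by blast
qed

lemma b_int_power_q_central:
  assumes i: "int q dvd i" and g: "g \<in> carrier G"
  shows "b [^] i \<otimes> g = g \<otimes> b [^] i"
proof -
  obtain j where j: "i = int q * j" using i by blast
  have "b [^] q \<in> {y \<in> carrier G. g \<otimes> y = y \<otimes> g}" using b_power_q_central[OF g] b by simp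
  then have "(b [^] q) [^] j \<in> {y \<in> carrier G. g \<otimes> y = y \<otimes> g}"
    by (rule subgroup_int_pow_closed[OF centralizer_subgroup[OF g]])
  moreover have "(b [^] q) [^] j = b [^] i" unfolding j using b by (simp add: int_pow_pow flip: int_pow_int)
  ultimately show ?thesis by simp
qed

lemma central_factor_commutator:
  assumes x: "x \<in> carrier G" "z \<in> carrier G" "\<And>g. g \<in> carrier G \<Longrightarrow> z \<otimes> g = g \<otimes> z"
    and y: "y \<in> carrier G" "w \<in> carrier G" "\<And>g. g \<in> carrier G \<Longrightarrow> w \<otimes> g = g \<otimes> w"
  shows "(x \<otimes> z) \<otimes> (y \<otimes> w) \<otimes> inv (x \<otimes> z) \<otimes> inv (y \<otimes> w) = x \<otimes> y \<otimes> inv x \<otimes> inv y"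
proof -
  have "z \<otimes> (y \<otimes> w \<otimes> inv z) = (y \<otimes> w \<otimes> inv z) \<otimes> z" by (rule x(3)) (use x(1,2) y(1,2) in simp)
  then have 1: "z \<otimes> (y \<otimes> w \<otimes> inv z) = y \<otimes> w" using x(1,2) y(1,2) by (simp add: m_assoc)
  have 2: "w \<otimes> (inv x \<otimes> inv w) = inv x"
    using y(3)[of "inv x \<otimes> inv w"] x(1,2) y(1,2) by (simp add: m_assoc)
  have "(x \<otimes> z) \<otimes> (y \<otimes> w) \<otimes> inv (x \<otimes> z) \<otimes> inv (y \<otimes> w) = x \<otimes> (z \<otimes> (y \<otimes> w \<otimes> inv z)) \<otimes> inv x \<otimes> inv w \<otimes> inv y"
    using x(1,2) y(1,2) by (simp add: word_simps)
  also have "\<dots> = x \<otimes> y \<otimes> (w \<otimes> (inv x \<otimes> inv w)) \<otimes> inv y"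
    unfolding 1 using x(1,2) y(1,2) by (simp add: m_assoc)
  finally show ?thesis unfolding 2 .
qed

text \<open>
  Up to central factors, the elements of \<open>L\<close> lie in \<open>M\<close>, which has central commutators.
\<close>

lemma subgroup_nilpotent_if_image_below_b_q:
  assumes L: "subgroup L G" and h: "\<And>h i. h \<in> L \<Longrightarrow> e h = b [^] (i::int) \<Longrightarrow> int q dvd i"
  shows "nilpotent_group (G\<lparr>carrier := L\<rparr>)"
proof -
  interpret LG: group "G\<lparr>carrier := L\<rparr>" by (rule subgroup_imp_group[OF L])
  have LG: "x \<in> carrier G" if "x \<in> L" for x by (rule subgroup.mem_carrier[OF L that])
  have split: "\<exists>m\<in>M. \<exists>z\<in>carrier G. x = m \<otimes> z \<and> (\<forall>g\<in>carrier G. z \<otimes> g = g \<otimes> z)" if x: "x \<in> L" for x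
  proof -
    obtain m i where m: "m \<in> M" "x = m \<otimes> b [^] (i::int)" "e x = b [^] i" using decompose[OF LG[OF x]] by blast
    have "int q dvd i" by (rule h[OF x m(3)])
    then have "\<forall>g\<in>carrier G. b [^] i \<otimes> g = g \<otimes> b [^] i" using b_int_power_q_central by blast
    then show ?thesis using m(1,2) int_pow_closed[OF b, of i] by blast
  qed
  have central: "g \<otimes> (x \<otimes> y \<otimes> inv x \<otimes> inv y) = (x \<otimes> y \<otimes> inv x \<otimes> inv y) \<otimes> g"
    if xy: "x \<in> L" "y \<in> L" and g: "g \<in> carrier G" for x y g
  proof -
    obtain m z where m: "m \<in> M" "z \<in> carrier G" "x = m \<otimes> z" "\<And>g. g \<in> carrier G \<Longrightarrow> z \<otimes> g = g \<otimes> z"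
      using split[OF xy(1)] by blast
    obtain n w where n: "n \<in> M" "w \<in> carrier G" "y = n \<otimes> w" "\<And>g. g \<in> carrier G \<Longrightarrow> w \<otimes> g = g \<otimes> w"
      using split[OF xy(2)] by blast
    have "x \<otimes> y \<otimes> inv x \<otimes> inv y = m \<otimes> n \<otimes> inv m \<otimes> inv n"
      unfolding m(3) n(3)
      by (rule central_factor_commutator[OF M.mem_carrier[OF m(1)] m(2,4) M.mem_carrier[OF n(1)] n(2,4)])
    then show ?thesis using M_commutator_central[OF m(1) n(1) g] by simp
  qed
  show ?thesis
    by (rule LG.nilpotent_if_derived_central)
      (use central LG in \<open>simp add: m_inv_consistent[OF L]\<close>)
qed

lemma M_I: "x \<in> carrier G \<Longrightarrow> e x = \<one> \<Longrightarrow> x \<in> M"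
  unfolding M_iff by blast

lemma power_onto:
  assumes h: "h \<in> carrier G" "e h = b [^] (i::int)" and i: "\<not> int q dvd i"
  shows "\<exists>t::int. e (h [^] t) = b [^] (n::int)"
proof -
  have "coprime i (int (q ^ v))"
    using q i by (metis coprime_commute coprime_power_right_iff of_nat_power prime_imp_coprime prime_nat_int_transfer)
  then obtain t where t: "[i * t = 1] (mod int (q ^ v))" using cong_solve_coprime_int by blast
  then have "[i * t * n = n] (mod int (q ^ v))" using cong_scalar_right[OF t, of n] by simp
  then have "int (q ^ v) dvd n - i * t * n" by (metis cong_iff_dvd_diff cong_sym)
  then have "b [^] (i * t * n) = b [^] n" using int_pow_eq[OF b] ord_b by simp
  moreover have "e (h [^] (t * n)) = b [^] (i * t * n)"
    unfolding e.hom_int_pow[OF h(1)] h(2) int_pow_pow[OF b] by (simp add: mult.assoc)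
  ultimately show ?thesis by metis
qed

text \<open>
  Let \<open>L0 = L \<inter> M\<close>. Conjugation by \<open>h\<close> maps \<open>L0\<close> to itself and acts on \<open>F\<close> as \<open>b\<^sup>i\<close> does, because \<open>F\<close> is
  abelian. So the image of \<open>L0\<close> in \<open>F\<close> is trivial or all of \<open>F\<close>. In the first case \<open>L0\<close> is central and
  \<open>L\<close>, which is \<open>L0\<close> times powers of \<open>h\<close>, is abelian. In the second case \<open>G\<close> is covered by \<open>L\<close> and the
  centre, so that \<open>L\<close> contains \<open>G' = M\<close>, and with \<open>h\<close> all of \<open>G\<close>.
\<close>

lemma proper_subgroup_nilpotent_if_image_above_b_q:
  assumes L: "subgroup L G" "L \<noteq> carrier G" and h: "h \<in> L" "e h = b [^] (i::int)" and i: "\<not> int q dvd i"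
  shows "nilpotent_group (G\<lparr>carrier := L\<rparr>)"
proof -
  interpret L: subgroup L G by (rule L(1))
  interpret LG: group "G\<lparr>carrier := L\<rparr>" by (rule subgroup_imp_group[OF L(1)])
  have hG: "h \<in> carrier G" using h(1) by (rule L.mem_carrier)
  define L0 where "L0 = L \<inter> M"
  have L0: "subgroup L0 G" unfolding L0_def by (rule subgroups_Inter_pair[OF L(1) M.is_subgroup])
  interpret L0: subgroup L0 G by (rule L0)
  define m where "m = h \<otimes> inv (b [^] i)"
  have m: "m \<in> M" unfolding m_def using M_part[OF hG] h(2) by simp
  have mG: "m \<in> carrier G" using m by (rule M.mem_carrier)
  have h_eq: "h = m \<otimes> b [^] i" unfolding m_def using hG b by (simp add: m_assoc)
  let ?c = "inner (b [^] i)" and ?c' = "inner (inv (b [^] i))"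
  have bi: "b [^] i \<in> carrier G" using b by simp
  have cc: "?c \<in> carrier S" "?c' \<in> carrier S" "?c \<cdot> ?c' = \<one>\<^bsub>S\<^esub>" "?c' \<cdot> ?c = \<one>\<^bsub>S\<^esub>"
    using bi inner_r_inv inner_l_inv by (auto intro: inner_End)
  have irreducible: "inner ` L0 = {\<one>\<^bsub>S\<^esub>} \<or> inner ` L0 = F"
  proof (rule S.F_irreducible[OF cc])
    have cb: "?c b = b" using b_powers_commute[of 1 i] b by (simp add: inner_apply m_assoc inv_cancel_left)
    show "e \<cdot> ?c = e"
    proof (rule End_eq_on_b[OF End_mult_closed[OF S.e_closed cc(1)] S.e_closed])
      show "(e \<cdot> ?c) x = e x" if "x \<in> M" for x
        using End_mult_apply[OF M.mem_carrier[OF that], of e ?c] that bi unfolding M_iff by (simp add: inner_apply)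
      show "(e \<cdot> ?c) b = e b" using End_mult_apply[OF b, of e ?c] e_b cb by simp
    qed
    show "?c \<cdot> e = e" by (rule inner_e[OF bi])
    have pow: "?c [^]\<^bsub>S\<^esub> n = inner ((b [^] i) [^] n)" for n :: nat
      by (induction n) (use bi in \<open>simp_all add: inner_one inner_mult\<close>)
    have "(b [^] i) [^] q = b [^] (int q * i)" using b by (simp add: int_pow_pow mult.commute flip: int_pow_int)
    then have "inner ((b [^] i) [^] q) = \<one>\<^bsub>S\<^esub>"
      using inner_eq_one_iff[of "b [^] (int q * i)"] b_int_power_q_central[of "int q * i"] b by simp
    then show "?c [^]\<^bsub>S\<^esub> q = \<one>\<^bsub>S\<^esub>" unfolding pow .
    show "?c \<noteq> \<one>\<^bsub>S\<^esub>"
    proof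
      assume c1: "?c = \<one>\<^bsub>S\<^esub>"
      obtain x where "x \<in> M" "x \<otimes> b [^] i \<noteq> b [^] i \<otimes> x" using b_power_not_central[OF i] by blast
      then show False using kernel_inner[OF bi c1, of x] M.mem_carrier[of x] by simp
    qed
    show "inner ` L0 \<subseteq> F" using inner_M_subset_F by (auto simp: L0_def)
    show "\<one>\<^bsub>S\<^esub> \<in> inner ` L0" unfolding inner_one[symmetric] using L0.one_closed by (rule imageI)
  next
    fix f assume "f \<in> inner ` L0"
    then obtain x where x: "x \<in> L0" "f = inner x" by (rule imageE)
    have xG: "x \<in> carrier G" using x(1) by (rule L0.mem_carrier)
    have "f \<cdot> inner (inv x) = \<one>\<^bsub>S\<^esub>" unfolding x(2) by (rule inner_r_inv[OF xG])
    then show "\<exists>g\<in>inner ` L0. f \<cdot> g = \<one>\<^bsub>S\<^esub>" using L0.m_inv_closed[OF x(1)] by blast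
    have xM: "x \<in> M" and xL: "x \<in> L" using x(1) by (auto simp: L0_def)
    have "?c' \<cdot> f \<cdot> ?c = ?c' \<cdot> inner (inv m \<otimes> x \<otimes> m) \<cdot> ?c"
    proof -
      have "inner (inv m \<otimes> x \<otimes> m) = inner (inv m) \<cdot> (inner x \<cdot> inner m)"
        using mG xG by (simp add: inner_mult m_assoc)
      also have "inner x \<cdot> inner m = inner m \<cdot> inner x"
        by (rule S.F_comm[OF inner_M_subset_F[OF xM] inner_M_subset_F[OF m]])
      also have "inner (inv m) \<cdot> (inner m \<cdot> inner x) = inner x" using mG xG by (simp add: inner_mult inv_cancel_left)
      finally show ?thesis unfolding x(2) by simp
    qed
    also have "\<dots> = inner (inv h \<otimes> x \<otimes> h)"
      unfolding h_eq using mG xG bi by (simp add: inner_mult inv_mult_group m_assoc)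
    also have "\<dots> \<in> inner ` L0"
    proof (rule imageI)
      have "inv h \<otimes> x \<otimes> h \<in> L" using h(1) xL by blast
      moreover have "inv h \<otimes> x \<otimes> h \<in> M" by (rule M.inv_op_closed1[OF hG xM])
      ultimately show "inv h \<otimes> x \<otimes> h \<in> L0" by (simp add: L0_def)
    qed
    finally show "?c' \<cdot> f \<cdot> ?c \<in> inner ` L0" .
    fix g assume "g \<in> inner ` L0"
    then obtain y where y: "y \<in> L0" "g = inner y" by (rule imageE)
    have "f \<cdot> g = inner (x \<otimes> y)" unfolding x(2) y(2) by (rule inner_mult[OF xG L0.mem_carrier[OF y(1)]])
    then show "f \<cdot> g \<in> inner ` L0" using L0.m_closed[OF x(1) y(1)] by blast
  qed
  have L_split: "\<exists>x\<in>L0. \<exists>j::int. l = x \<otimes> h [^] j" if l: "l \<in> L" for l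
  proof -
    have lG: "l \<in> carrier G" using l by (rule L.mem_carrier)
    obtain n where n: "e l = b [^] (n::int)" using K_powers[OF e_in_K[OF lG]] by blast
    obtain t where eh: "e (h [^] (t::int)) = b [^] n" using power_onto[OF hG h(2) i] by blast
    have hL: "h [^] t \<in> L" by (rule subgroup_int_pow_closed[OF L(1) h(1)])
    have "e (l \<otimes> inv (h [^] t)) = \<one>" using lG hG n eh b by simp
    then have "l \<otimes> inv (h [^] t) \<in> M" by (rule M_I[rotated]) (use lG hG in simp)
    moreover have "l \<otimes> inv (h [^] t) \<in> L" using l hL by blast
    moreover have "l = (l \<otimes> inv (h [^] t)) \<otimes> h [^] t" using lG hG by (simp add: m_assoc)
    ultimately show ?thesis unfolding L0_def by blast
  qed
  from irreducible show ?thesis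
  proof
    assume triv: "inner ` L0 = {\<one>\<^bsub>S\<^esub>}"
    have L0c: "x \<otimes> g = g \<otimes> x" if "x \<in> L0" "g \<in> carrier G" for x g
      using kernel_inner[of x g] triv that L0.mem_carrier by blast
    have comm: "l \<otimes> l' = l' \<otimes> l" if "l \<in> L" "l' \<in> L" for l l'
    proof -
      obtain x j where x: "x \<in> L0" "l = x \<otimes> h [^] (j::int)" using L_split \<open>l \<in> L\<close> by blast
      obtain y n where y: "y \<in> L0" "l' = y \<otimes> h [^] (n::int)" using L_split \<open>l' \<in> L\<close> by blast
      have G: "x \<in> carrier G" "y \<in> carrier G" "h [^] j \<in> carrier G" "h [^] n \<in> carrier G"
        using x y L0.mem_carrier hG by auto
      have hh: "h [^] j \<otimes> h [^] n = h [^] n \<otimes> h [^] j"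
        unfolding int_pow_mult[OF hG, symmetric] by (simp add: add.commute)
      have "l \<otimes> l' = x \<otimes> (h [^] j \<otimes> (y \<otimes> h [^] n))" unfolding x(2) y(2) using G by (simp add: m_assoc)
      also have "\<dots> = (h [^] j \<otimes> (y \<otimes> h [^] n)) \<otimes> x" by (rule L0c[OF x(1)]) (use G in simp)
      also have "\<dots> = (h [^] j \<otimes> y) \<otimes> h [^] n \<otimes> x" using G by (simp add: m_assoc)
      also have "h [^] j \<otimes> y = y \<otimes> h [^] j" using L0c[OF y(1) G(3)] by simp
      also have "y \<otimes> h [^] j \<otimes> h [^] n \<otimes> x = y \<otimes> (h [^] j \<otimes> h [^] n) \<otimes> x" using G by (simp add: m_assoc)
      also have "\<dots> = y \<otimes> h [^] n \<otimes> (h [^] j \<otimes> x)" unfolding hh using G by (simp add: m_assoc)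
      also have "h [^] j \<otimes> x = x \<otimes> h [^] j" using L0c[OF x(1) G(3)] by simp
      finally show ?thesis unfolding x(2) y(2) .
    qed
    show ?thesis
    proof (rule LG.nilpotent_if_derived_central)
      fix x y z assume "x \<in> carrier (G\<lparr>carrier := L\<rparr>)" "y \<in> carrier (G\<lparr>carrier := L\<rparr>)" "z \<in> carrier (G\<lparr>carrier := L\<rparr>)"
      then have L: "x \<in> L" "y \<in> L" "z \<in> L" by simp_all
      then have "x \<otimes> y \<otimes> inv x \<otimes> inv y \<in> L" by blast
      from comm[OF L(3) this] show "z \<otimes>\<^bsub>G\<lparr>carrier := L\<rparr>\<^esub>
           (x \<otimes>\<^bsub>G\<lparr>carrier := L\<rparr>\<^esub> y \<otimes>\<^bsub>G\<lparr>carrier := L\<rparr>\<^esub> inv\<^bsub>G\<lparr>carrier := L\<rparr>\<^esub> x \<otimes>\<^bsub>G\<lparr>carrier := L\<rparr>\<^esub> inv\<^bsub>G\<lparr>carrier := L\<rparr>\<^esub> y) =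
           x \<otimes>\<^bsub>G\<lparr>carrier := L\<rparr>\<^esub> y \<otimes>\<^bsub>G\<lparr>carrier := L\<rparr>\<^esub> inv\<^bsub>G\<lparr>carrier := L\<rparr>\<^esub> x \<otimes>\<^bsub>G\<lparr>carrier := L\<rparr>\<^esub> inv\<^bsub>G\<lparr>carrier := L\<rparr>\<^esub> y \<otimes>\<^bsub>G\<lparr>carrier := L\<rparr>\<^esub> z"
        using L by (simp add: m_inv_consistent[OF L.is_subgroup])
    qed
  next
    assume full: "inner ` L0 = F"
    have M_split: "\<exists>x\<in>L. \<exists>z\<in>carrier G. n = x \<otimes> z \<and> (\<forall>g\<in>carrier G. z \<otimes> g = g \<otimes> z)" if n: "n \<in> M" for n
    proof -
      have nG: "n \<in> carrier G" using n by (rule M.mem_carrier)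
      obtain x where x: "x \<in> L0" "inner n = inner x" using inner_M_subset_F[OF n] full by blast
      have xG: "x \<in> carrier G" using x(1) by (rule L0.mem_carrier)
      have c: "\<forall>g\<in>carrier G. (n \<otimes> inv x) \<otimes> g = g \<otimes> (n \<otimes> inv x)" using inner_eq_iff[OF nG xG] x(2) by simp
      have "n = (n \<otimes> inv x) \<otimes> x" using nG xG by (simp add: m_assoc)
      also have "\<dots> = x \<otimes> (n \<otimes> inv x)" using c xG by simp
      finally show ?thesis using c x(1) nG xG unfolding L0_def by blast
    qed
    have G_split: "\<exists>x\<in>L. \<exists>z\<in>carrier G. g = x \<otimes> z \<and> (\<forall>g\<in>carrier G. z \<otimes> g = g \<otimes> z)" if g: "g \<in> carrier G" for g
    proof -
      obtain n where n: "e g = b [^] (n::int)" using K_powers[OF e_in_K[OF g]] by blast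
      obtain t where eh: "e (h [^] (t::int)) = b [^] n" using power_onto[OF hG h(2) i] by blast
      let ?y = "h [^] t"
      have yL: "?y \<in> L" by (rule subgroup_int_pow_closed[OF L(1) h(1)])
      have yG: "?y \<in> carrier G" using hG by simp
      have "inv ?y \<otimes> g \<in> M" by (rule M_I) (use g yG n eh b in simp_all)
      then obtain x z where x: "x \<in> L" "z \<in> carrier G" "inv ?y \<otimes> g = x \<otimes> z" "\<forall>g\<in>carrier G. z \<otimes> g = g \<otimes> z"
        using M_split by blast
      have "g = ?y \<otimes> (inv ?y \<otimes> g)" using g yG by (simp add: inv_cancel_left)
      then have "g = (?y \<otimes> x) \<otimes> z" unfolding x(3) using yG L.mem_carrier[OF x(1)] x(2) by (simp add: m_assoc)
      moreover have "?y \<otimes> x \<in> L" using yL x(1) by blast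
      ultimately show ?thesis using x(2,4) by blast
    qed
    have "derived G (carrier G) \<subseteq> L"
      unfolding derived_def
    proof (rule generate_subgroup_incl[OF _ L(1)], safe)
      fix g g' assume g: "g \<in> carrier G" "g' \<in> carrier G"
      obtain x z where x: "x \<in> L" "z \<in> carrier G" "g = x \<otimes> z" "\<And>u. u \<in> carrier G \<Longrightarrow> z \<otimes> u = u \<otimes> z"
        using G_split[OF g(1)] by blast
      obtain y w where y: "y \<in> L" "w \<in> carrier G" "g' = y \<otimes> w" "\<And>u. u \<in> carrier G \<Longrightarrow> w \<otimes> u = u \<otimes> w"
        using G_split[OF g(2)] by blast
      have "g \<otimes> g' \<otimes> inv g \<otimes> inv g' = x \<otimes> y \<otimes> inv x \<otimes> inv y"
        unfolding x(3) y(3)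
        by (rule central_factor_commutator[OF L.mem_carrier[OF x(1)] x(2,4) L.mem_carrier[OF y(1)] y(2,4)])
      then show "g \<otimes> g' \<otimes> inv g \<otimes> inv g' \<in> L" using x(1) y(1) by auto
    qed
    then have M_L: "M \<subseteq> L" using derived_eq_M by simp
    have "carrier G \<subseteq> L"
    proof
      fix g assume g: "g \<in> carrier G"
      obtain n where n: "e g = b [^] (n::int)" using K_powers[OF e_in_K[OF g]] by blast
      obtain t where eh: "e (h [^] (t::int)) = b [^] n" using power_onto[OF hG h(2) i] by blast
      have yL: "h [^] t \<in> L" by (rule subgroup_int_pow_closed[OF L(1) h(1)])
      have "g \<otimes> inv (h [^] t) \<in> M" by (rule M_I) (use g hG n eh b in simp_all)
      then have "(g \<otimes> inv (h [^] t)) \<otimes> h [^] t \<in> L" using M_L yL by blast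
      then show "g \<in> L" using g hG by (simp add: m_assoc)
    qed
    then show ?thesis using L(2) L.subset by blast
  qed
qed

lemma Schmidt: "Schmidt_group G"
  unfolding Schmidt_group_def
proof (intro conjI allI impI)
  show "group G" by (rule is_group)
  show "finite (carrier G)" by (rule finite_G)
  show "\<not> nilpotent_group G" by (rule not_nilpotent)
  fix L assume L: "subgroup L G \<and> L \<noteq> carrier G"
  show "nilpotent_group (G\<lparr>carrier := L\<rparr>)"
  proof (cases "\<exists>h i. h \<in> L \<and> e h = b [^] (i::int) \<and> \<not> int q dvd i")
    case True
    then show ?thesis using proper_subgroup_nilpotent_if_image_above_b_q L by blast
  next
    case False
    then show ?thesis using subgroup_nilpotent_if_image_below_b_q L by blast
  qed
qed

theorem Schmidt_with_parameters: "Schmidt_group_with_parameters G p q v"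
  unfolding Schmidt_group_with_parameters_def derived_eq_M
  using Schmidt p q pq v card_M b generate_b generate_pow_card[OF b] ord_b semidirect_M_K by metis

end

section \<open>Groups with isomorphic endomorphism monoids\<close>

theorem theorem3p2:
  fixes G :: "('a, 'm) monoid_scheme" and H :: "('b, 'n) monoid_scheme"
    and p q v :: nat
  assumes "Factorial_Ring.prime p" and "Factorial_Ring.prime q" and "p \<noteq> q" and "v \<ge> 1"
    and "Schmidt_group_with_parameters G p q v"
    and "group H"
    and "End_semigroup G \<cong> End_semigroup H"
  shows "Schmidt_group_with_parameters H p q v"
proof -
  obtain k b where split: "schmidt_split G p q v k b"
    using assms(5) unfolding Schmidt_group_with_parameters_def schmidt_split_def schmidt_split_axioms_def Schmidt_group_def
    by blast
  define e and F where "e = schmidt_split.e G b" and "F = schmidt_split.F G"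
  obtain j where G: "schmidt_monoid (End_semigroup G) p q v j e F"
    using schmidt_split.End_schmidt_monoid[OF split] unfolding e_def F_def by (rule exE)
  obtain \<phi> where phi: "\<phi> \<in> iso (End_semigroup G) (End_semigroup H)" using assms(7) unfolding is_iso_def by blast
  have "schmidt_monoid (End_semigroup H) p q v j (\<phi> e) (\<phi> ` F)"
    by (rule schmidt_monoid_iso[OF G group.End_monoid[OF assms(6)] phi])
  then have "schmidt_End H p q v j (\<phi> e) (\<phi> ` F)"
    using assms unfolding schmidt_End_def schmidt_End_axioms_def by blast
  then show ?thesis by (rule schmidt_End.Schmidt_with_parameters)
qed

end
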